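(* Let $\gamma\in\mathbb{R}$ and $\mu>0$, and let $\mathcal{A}_\mu$, $\mu_l^0(\gamma)$ and $E_\mu^{(1)}$ be as defined in the context. (A) If $\gamma\le 0$, then for any $\mu>0$ the equality $\min\sigma_{\rm ess}(\mathcal{A}_\mu)=E_\mu^{(1)}$ holds with $E_\mu^{(1)}<0$. (B) Let $\gamma>0$. (B$_1$) If $\mu\in(0,\mu_l^0(\gamma)]$, then $\min\sigma_{\rm ess}(\mathcal{A}_\mu)=0$. (B$_2$) If $\mu>\mu_l^0(\gamma)$, then $\min\sigma_{\rm ess}(\mathcal{A}_\mu)=E_\mu^{(1)}$ with $E_\mu^{(1)}<0$.
   Context: $\mathbb{T}^3$ is the three-dimensional torus, i.e. the cube $(-\pi,\pi]^3$ with appropriately identified sides, equipped with its Haar measure (Lebesgue measure $dt$ on the cube); addition and multiplication by real numbers are regarded as operations on $\mathbb{R}^3$ modulo $(2\pi\mathbb{Z})^3$, and $\tfrac12(k+p)$ is computed from the representatives of $k,p$ in $(-\pi,\pi]^3$. Write $\overline{0}=(0,0,0)$. Let $\mathcal{H}_0=\mathbb{C}$, $\mathcal{H}_1=L_2(\mathbb{T}^3)$, $\mathcal{H}_2=L_2^{\rm s}((\mathbb{T}^3)^2)$ (square integrable complex functions symmetric in their two variables), $\mathcal{H}=\mathcal{H}_1\oplus\mathcal{H}_2$. Put $$\varepsilon(k)=\sum_{i=1}^3(1-\cos k_i),\quad w_1(k)=\varepsilon(k)+\gamma,\quad w_2(k,p)=\varepsilon(k)+\varepsilon\big(\tfrac12(k+p)\big)+\varepsilon(p).$$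 For $\mu>0$, $\mathcal{A}_\mu$ is the bounded self-adjoint operator in $\mathcal{H}$ $$\mathcal{A}_\mu=\begin{pmatrix}A_{11}&\mu A_{12}\\ \mu A_{12}^*&A_{22}\end{pmatrix},\quad (A_{11}f_1)(k)=w_1(k)f_1(k),\quad (A_{12}f_2)(k)=\int_{\mathbb{T}^3}f_2(k,t)\,dt,\quad (A_{22}f_2)(k,p)=w_2(k,p)f_2(k,p),$$ with $(A_{12}^*f_1)(k,p)=\frac12(f_1(k)+f_1(p))$. For $k\in\mathbb{T}^3$, $\mathcal{A}_\mu(k)$ is the bounded self-adjoint operator in $\mathcal{H}_0\oplus\mathcal{H}_1$ $$\mathcal{A}_\mu(k)=\begin{pmatrix}A_{00}(k)&\mu A_{01}\\ \mu A_{01}^*&A_{11}(k)\end{pmatrix},\quad A_{00}(k)f_0=w_1(k)f_0,\quad A_{01}f_1=\frac1{\sqrt2}\int_{\mathbb{T}^3}f_1(t)\,dt,\quad (A_{11}(k)f_1)(p)=w_2(k,p)f_1(p).$$ $\sigma_{\rm ess}$ and $\sigma_{\rm disc}$ denote the essential and discrete spectrum. Set $\Lambda_\mu=\bigcup_{k\in\mathbb{T}^3}\sigma_{\rm disc}(\mathcal{A}_\mu(k))$. Let $I(\overline0,0)=\int_{\mathbb{T}^3}\frac{dt}{w_2(\overline0,t)}$ (which is finite), and $$\mu_l^0(\gamma)=\sqrt{2\gamma}\;I(\overline0,0)^{-1/2}\quad(\gamma>0),\qquad E_\mu^{(1)}=\min\{\Lambda_\mu\cap(-\infty,0]\}.$$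 *)

theory Defs
  imports "HOL-Analysis.Analysis"
begin

class complex_normed_vector = real_normed_vector +
  fixes scaleC :: "complex \<Rightarrow> 'a \<Rightarrow> 'a"  (infixr "*\<^sub>C" 75)
  assumes scaleC_add_right: "a *\<^sub>C (x + y) = a *\<^sub>C x + a *\<^sub>C y"
    and scaleC_add_left: "(a + b) *\<^sub>C x = a *\<^sub>C x + b *\<^sub>C x"
    and scaleC_scaleC: "a *\<^sub>C (b *\<^sub>C x) = (a * b) *\<^sub>C x"
    and scaleC_of_real: "complex_of_real r *\<^sub>C x = r *\<^sub>R x"
    and norm_scaleC: "norm (a *\<^sub>C x) = cmod a * norm x"

instantiation complex :: complex_normed_vector
begin
definition scaleC_complex :: "complex \<Rightarrow> complex \<Rightarrow> complex"
  where "scaleC_complex = (*)"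
instance
  by standard
    (simp_all add: scaleC_complex_def distrib_left distrib_right norm_mult scaleR_conv_of_real)
end

instantiation prod :: (complex_normed_vector, complex_normed_vector) complex_normed_vector
begin
definition scaleC_prod :: "complex \<Rightarrow> 'a \<times> 'b \<Rightarrow> 'a \<times> 'b"
  where "scaleC_prod a x = (a *\<^sub>C fst x, a *\<^sub>C snd x)"
instance
proof
  fix a b :: complex and r :: real and x y :: "'a \<times> 'b"
  show "a *\<^sub>C (x + y) = a *\<^sub>C x + a *\<^sub>C y" "(a + b) *\<^sub>C x = a *\<^sub>C x + b *\<^sub>C x"
    "a *\<^sub>C (b *\<^sub>C x) = (a * b) *\<^sub>C x"
    by (simp_all add: scaleC_prod_def scaleC_add_right scaleC_add_left scaleC_scaleC)
  show "complex_of_real r *\<^sub>C x = r *\<^sub>R x"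
    by (simp add: scaleC_prod_def scaleC_of_real scaleR_prod_def)
  have "(norm (a *\<^sub>C x))\<^sup>2 = (cmod a * norm x)\<^sup>2"
    by (simp add: scaleC_prod_def norm_prod_def norm_scaleC power_mult_distrib distrib_left)
  then show "norm (a *\<^sub>C x) = cmod a * norm x"
    by (simp add: power2_eq_iff_nonneg)
qed
end

definition resolvent_set :: "('a::complex_normed_vector \<Rightarrow> 'a) \<Rightarrow> complex set" where
  "resolvent_set A =
     {z. bij (\<lambda>x. A x - z *\<^sub>C x) \<and> bounded_linear (inv (\<lambda>x. A x - z *\<^sub>C x))}"

definition spectrum :: "('a::complex_normed_vector \<Rightarrow> 'a) \<Rightarrow> complex set" where
  "spectrum A = - resolvent_set A"

definition eigenspace :: "('a::complex_normed_vector \<Rightarrow> 'a) \<Rightarrow> complex \<Rightarrow> 'a set" where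
  "eigenspace A z = {x. A x = z *\<^sub>C x}"

definition discrete_spectrum :: "('a::complex_normed_vector \<Rightarrow> 'a) \<Rightarrow> complex set" where
  "discrete_spectrum A =
     {z. z isolated_in spectrum A \<and> eigenspace A z \<noteq> {0} \<and>
         (\<exists>B. finite B \<and> eigenspace A z \<subseteq> module.span scaleC B)}"

definition essential_spectrum :: "('a::complex_normed_vector \<Rightarrow> 'a) \<Rightarrow> complex set" where
  "essential_spectrum A = spectrum A - discrete_spectrum A"

text \<open>Spectra are subsets of the complex plane; a minimum is only attributed to a set all of whose
  elements are real.\<close>

definition is_min :: "complex set \<Rightarrow> real \<Rightarrow> bool" where
  "is_min S m \<longleftrightarrow> S \<subseteq> \<real> \<and> complex_of_real m \<in> S \<and> (\<forall>z\<in>S. m \<le> Re z)"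

definition sq_integrable :: "'a measure \<Rightarrow> ('a \<Rightarrow> complex) \<Rightarrow> bool" where
  "sq_integrable M f \<longleftrightarrow> f \<in> borel_measurable M \<and> integrable M (\<lambda>x. (cmod (f x))\<^sup>2)"

lemma sq_integrable_measurable: "sq_integrable M f \<Longrightarrow> f \<in> borel_measurable M"
  by (simp add: sq_integrable_def)

lemma sq_integrable_zero: "sq_integrable M (\<lambda>x. 0)"
  by (simp add: sq_integrable_def)

lemma sq_integrable_mult_bounded:
  assumes f: "sq_integrable M f" and w [measurable]: "w \<in> borel_measurable M"
    and B: "\<And>x. cmod (w x) \<le> B"
  shows "sq_integrable M (\<lambda>x. w x * f x)"
proof -
  have [measurable]: "f \<in> borel_measurable M" using f by (simp add: sq_integrable_def)
  have "integrable M (\<lambda>x. (cmod (w x * f x))\<^sup>2)"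
  proof (rule Bochner_Integration.integrable_bound)
    show "integrable M (\<lambda>x. B\<^sup>2 * (cmod (f x))\<^sup>2)" using f by (simp add: sq_integrable_def)
    show "AE x in M. norm ((cmod (w x * f x))\<^sup>2) \<le> norm (B\<^sup>2 * (cmod (f x))\<^sup>2)"
      by (rule AE_I2) (simp add: norm_mult power_mult_distrib mult_right_mono power_mono[OF B])
  qed measurable
  then show ?thesis by (simp add: sq_integrable_def)
qed

lemma sq_integrable_cmult: "sq_integrable M f \<Longrightarrow> sq_integrable M (\<lambda>x. c * f x)"
  by (rule sq_integrable_mult_bounded[where B = "cmod c"]) auto

lemma sq_integrable_add:
  assumes f: "sq_integrable M f" and g: "sq_integrable M g"
  shows "sq_integrable M (\<lambda>x. f x + g x)"
proof -
  have [measurable]: "f \<in> borel_measurable M" "g \<in> borel_measurable M"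
    using f g by (simp_all add: sq_integrable_def)
  have "integrable M (\<lambda>x. (cmod (f x + g x))\<^sup>2)"
  proof (rule Bochner_Integration.integrable_bound)
    show "integrable M (\<lambda>x. 2 * (cmod (f x))\<^sup>2 + 2 * (cmod (g x))\<^sup>2)"
      using f g by (simp add: sq_integrable_def)
    have "(cmod (f x + g x))\<^sup>2 \<le> 2 * (cmod (f x))\<^sup>2 + 2 * (cmod (g x))\<^sup>2" for x
    proof -
      have "(cmod (f x + g x))\<^sup>2 \<le> (cmod (f x) + cmod (g x))\<^sup>2"
        by (intro power_mono norm_triangle_ineq) simp
      also have "\<dots> \<le> 2 * (cmod (f x))\<^sup>2 + 2 * (cmod (g x))\<^sup>2"
        using sum_squares_bound[of "cmod (f x)" "cmod (g x)"] by (simp add: power2_sum)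
      finally show ?thesis .
    qed
    then show "AE x in M. norm ((cmod (f x + g x))\<^sup>2)
        \<le> norm (2 * (cmod (f x))\<^sup>2 + 2 * (cmod (g x))\<^sup>2)"
      by (intro AE_I2) simp
  qed measurable
  then show ?thesis by (simp add: sq_integrable_def)
qed

lemma sq_integrable_uminus: "sq_integrable M f \<Longrightarrow> sq_integrable M (\<lambda>x. - f x)"
  using sq_integrable_cmult[of M f "-1"] by simp

lemma sq_integrable_diff:
  "sq_integrable M f \<Longrightarrow> sq_integrable M g \<Longrightarrow> sq_integrable M (\<lambda>x. f x - g x)"
  using sq_integrable_add[of M f "\<lambda>x. - g x"] sq_integrable_uminus[of M g] by simp

lemma sq_integrable_inner:
  assumes f: "sq_integrable M f" and g: "sq_integrable M g"
  shows "integrable M (\<lambda>x. f x * cnj (g x))"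
proof (rule Bochner_Integration.integrable_bound)
  have [measurable]: "f \<in> borel_measurable M" "g \<in> borel_measurable M"
    using f g by (simp_all add: sq_integrable_def)
  show "integrable M (\<lambda>x. (cmod (f x))\<^sup>2 + (cmod (g x))\<^sup>2)"
    using f g by (simp add: sq_integrable_def)
  have "cmod (f x) * cmod (g x) \<le> (cmod (f x))\<^sup>2 + (cmod (g x))\<^sup>2" for x
    using sum_squares_bound[of "cmod (f x)" "cmod (g x)"]
      mult_nonneg_nonneg[OF norm_ge_zero[of "f x"] norm_ge_zero[of "g x"]] by linarith
  then show "AE x in M. norm (f x * cnj (g x)) \<le> norm ((cmod (f x))\<^sup>2 + (cmod (g x))\<^sup>2)"
    by (intro AE_I2) (simp add: norm_mult)
  have [measurable]: "cnj \<in> borel_measurable borel"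
    by (intro borel_measurable_continuous_onI continuous_intros)
  show "(\<lambda>x. f x * cnj (g x)) \<in> borel_measurable M" by measurable
qed

lemma sq_integrable_const:
  assumes "finite_measure M" shows "sq_integrable M (\<lambda>x. c)"
proof -
  interpret finite_measure M by fact
  show ?thesis by (simp add: sq_integrable_def)
qed

lemma sq_integrable_integrable:
  assumes "finite_measure M" and f: "sq_integrable M f"
  shows "integrable M f"
  using sq_integrable_inner[OF f sq_integrable_const[OF assms(1), of 1]] by simp

definition L2_rel :: "'a measure \<Rightarrow> ('a \<Rightarrow> complex) \<Rightarrow> ('a \<Rightarrow> complex) \<Rightarrow> bool" where
  "L2_rel M f g \<longleftrightarrow> sq_integrable M f \<and> sq_integrable M g \<and> (AE x in M. f x = g x)"

definition L2_inner :: "'a measure \<Rightarrow> ('a \<Rightarrow> complex) \<Rightarrow> ('a \<Rightarrow> complex) \<Rightarrow> complex" where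
  "L2_inner M f g = (\<integral>x. f x * cnj (g x) \<partial>M)"

lemma L2_rel_symp: "symp (L2_rel M)"
  by (rule sympI) (auto simp: L2_rel_def elim: eventually_mono)

lemma L2_rel_transp: "transp (L2_rel M)"
proof (rule transpI)
  fix f g h assume *: "L2_rel M f g" "L2_rel M g h"
  then have "AE x in M. f x = h x"
    unfolding L2_rel_def by (auto elim: eventually_elim2)
  with * show "L2_rel M f h" by (simp add: L2_rel_def)
qed

lemma L2_inner_cong:
  assumes "L2_rel M f f'" "L2_rel M g g'"
  shows "L2_inner M f g = L2_inner M f' g'"
  unfolding L2_inner_def
proof (rule integral_cong_AE)
  show "AE x in M. f x * cnj (g x) = f' x * cnj (g' x)"
    using assms unfolding L2_rel_def by (auto elim: eventually_elim2)
  show "(\<lambda>x. f x * cnj (g x)) \<in> borel_measurable M" "(\<lambda>x. f' x * cnj (g' x)) \<in> borel_measurable M"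
    using assms by (auto simp: L2_rel_def intro!: borel_measurable_integrable sq_integrable_inner)
qed

lemma L2_inner_add_left:
  "sq_integrable M f \<Longrightarrow> sq_integrable M g \<Longrightarrow> sq_integrable M h \<Longrightarrow>
    L2_inner M (\<lambda>x. f x + g x) h = L2_inner M f h + L2_inner M g h"
  by (simp add: L2_inner_def distrib_right sq_integrable_inner)

lemma L2_inner_cmult_left: "L2_inner M (\<lambda>x. c * f x) g = c * L2_inner M f g"
  by (simp add: L2_inner_def mult.assoc)

lemma L2_inner_cmult_right: "L2_inner M f (\<lambda>x. c * g x) = cnj c * L2_inner M f g"
  by (simp add: L2_inner_def mult.left_commute)

lemma L2_inner_commute: "L2_inner M f g = cnj (L2_inner M g f)"
  unfolding L2_inner_def by (subst Bochner_Integration.integral_cnj[symmetric]) (simp add: mult.commute)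

lemma L2_inner_self: "L2_inner M f f = complex_of_real (\<integral>x. (cmod (f x))\<^sup>2 \<partial>M)"
  by (simp add: L2_inner_def complex_norm_square[symmetric] flip: of_real_power integral_complex_of_real)

lemma L2_inner_eq_0_iff:
  assumes "sq_integrable M f"
  shows "Re (L2_inner M f f) = 0 \<longleftrightarrow> (AE x in M. f x = 0)"
  using assms integral_nonneg_eq_0_iff_AE[of M "\<lambda>x. (cmod (f x))\<^sup>2"]
  by (simp add: L2_inner_self sq_integrable_def)

text \<open>Points of the three-dimensional torus are given by their representatives in the half-open cube.\<close>

definition torus :: "(real^3) set" where
  "torus = {k. \<forall>i. - pi < k $ i \<and> k $ i \<le> pi}"

definition torus_measure :: "(real^3) measure" where
  "torus_measure = restrict_space lborel torus"

abbreviation torus2_measure :: "((real^3) \<times> (real^3)) measure" where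
  "torus2_measure \<equiv> torus_measure \<Otimes>\<^sub>M torus_measure"

lemma torus_borel: "torus \<in> sets borel"
proof -
  have "torus = (\<Inter>i\<in>UNIV. {k. - pi < k $ i} \<inter> {k. k $ i \<le> pi})"
    by (auto simp: torus_def)
  also have "\<dots> \<in> sets borel"
  proof (intro sets.finite_INT sets.Int)
    fix i :: 3
    show "{k::real^3. - pi < k $ i} \<in> sets borel"
      by (intro borel_open open_Collect_less continuous_intros)
    show "{k::real^3. k $ i \<le> pi} \<in> sets borel"
      by (intro borel_closed closed_Collect_le continuous_intros)
  qed auto
  finally show ?thesis .
qed

lemma finite_measure_torus: "finite_measure torus_measure"
proof (rule finite_measureI)
  have "emeasure lborel torus \<le> emeasure lborel (cbox (\<chi> i. - pi) (\<chi> i. pi) :: (real^3) set)"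
    by (rule emeasure_mono) (auto simp: torus_def mem_box_cart less_imp_le)
  then show "emeasure torus_measure (space torus_measure) \<noteq> \<infinity>"
    using emeasure_lborel_cbox_finite[of "(\<chi> i. - pi) :: real^3" "\<chi> i. pi"] torus_borel
    by (auto simp: torus_measure_def emeasure_restrict_space space_restrict_space top_unique)
qed

interpretation torus: finite_measure torus_measure
  by (rule finite_measure_torus)

interpretation torus2: pair_sigma_finite torus_measure torus_measure
  by unfold_locales

lemma finite_measure_torus2: "finite_measure torus2_measure"
  by (intro finite_measure_pair_measure finite_measure_torus)

lemma borel_measurable_torus [measurable (raw)]:
  "f \<in> borel_measurable borel \<Longrightarrow> f \<in> borel_measurable torus_measure"
  unfolding torus_measure_def by (rule measurable_restrict_space1) simp

definition L2_sym_rel :: "((real^3) \<times> (real^3) \<Rightarrow> complex) \<Rightarrow> ((real^3) \<times> (real^3) \<Rightarrow> complex) \<Rightarrow> bool" where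
  "L2_sym_rel f g \<longleftrightarrow> L2_rel torus2_measure f g \<and>
     (AE x in torus2_measure. f (snd x, fst x) = f x) \<and>
     (AE x in torus2_measure. g (snd x, fst x) = g x)"

text \<open>The elements of both types are classes of square integrable functions modulo equality almost
  everywhere; \<open>L2_sym\<close> is the closed subspace of functions symmetric in the two variables.
  The inner product of the class \<^class>\<open>real_inner\<close> is the real part of the complex
  inner product, which gives the same norm and, for complex linear maps, the same adjoints.\<close>

quotient_type L2_torus = "real^3 \<Rightarrow> complex" / partial: "L2_rel torus_measure"
proof (rule part_equivpI)
  show "\<exists>f. L2_rel torus_measure f f"
    by (rule exI[of _ "\<lambda>x. 0"]) (simp add: L2_rel_def sq_integrable_zero)
qed (rule L2_rel_symp L2_rel_transp)+

quotient_type L2_sym = "(real^3) \<times> (real^3) \<Rightarrow> complex" / partial: L2_sym_rel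
proof (rule part_equivpI)
  show "\<exists>f. L2_sym_rel f f"
    by (rule exI[of _ "\<lambda>x. 0"]) (simp add: L2_sym_rel_def L2_rel_def sq_integrable_zero)
  show "symp L2_sym_rel"
    using L2_rel_symp[of torus2_measure] by (auto simp: symp_def L2_sym_rel_def)
  show "transp L2_sym_rel"
    using L2_rel_transp[of torus2_measure] unfolding transp_def L2_sym_rel_def by blast
qed

lemma L2_rel_closure:
  shows "L2_rel M (\<lambda>x. 0) (\<lambda>x. 0)"
    and "L2_rel M f f' \<Longrightarrow> L2_rel M g g' \<Longrightarrow> L2_rel M (\<lambda>x. f x + g x) (\<lambda>x. f' x + g' x)"
    and "L2_rel M f f' \<Longrightarrow> L2_rel M g g' \<Longrightarrow> L2_rel M (\<lambda>x. f x - g x) (\<lambda>x. f' x - g' x)"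
    and "L2_rel M f f' \<Longrightarrow> L2_rel M (\<lambda>x. - f x) (\<lambda>x. - f' x)"
    and "L2_rel M f f' \<Longrightarrow> L2_rel M (\<lambda>x. c * f x) (\<lambda>x. c * f' x)"
  unfolding L2_rel_def
  by (auto intro: sq_integrable_zero sq_integrable_add sq_integrable_diff sq_integrable_uminus
        sq_integrable_cmult elim: eventually_elim2 eventually_mono)

lemma L2_sym_rel_closure:
  shows "L2_sym_rel (\<lambda>x. 0) (\<lambda>x. 0)"
    and "L2_sym_rel f f' \<Longrightarrow> L2_sym_rel g g' \<Longrightarrow> L2_sym_rel (\<lambda>x. f x + g x) (\<lambda>x. f' x + g' x)"
    and "L2_sym_rel f f' \<Longrightarrow> L2_sym_rel g g' \<Longrightarrow> L2_sym_rel (\<lambda>x. f x - g x) (\<lambda>x. f' x - g' x)"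
    and "L2_sym_rel f f' \<Longrightarrow> L2_sym_rel (\<lambda>x. - f x) (\<lambda>x. - f' x)"
    and "L2_sym_rel f f' \<Longrightarrow> L2_sym_rel (\<lambda>x. c * f x) (\<lambda>x. c * f' x)"
  unfolding L2_sym_rel_def
  by (auto intro: L2_rel_closure elim: eventually_elim2 eventually_mono)

instantiation L2_torus :: real_inner
begin

lift_definition zero_L2_torus :: "L2_torus" is "\<lambda>x. 0"
  by (simp add: L2_rel_closure)

lift_definition plus_L2_torus :: "L2_torus \<Rightarrow> L2_torus \<Rightarrow> L2_torus" is "\<lambda>f g x. f x + g x"
  by (simp add: L2_rel_closure)

lift_definition minus_L2_torus :: "L2_torus \<Rightarrow> L2_torus \<Rightarrow> L2_torus" is "\<lambda>f g x. f x - g x"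
  by (simp add: L2_rel_closure)

lift_definition uminus_L2_torus :: "L2_torus \<Rightarrow> L2_torus" is "\<lambda>f x. - f x"
  by (simp add: L2_rel_closure)

lift_definition scaleR_L2_torus :: "real \<Rightarrow> L2_torus \<Rightarrow> L2_torus" is "\<lambda>r f x. complex_of_real r * f x"
  by (simp add: L2_rel_closure)

lift_definition inner_L2_torus :: "L2_torus \<Rightarrow> L2_torus \<Rightarrow> real" is "\<lambda>f g. Re (L2_inner torus_measure f g)"
  by (auto intro!: arg_cong[of _ _ Re] L2_inner_cong)

definition norm_L2_torus :: "L2_torus \<Rightarrow> real" where "norm_L2_torus f = sqrt (inner f f)"
definition dist_L2_torus :: "L2_torus \<Rightarrow> L2_torus \<Rightarrow> real" where "dist_L2_torus f g = norm (f - g)"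
definition sgn_L2_torus :: "L2_torus \<Rightarrow> L2_torus" where "sgn_L2_torus f = inverse (norm f) *\<^sub>R f"
definition uniformity_L2_torus :: "(L2_torus \<times> L2_torus) filter"
  where "uniformity_L2_torus = (INF e\<in>{0<..}. principal {(f, g). dist f g < e})"
definition open_L2_torus :: "L2_torus set \<Rightarrow> bool"
  where "open_L2_torus U \<longleftrightarrow> (\<forall>f\<in>U. eventually (\<lambda>(f', g). f' = f \<longrightarrow> g \<in> U) uniformity)"

instance
proof
  fix f g h :: L2_torus and r r' :: real
  show "dist f g = norm (f - g)" "sgn f = inverse (norm f) *\<^sub>R f" "norm f = sqrt (inner f f)"
    "(uniformity :: (L2_torus \<times> L2_torus) filter) = (INF e\<in>{0<..}. principal {(f, g). dist f g < e})"
    by (simp_all add: dist_L2_torus_def sgn_L2_torus_def norm_L2_torus_def uniformity_L2_torus_def)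
  show "open U \<longleftrightarrow> (\<forall>f\<in>U. eventually (\<lambda>(f', g). f' = f \<longrightarrow> g \<in> U) uniformity)" for U :: "L2_torus set"
    by (rule open_L2_torus_def)
  show "f + g + h = f + (g + h)" "f + g = g + f" "0 + f = f" "- f + f = 0" "f - g = f + - g"
    "r *\<^sub>R (f + g) = r *\<^sub>R f + r *\<^sub>R g" "(r + r') *\<^sub>R f = r *\<^sub>R f + r' *\<^sub>R f"
    "r *\<^sub>R r' *\<^sub>R f = (r * r') *\<^sub>R f" "1 *\<^sub>R f = f"
    by (transfer; simp add: L2_rel_closure add_ac mult.assoc distrib_left distrib_right)+
  show "inner f g = inner g f"
    by transfer (subst L2_inner_commute, simp)
  show "inner (f + g) h = inner f h + inner g h"
    by transfer (simp add: L2_rel_def L2_inner_add_left)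
  show "inner (r *\<^sub>R f) g = r * inner f g"
    by transfer (simp add: L2_inner_cmult_left)
  show "0 \<le> inner f f"
    by transfer (simp add: L2_inner_self)
  show "inner f f = 0 \<longleftrightarrow> f = 0"
    by transfer (auto simp: L2_rel_def L2_inner_eq_0_iff sq_integrable_zero)
qed

end

instantiation L2_torus :: complex_normed_vector
begin

lift_definition scaleC_L2_torus :: "complex \<Rightarrow> L2_torus \<Rightarrow> L2_torus" is "\<lambda>c f x. c * f x"
  by (simp add: L2_rel_closure)

instance
proof
  fix f g :: L2_torus and a b :: complex and r :: real
  show "a *\<^sub>C (f + g) = a *\<^sub>C f + a *\<^sub>C g" "(a + b) *\<^sub>C f = a *\<^sub>C f + b *\<^sub>C f"
    "a *\<^sub>C b *\<^sub>C f = (a * b) *\<^sub>C f" "complex_of_real r *\<^sub>C f = r *\<^sub>R f"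
    by (transfer; simp add: L2_rel_closure add_ac mult.assoc distrib_left distrib_right)+
  have "inner (a *\<^sub>C f) (a *\<^sub>C f) = (cmod a)\<^sup>2 * inner f f"
    by transfer (simp add: L2_inner_self norm_mult power_mult_distrib)
  then show "norm (a *\<^sub>C f) = cmod a * norm f"
    by (simp add: norm_L2_torus_def real_sqrt_mult)
qed

end

instantiation L2_sym :: real_inner
begin

lift_definition zero_L2_sym :: "L2_sym" is "\<lambda>x. 0"
  by (simp add: L2_sym_rel_closure)

lift_definition plus_L2_sym :: "L2_sym \<Rightarrow> L2_sym \<Rightarrow> L2_sym" is "\<lambda>f g x. f x + g x"
  by (simp add: L2_sym_rel_closure)

lift_definition minus_L2_sym :: "L2_sym \<Rightarrow> L2_sym \<Rightarrow> L2_sym" is "\<lambda>f g x. f x - g x"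
  by (simp add: L2_sym_rel_closure)

lift_definition uminus_L2_sym :: "L2_sym \<Rightarrow> L2_sym" is "\<lambda>f x. - f x"
  by (simp add: L2_sym_rel_closure)

lift_definition scaleR_L2_sym :: "real \<Rightarrow> L2_sym \<Rightarrow> L2_sym" is "\<lambda>r f x. complex_of_real r * f x"
  by (simp add: L2_sym_rel_closure)

lift_definition inner_L2_sym :: "L2_sym \<Rightarrow> L2_sym \<Rightarrow> real" is "\<lambda>f g. Re (L2_inner torus2_measure f g)"
  by (auto simp: L2_sym_rel_def intro!: arg_cong[of _ _ Re] L2_inner_cong)

definition norm_L2_sym :: "L2_sym \<Rightarrow> real" where "norm_L2_sym f = sqrt (inner f f)"
definition dist_L2_sym :: "L2_sym \<Rightarrow> L2_sym \<Rightarrow> real" where "dist_L2_sym f g = norm (f - g)"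
definition sgn_L2_sym :: "L2_sym \<Rightarrow> L2_sym" where "sgn_L2_sym f = inverse (norm f) *\<^sub>R f"
definition uniformity_L2_sym :: "(L2_sym \<times> L2_sym) filter"
  where "uniformity_L2_sym = (INF e\<in>{0<..}. principal {(f, g). dist f g < e})"
definition open_L2_sym :: "L2_sym set \<Rightarrow> bool"
  where "open_L2_sym U \<longleftrightarrow> (\<forall>f\<in>U. eventually (\<lambda>(f', g). f' = f \<longrightarrow> g \<in> U) uniformity)"

instance
proof
  fix f g h :: L2_sym and r r' :: real
  show "dist f g = norm (f - g)" "sgn f = inverse (norm f) *\<^sub>R f" "norm f = sqrt (inner f f)"
    "(uniformity :: (L2_sym \<times> L2_sym) filter) = (INF e\<in>{0<..}. principal {(f, g). dist f g < e})"
    by (simp_all add: dist_L2_sym_def sgn_L2_sym_def norm_L2_sym_def uniformity_L2_sym_def)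
  show "open U \<longleftrightarrow> (\<forall>f\<in>U. eventually (\<lambda>(f', g). f' = f \<longrightarrow> g \<in> U) uniformity)" for U :: "L2_sym set"
    by (rule open_L2_sym_def)
  show "f + g + h = f + (g + h)" "f + g = g + f" "0 + f = f" "- f + f = 0" "f - g = f + - g"
    "r *\<^sub>R (f + g) = r *\<^sub>R f + r *\<^sub>R g" "(r + r') *\<^sub>R f = r *\<^sub>R f + r' *\<^sub>R f"
    "r *\<^sub>R r' *\<^sub>R f = (r * r') *\<^sub>R f" "1 *\<^sub>R f = f"
    by (transfer; simp add: L2_sym_rel_closure add_ac mult.assoc distrib_left distrib_right)+
  show "inner f g = inner g f"
    by transfer (subst L2_inner_commute, simp)
  show "inner (f + g) h = inner f h + inner g h"
    by transfer (simp add: L2_sym_rel_def L2_rel_def L2_inner_add_left)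
  show "inner (r *\<^sub>R f) g = r * inner f g"
    by transfer (simp add: L2_inner_cmult_left)
  show "0 \<le> inner f f"
    by transfer (simp add: L2_inner_self)
  show "inner f f = 0 \<longleftrightarrow> f = 0"
    by transfer (auto simp: L2_sym_rel_def L2_rel_def L2_inner_eq_0_iff sq_integrable_zero)
qed

end

instantiation L2_sym :: complex_normed_vector
begin

lift_definition scaleC_L2_sym :: "complex \<Rightarrow> L2_sym \<Rightarrow> L2_sym" is "\<lambda>c f x. c * f x"
  by (simp add: L2_sym_rel_closure)

instance
proof
  fix f g :: L2_sym and a b :: complex and r :: real
  show "a *\<^sub>C (f + g) = a *\<^sub>C f + a *\<^sub>C g" "(a + b) *\<^sub>C f = a *\<^sub>C f + b *\<^sub>C f"
    "a *\<^sub>C b *\<^sub>C f = (a * b) *\<^sub>C f" "complex_of_real r *\<^sub>C f = r *\<^sub>R f"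
    by (transfer; simp add: L2_sym_rel_closure add_ac mult.assoc distrib_left distrib_right)+
  have "inner (a *\<^sub>C f) (a *\<^sub>C f) = (cmod a)\<^sup>2 * inner f f"
    by transfer (simp add: L2_inner_self norm_mult power_mult_distrib)
  then show "norm (a *\<^sub>C f) = cmod a * norm f"
    by (simp add: norm_L2_sym_def real_sqrt_mult)
qed

end

definition eps :: "real^3 \<Rightarrow> real" where
  "eps k = (\<Sum>i\<in>UNIV. 1 - cos (k $ i))"

definition w1 :: "real \<Rightarrow> real^3 \<Rightarrow> real" where
  "w1 \<gamma> k = eps k + \<gamma>"

text \<open>No reduction modulo the period lattice is needed: half of \<open>k + p\<close> is formed from the
  representatives, and \<^const>\<open>eps\<close> is periodic.\<close>

definition w2 :: "real^3 \<Rightarrow> real^3 \<Rightarrow> real" where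
  "w2 k p = eps k + eps ((1/2) *\<^sub>R (k + p)) + eps p"

lemma eps_bound: "\<bar>eps k\<bar> \<le> 6"
proof -
  have "\<bar>1 - cos t\<bar> \<le> 2" for t :: real
    using cos_le_one[of t] cos_ge_minus_one[of t] by linarith
  then have "\<bar>eps k\<bar> \<le> (\<Sum>i\<in>(UNIV::3 set). 2)"
    unfolding eps_def by (intro order_trans[OF sum_abs] sum_mono)
  then show ?thesis by simp
qed

lemma w1_bound: "\<bar>w1 \<gamma> k\<bar> \<le> 6 + \<bar>\<gamma>\<bar>"
  using eps_bound[of k] by (simp add: w1_def)

lemma w2_bound: "\<bar>w2 k p\<bar> \<le> 18"
  using eps_bound[of k] eps_bound[of p] eps_bound[of "(1/2) *\<^sub>R (k + p)"]
  by (simp add: w2_def abs_le_iff)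

lemma w2_commute: "w2 k p = w2 p k"
  by (simp add: w2_def add.commute)

lemma eps_measurable [measurable]: "eps \<in> borel_measurable borel"
  unfolding eps_def by (intro borel_measurable_continuous_onI continuous_intros)

lemma w1_measurable [measurable]: "w1 \<gamma> \<in> borel_measurable borel"
  unfolding w1_def by measurable

lemma w2_measurable: "(\<lambda>x. w2 (fst x) (snd x)) \<in> borel_measurable torus2_measure"
proof -
  have [measurable]: "(\<lambda>x. x) \<in> borel_measurable torus_measure" by measurable
  have [measurable]: "fst \<in> borel_measurable torus2_measure" "snd \<in> borel_measurable torus2_measure"
    using measurable_compose[OF measurable_fst, of "\<lambda>x. x"] measurable_compose[OF measurable_snd, of "\<lambda>x. x"]
    by auto
  show ?thesis unfolding w2_def by measurable
qed

lemma w2_fiber_measurable: "w2 k \<in> borel_measurable torus_measure"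
  unfolding w2_def by measurable

lemma L2_rel_mult_bounded:
  assumes "L2_rel M f g" and "w \<in> borel_measurable M" and "\<And>x. \<bar>w x\<bar> \<le> B"
  shows "L2_rel M (\<lambda>x. complex_of_real (w x) * f x) (\<lambda>x. complex_of_real (w x) * g x)"
  using assms unfolding L2_rel_def
  by (auto intro!: sq_integrable_mult_bounded[where B = B] elim: eventually_mono)

lemma sq_integrable_integral:
  assumes "finite_measure M" and f: "sq_integrable M f"
  shows "(cmod (\<integral>x. f x \<partial>M))\<^sup>2 \<le> (measure M (space M) + 1) * (\<integral>x. (cmod (f x))\<^sup>2 \<partial>M)"
proof -
  interpret finite_measure M by fact
  define a where "a = (\<integral>x. cmod (f x) \<partial>M)"
  define d where "d = measure M (space M) + 1"
  define S where "S = (\<integral>x. (cmod (f x))\<^sup>2 \<partial>M)"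
  have d: "d \<ge> 1" by (simp add: d_def)
  have i: "integrable M (\<lambda>x. cmod (f x))" "integrable M (\<lambda>x. (cmod (f x))\<^sup>2)"
    using sq_integrable_integrable[OF assms] f by (auto simp: sq_integrable_def)
  have "0 \<le> (\<integral>x. (cmod (f x) - a / d)\<^sup>2 \<partial>M)" by simp
  also have "\<dots> = (\<integral>x. (cmod (f x))\<^sup>2 - 2 * (a / d) * cmod (f x) + (a / d)\<^sup>2 \<partial>M)"
    by (simp add: power2_diff algebra_simps)
  also have "\<dots> = S - 2 * (a / d) * a + (a / d)\<^sup>2 * (d - 1)"
    using i by (simp add: S_def a_def d_def)
  also have "\<dots> \<le> S - a\<^sup>2 / d"
    using d mult_nonneg_nonneg[of "a * a" "d * d"] by (simp add: field_simps power2_eq_square)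
  finally have "a\<^sup>2 \<le> d * S" using d by (simp add: field_simps)
  moreover have "(cmod (\<integral>x. f x \<partial>M))\<^sup>2 \<le> a\<^sup>2"
    unfolding a_def by (intro power_mono integral_norm_bound) simp
  ultimately show ?thesis by (simp add: d_def S_def)
qed

lemma L2_rel_partial_integral:
  assumes "L2_rel torus2_measure f g"
  shows "L2_rel torus_measure
    (\<lambda>k. \<integral>t. f (k, t) \<partial>torus_measure) (\<lambda>k. \<integral>t. g (k, t) \<partial>torus_measure)"
proof -
  have sq: "sq_integrable torus_measure (\<lambda>k. \<integral>t. h (k, t) \<partial>torus_measure)"
    if h: "sq_integrable torus2_measure h" for h
  proof -
    have [measurable]: "h \<in> borel_measurable torus2_measure" using h by (simp add: sq_integrable_def)
    have i: "integrable torus2_measure (\<lambda>x. (cmod (h x))\<^sup>2)" using h by (simp add: sq_integrable_def)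
    define d where "d = measure torus_measure (space torus_measure) + 1"
    have "integrable torus_measure (\<lambda>k. (cmod (\<integral>t. h (k, t) \<partial>torus_measure))\<^sup>2)"
    proof (rule Bochner_Integration.integrable_bound)
      show "integrable torus_measure (\<lambda>k. d * (\<integral>t. (cmod (h (k, t)))\<^sup>2 \<partial>torus_measure))"
        using torus2.integrable_fst'[OF i] by simp
      have "AE k in torus_measure. integrable torus_measure (\<lambda>t. (cmod (h (k, t)))\<^sup>2)"
        using torus2.AE_integrable_fst'[OF i] .
      then show "AE k in torus_measure. norm ((cmod (\<integral>t. h (k, t) \<partial>torus_measure))\<^sup>2)
          \<le> norm (d * (\<integral>t. (cmod (h (k, t)))\<^sup>2 \<partial>torus_measure))"
        using AE_space
      proof eventually_elim
        case (elim k)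
        have "sq_integrable torus_measure (\<lambda>t. h (k, t))"
          unfolding sq_integrable_def
        proof
          from elim(2) show "(\<lambda>t. h (k, t)) \<in> borel_measurable torus_measure" by measurable
        qed (rule elim(1))
        from sq_integrable_integral[OF finite_measure_torus this]
        show ?case by (simp add: d_def)
      qed
    qed measurable
    then show ?thesis by (simp add: sq_integrable_def)
  qed
  have [measurable]: "f \<in> borel_measurable torus2_measure" "g \<in> borel_measurable torus2_measure"
    using assms by (simp_all add: L2_rel_def sq_integrable_def)
  have "AE x in torus2_measure. f x = g x" using assms by (simp add: L2_rel_def)
  from torus2.AE_pair[OF this] AE_space
  have "AE k in torus_measure. (\<integral>t. f (k, t) \<partial>torus_measure) = (\<integral>t. g (k, t) \<partial>torus_measure)"
  proof eventually_elim
    case (elim k)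
    from elim(2) have "(\<lambda>t. f (k, t)) \<in> borel_measurable torus_measure"
      "(\<lambda>t. g (k, t)) \<in> borel_measurable torus_measure" by measurable
    then show ?case using elim(1) by (rule integral_cong_AE)
  qed
  with sq assms show ?thesis by (simp add: L2_rel_def)
qed

lemma L2_rel_fst_snd:
  assumes "L2_rel torus_measure f g"
  shows "L2_rel torus2_measure (\<lambda>x. f (fst x)) (\<lambda>x. g (fst x))"
    and "L2_rel torus2_measure (\<lambda>x. f (snd x)) (\<lambda>x. g (snd x))"
proof -
  have [measurable]: "f \<in> borel_measurable torus_measure" "g \<in> borel_measurable torus_measure"
    using assms by (simp_all add: L2_rel_def sq_integrable_def)
  have sq1: "sq_integrable torus2_measure (\<lambda>x. h (fst x))" if h: "sq_integrable torus_measure h" for h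
  proof -
    have [measurable]: "h \<in> borel_measurable torus_measure" using h by (simp add: sq_integrable_def)
    have i: "integrable torus_measure (\<lambda>k. (cmod (h k))\<^sup>2)" using h by (simp add: sq_integrable_def)
    have "integrable torus2_measure (\<lambda>x. (cmod (h (fst x)))\<^sup>2)"
      by (rule torus2.Fubini_integrable) (use i in auto)
    then show ?thesis by (simp add: sq_integrable_def)
  qed
  have sq2: "sq_integrable torus2_measure (\<lambda>x. h (snd x))" if h: "sq_integrable torus_measure h" for h
  proof -
    have [measurable]: "h \<in> borel_measurable torus_measure" using h by (simp add: sq_integrable_def)
    have "integrable torus2_measure (\<lambda>x. (cmod (h (fst x)))\<^sup>2)"
      using sq1[OF h] by (simp add: sq_integrable_def)
    from torus2.integrable_product_swap[OF this]
    have "integrable torus2_measure (\<lambda>x. (cmod (h (snd x)))\<^sup>2)"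
      by (simp add: case_prod_beta')
    then show ?thesis by (simp add: sq_integrable_def)
  qed
  have ae: "AE x in torus_measure. f x = g x" using assms by (simp add: L2_rel_def)
  have "AE x in torus2_measure. f (fst x) = g (fst x)"
    by (rule torus2.AE_pair_measure) (use ae in auto)
  with sq1 assms show "L2_rel torus2_measure (\<lambda>x. f (fst x)) (\<lambda>x. g (fst x))"
    by (simp add: L2_rel_def)
  have "AE x in torus2_measure. f (snd x) = g (snd x)"
    by (rule torus2.AE_pair_measure) (use ae in auto)
  with sq2 assms show "L2_rel torus2_measure (\<lambda>x. f (snd x)) (\<lambda>x. g (snd x))"
    by (simp add: L2_rel_def)
qed

lift_definition A11 :: "real \<Rightarrow> L2_torus \<Rightarrow> L2_torus" is
  "\<lambda>\<gamma> f k. complex_of_real (w1 \<gamma> k) * f k"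
  by (rule L2_rel_mult_bounded[OF _ _ w1_bound]) auto

lift_definition A12 :: "L2_sym \<Rightarrow> L2_torus" is
  "\<lambda>f k. \<integral>t. f (k, t) \<partial>torus_measure"
  by (simp add: L2_sym_rel_def L2_rel_partial_integral)

lift_definition A12_adj :: "L2_torus \<Rightarrow> L2_sym" is
  "\<lambda>f x. (f (fst x) + f (snd x)) / 2"
proof -
  fix f g assume fg: "L2_rel torus_measure f g"
  have "L2_rel torus2_measure (\<lambda>x. (1/2) * (f (fst x) + f (snd x))) (\<lambda>x. (1/2) * (g (fst x) + g (snd x)))"
    by (intro L2_rel_closure L2_rel_fst_snd fg)
  then show "L2_sym_rel (\<lambda>x. (f (fst x) + f (snd x)) / 2) (\<lambda>x. (g (fst x) + g (snd x)) / 2)"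
    by (simp add: L2_sym_rel_def add.commute)
qed

lift_definition A22 :: "L2_sym \<Rightarrow> L2_sym" is
  "\<lambda>f x. complex_of_real (w2 (fst x) (snd x)) * f x"
  using L2_rel_mult_bounded[OF _ w2_measurable w2_bound]
  by (auto simp: L2_sym_rel_def w2_commute elim: eventually_mono)

definition A_op :: "real \<Rightarrow> real \<Rightarrow> L2_torus \<times> L2_sym \<Rightarrow> L2_torus \<times> L2_sym" where
  "A_op \<gamma> \<mu> f = (A11 \<gamma> (fst f) + \<mu> *\<^sub>R A12 (snd f), \<mu> *\<^sub>R A12_adj (fst f) + A22 (snd f))"

definition A00_fiber :: "real \<Rightarrow> real^3 \<Rightarrow> complex \<Rightarrow> complex" where
  "A00_fiber \<gamma> k c = complex_of_real (w1 \<gamma> k) * c"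

lift_definition A01 :: "L2_torus \<Rightarrow> complex" is
  "\<lambda>f. complex_of_real (1 / sqrt 2) * (\<integral>t. f t \<partial>torus_measure)"
  by (auto simp: L2_rel_def sq_integrable_measurable intro!: integral_cong_AE)

text \<open>The adjoint of \<^const>\<open>A01\<close>, see \<open>A01_adj_inner\<close> below.\<close>

lift_definition A01_adj :: "complex \<Rightarrow> L2_torus" is
  "\<lambda>c t. complex_of_real (1 / sqrt 2) * c"
  by (simp add: L2_rel_def sq_integrable_const finite_measure_torus)

lift_definition A11_fiber :: "real^3 \<Rightarrow> L2_torus \<Rightarrow> L2_torus" is
  "\<lambda>k f p. complex_of_real (w2 k p) * f p"
  by (rule L2_rel_mult_bounded[OF _ w2_fiber_measurable w2_bound])

definition A_fiber :: "real \<Rightarrow> real \<Rightarrow> real^3 \<Rightarrow> complex \<times> L2_torus \<Rightarrow> complex \<times> L2_torus" where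
  "A_fiber \<gamma> \<mu> k f =
     (A00_fiber \<gamma> k (fst f) + \<mu> *\<^sub>R A01 (snd f), \<mu> *\<^sub>R A01_adj (fst f) + A11_fiber k (snd f))"

lemma A01_adj_inner: "inner (A01 f) c = inner f (A01_adj c)"
proof transfer
  fix f c
  show "inner (complex_of_real (1 / sqrt 2) * (\<integral>t. f t \<partial>torus_measure)) c
      = Re (L2_inner torus_measure f (\<lambda>t. complex_of_real (1 / sqrt 2) * c))"
    by (simp add: L2_inner_def inner_complex_def field_simps)
qed

definition Lambda :: "real \<Rightarrow> real \<Rightarrow> complex set" where
  "Lambda \<gamma> \<mu> = (\<Union>k\<in>torus. discrete_spectrum (A_fiber \<gamma> \<mu> k))"

definition I00 :: real where
  "I00 = (\<integral>t. 1 / w2 0 t \<partial>torus_measure)"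

definition mu_l0 :: "real \<Rightarrow> real" where
  "mu_l0 \<gamma> = sqrt (2 * \<gamma>) * I00 powr (- 1/2)"

definition E1 :: "real \<Rightarrow> real \<Rightarrow> real" where
  "E1 \<gamma> \<mu> = (THE E. is_min (Lambda \<gamma> \<mu> \<inter> complex_of_real ` {..0}) E)"

end

theory Submission
  imports Defs
begin

text \<open>Eliminating the second component from \<open>(A - z) f = 0\<close>, \<open>z < 0\<close>, leaves multiplication by
  \<open>Dl z k = w1 k - z - \<mu>\<^sup>2/2 * \<integral>dt / (w2 k t - z)\<close>, the determinant of the fiber operator at \<open>k\<close>, minus a
  Hilbert-Schmidt operator. A rearrangement in each coordinate shows that the integral is largest at
  \<open>k = 0\<close>, so \<open>Dl z k \<ge> Dl z 0 + eps k\<close>. Where \<open>Dl z 0 > 0\<close>, the form of \<open>A - z\<close> is therefore bounded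
  below up to finite rank and \<open>z\<close> is at most a discrete eigenvalue. Roots of \<open>Dl z k\<close>
  and values of \<open>w2\<close> have singular sequences concentrating at a point; the root \<open>E\<close> of
  \<open>Dl z 0\<close> is not isolated because roots for \<open>k \<noteq> 0\<close> accumulate at it. A negative \<open>E\<close>
  exists iff \<open>\<gamma> - \<mu>\<^sup>2/2 * I00 < 0\<close>, the limit of \<open>Dl z 0\<close> as \<open>z\<close> increases to 0.\<close>

section \<open>Bounded self-adjoint operators\<close>

text \<open>Two features of \<open>w2\<close> shape the proof. The term
  \<open>eps ((1/2) *\<^sub>R (k + t))\<close> vanishes at \<open>k = - t\<close>, so for most
  \<open>t\<close> the value \<open>w2 k t\<close> is not smallest at \<open>k = 0\<close>, and only
  the integrals over \<open>t\<close> can be compared. It also lacks the period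
  \<open>2 * pi\<close> in each coordinate, so the torus cannot be translated; the comparison works
  on all of space with the indicator of the cube as part of the integrand. Spectral statements
  become norm inequalities. By self-adjointness a positive lower bound for \<open>A - z\<close> puts
  \<open>z\<close> into the resolvent set, and trial vectors violating every such bound put it into
  the spectrum. Discreteness follows once the form of \<open>A - z\<close> is coercive after adding
  squares of finitely many functionals; for the Hilbert-Schmidt part these arise from a kernel that
  is a step function in one variable, uniformly close because \<open>G\<close> is Lipschitz for
  negative energy. The inner product is real, so a complex functional counts as two real ones.
  Finiteness of \<open>I00\<close> rests on the quadratic lower bound for \<open>w2 0\<close> at the
  origin, in dimension 3.\<close>

lemma scaleC_eq: "z *\<^sub>C (x::'a::complex_normed_vector) = Re z *\<^sub>R x + Im z *\<^sub>R (\<i> *\<^sub>C x)"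
proof -
  have "z *\<^sub>C x = (complex_of_real (Re z) + complex_of_real (Im z) * \<i>) *\<^sub>C x"
    by (metis complex_eq mult.commute)
  also have "\<dots> = Re z *\<^sub>R x + Im z *\<^sub>R (\<i> *\<^sub>C x)"
    unfolding scaleC_add_left by (simp only: scaleC_of_real flip: scaleC_scaleC)
  finally show ?thesis .
qed

lemma scaleC_diff_right: "a *\<^sub>C (x - y) = a *\<^sub>C x - a *\<^sub>C (y::'a::complex_normed_vector)"
  using scaleC_add_right[of a "x - y" y] by simp

lemma scaleC_zero [simp]: "a *\<^sub>C (0::'a::complex_normed_vector) = 0"
  using scaleC_add_right[of a 0 "0::'a"] by simp

lemma scaleC_one: "1 *\<^sub>C (x::'a::complex_normed_vector) = x"
  using scaleC_of_real[of 1 x] by simp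

lemma module_scaleC: "module (scaleC :: complex \<Rightarrow> 'a::complex_normed_vector \<Rightarrow> 'a)"
  by (rule module.intro) (rule scaleC_add_right scaleC_add_left scaleC_scaleC scaleC_one)+

lemma scaleC_scaleR: "a *\<^sub>C (r *\<^sub>R x) = r *\<^sub>R (a *\<^sub>C (x::'a::complex_normed_vector))"
  by (metis mult.commute scaleC_of_real scaleC_scaleC)

lemma bounded_linear_scaleC: "bounded_linear (\<lambda>x::'a::complex_normed_vector. a *\<^sub>C x)"
  by (rule bounded_linear_intro[where K = "cmod a"])
    (simp_all add: scaleC_add_right scaleC_scaleR norm_scaleC mult.commute)

text \<open>Polarization: the norm is the only link between the complex structure and
  \<open>inner\<close>, and \<open>dot_norm\<close> expresses the latter by norms.\<close>

lemma inner_scaleC_scaleC: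
  fixes x y :: "'a::{real_inner, complex_normed_vector}"
  shows "inner (a *\<^sub>C x) (a *\<^sub>C y) = (cmod a)\<^sup>2 * inner x y"
  unfolding dot_norm scaleC_add_right[symmetric] norm_scaleC power_mult_distrib
  by (simp add: field_simps)

lemma scaleC_i_i: "\<i> *\<^sub>C \<i> *\<^sub>C (x::'a::complex_normed_vector) = - x"
proof -
  have "\<i> *\<^sub>C \<i> *\<^sub>C x = complex_of_real (-1) *\<^sub>C x" by (simp add: scaleC_scaleC)
  then show ?thesis by (simp only: scaleC_of_real) simp
qed

lemma inner_i_scaleC_left:
  fixes x y :: "'a::{real_inner, complex_normed_vector}"
  shows "inner (\<i> *\<^sub>C x) y = - inner x (\<i> *\<^sub>C y)"
  using inner_scaleC_scaleC[of "\<i>" x "\<i> *\<^sub>C y"] by (simp add: scaleC_i_i)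

lemma inner_scaleC_left:
  fixes x y :: "'a::{real_inner, complex_normed_vector}"
  shows "inner (a *\<^sub>C x) y = inner x (cnj a *\<^sub>C y)"
  unfolding scaleC_eq[of a x] scaleC_eq[of "cnj a" y]
  by (simp add: inner_add_left inner_diff_right inner_i_scaleC_left)

text \<open>Lax-Milgram argument: for suitable \<open>\<tau>\<close> the map
  \<open>x - \<tau> *\<^sub>R (B x - y)\<close> is a contraction, and its fixed points are exactly
  the solutions of \<open>B x = y\<close>.\<close>

lemma coercive_invertible:
  fixes B :: "'a::{real_inner, complete_space} \<Rightarrow> 'a"
  assumes B: "bounded_linear B" and c: "c > 0" and coer: "\<And>x. c * (norm x)\<^sup>2 \<le> inner (B x) x"
  shows "bij B"
proof -
  interpret bounded_linear B by fact
  obtain K where K: "K > 0" "\<And>x. norm (B x) \<le> norm x * K" using pos_bounded by blast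
  \<comment> \<open>The maximum with \<open>c\<close> guarantees
    \<open>c\<^sup>2 / M\<^sup>2 \<le> 1\<close>, so that the root defining \<open>q\<close> is
    taken of a nonnegative number.\<close>
  define M where "M = max K c"
  have M: "M \<ge> c" "M > 0" "\<And>x. norm (B x) \<le> M * norm x"
  proof -
    show "norm (B x) \<le> M * norm x" for x
      using K(2)[of x] mult_right_mono[of K M "norm x"] by (simp add: M_def mult.commute)
  qed (use K c in \<open>simp_all add: M_def\<close>)
  \<comment> \<open>This \<open>\<tau>\<close> minimizes
    \<open>1 - 2 * \<tau> * c + \<tau>\<^sup>2 * M\<^sup>2\<close>, and \<open>q\<^sup>2\<close> is
    the minimum.\<close>
  define \<tau> where "\<tau> = c / M\<^sup>2"
  define q where "q = sqrt (1 - c\<^sup>2 / M\<^sup>2)"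
  have c2: "c\<^sup>2 / M\<^sup>2 \<le> 1" "0 < c\<^sup>2 / M\<^sup>2"
    using M c by (simp_all add: power_mono)
  have contr: "norm (x - \<tau> *\<^sub>R B x) \<le> q * norm x" for x
  proof -
    have "(norm (x - \<tau> *\<^sub>R B x))\<^sup>2 = (norm x)\<^sup>2 - 2 * \<tau> * inner (B x) x + \<tau>\<^sup>2 * (norm (B x))\<^sup>2"
      unfolding power2_norm_eq_inner
      by (simp add: inner_diff_left inner_diff_right inner_commute power2_eq_square algebra_simps)
    also have "\<dots> \<le> (norm x)\<^sup>2 - 2 * \<tau> * (c * (norm x)\<^sup>2) + \<tau>\<^sup>2 * (M * norm x)\<^sup>2"
      using c M by (intro add_mono diff_mono mult_left_mono coer power_mono) (auto simp: \<tau>_def)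
    also have "\<dots> = (1 - c\<^sup>2 / M\<^sup>2) * (norm x)\<^sup>2"
      using M by (simp add: \<tau>_def field_simps power2_eq_square)
    also have "\<dots> = (q * norm x)\<^sup>2"
      using c2 by (simp add: q_def power_mult_distrib)
    finally show ?thesis
      by (rule power2_le_imp_le) (use c2 in \<open>simp add: q_def\<close>)
  qed
  have q: "0 \<le> q" "q < 1" using c2 by (auto simp: q_def real_sqrt_lt_1_iff)
  have "\<exists>!x. B x = y" for y
  proof -
    have "\<forall>x x'. dist (x - \<tau> *\<^sub>R (B x - y)) (x' - \<tau> *\<^sub>R (B x' - y)) \<le> q * dist x x'"
    proof (intro allI)
      fix x x'
      have "(x - \<tau> *\<^sub>R (B x - y)) - (x' - \<tau> *\<^sub>R (B x' - y)) = (x - x') - \<tau> *\<^sub>R B (x - x')"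
        by (simp add: algebra_simps diff)
      then show "dist (x - \<tau> *\<^sub>R (B x - y)) (x' - \<tau> *\<^sub>R (B x' - y)) \<le> q * dist x x'"
        unfolding dist_norm by (simp only: contr)
    qed
    from banach_fix_type[OF q this] have "\<exists>!x. x - \<tau> *\<^sub>R (B x - y) = x" .
    moreover have "\<tau> \<noteq> 0" using c M by (simp add: \<tau>_def)
    ultimately show ?thesis by simp
  qed
  then show ?thesis by (simp add: bij_iff)
qed

lemma bounded_linear_inv_of_bounded_below:
  fixes T :: "'a::real_normed_vector \<Rightarrow> 'a"
  assumes "bounded_linear T" "bij T" and d: "d > 0" and lower: "\<And>x. d * norm x \<le> norm (T x)"
  shows "bounded_linear (inv T)"
proof -
  interpret bounded_linear T by fact
  have inv: "T (inv T x) = x" "inv T (T x) = x" for x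
    using \<open>bij T\<close> by (simp_all add: bij_is_surj surj_f_inv_f bij_is_inj)
  show ?thesis
  proof (rule bounded_linear_intro[where K = "1 / d"])
    show "inv T (x + y) = inv T x + inv T y" for x y by (metis inv add)
    show "inv T (r *\<^sub>R x) = r *\<^sub>R inv T x" for r x by (metis inv scaleR)
    show "norm (inv T x) \<le> norm x * (1 / d)" for x
      using lower[of "inv T x"] d by (simp add: inv field_simps)
  qed
qed

text \<open>For a complex linear \<open>A\<close>, symmetry with respect to the real part of the
  inner product is Hermitian symmetry: inserting \<open>\<i> *\<^sub>C y\<close> for
  \<open>y\<close> recovers the imaginary part.\<close>

locale self_adjoint_op =
  fixes A :: "'a::{real_inner, complete_space, complex_normed_vector} \<Rightarrow> 'a"
  assumes bounded_linear: "bounded_linear A"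
    and scaleC: "A (a *\<^sub>C x) = a *\<^sub>C A x"
    and self_adjoint: "inner (A x) y = inner x (A y)"
begin

sublocale bounded_linear A by (rule bounded_linear)

lemma bounded_linear_shift: "bounded_linear (\<lambda>x. A x - z *\<^sub>C x)"
  by (intro bounded_linear_sub bounded_linear bounded_linear_scaleC)

text \<open>Pythagoras: \<open>\<i> *\<^sub>C x\<close> is orthogonal both to \<open>x\<close> and,
  by self-adjointness, to \<open>A x\<close>, so the imaginary part of \<open>z\<close> contributes
  an orthogonal summand.\<close>

lemma norm_shift: "(norm (A x - z *\<^sub>C x))\<^sup>2 = (norm (A x - Re z *\<^sub>R x))\<^sup>2 + (Im z)\<^sup>2 * (norm x)\<^sup>2"
proof -
  have 0: "inner (A x) (\<i> *\<^sub>C x) = 0"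
    using inner_i_scaleC_left[of x "A x"] self_adjoint[of x "\<i> *\<^sub>C x"]
    by (simp add: scaleC inner_commute)
  have 1: "inner x (\<i> *\<^sub>C x) = 0"
    using inner_i_scaleC_left[of x x] by (simp add: inner_commute)
  define u v where "u = A x - Re z *\<^sub>R x" and "v = \<i> *\<^sub>C x"
  have uv: "inner u v = 0" "(norm v)\<^sup>2 = (norm x)\<^sup>2"
    using 0 1 by (simp_all add: u_def v_def inner_diff_left norm_scaleC)
  have "A x - z *\<^sub>C x = u - Im z *\<^sub>R v"
    unfolding scaleC_eq[of z x] u_def v_def by simp
  then have "(norm (A x - z *\<^sub>C x))\<^sup>2 = (norm u)\<^sup>2 + (Im z)\<^sup>2 * (norm v)\<^sup>2"
    using uv(1) unfolding power2_norm_eq_inner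
    by (simp add: inner_diff_left inner_diff_right inner_commute[of v u] power2_eq_square)
  then show ?thesis by (simp add: uv(2) u_def)
qed

text \<open>With \<open>T' = A - cnj z\<close> the adjoint of \<open>T = A - z\<close>, the product
  of \<open>T'\<close> and \<open>T\<close> is coercive, hence bijective. Both orders of the product
  agree, so one of them makes \<open>T\<close> injective and the other makes it surjective.\<close>

lemma resolvent_setI:
  assumes d: "d > 0" and lower: "\<And>x. d * norm x \<le> norm (A x - z *\<^sub>C x)"
  shows "z \<in> resolvent_set A"
proof -
  define T where "T = (\<lambda>x. A x - z *\<^sub>C x)"
  define T' where "T' = (\<lambda>x. A x - cnj z *\<^sub>C x)"
  have T: "bounded_linear T" and T': "bounded_linear T'"
    unfolding T_def T'_def by (rule bounded_linear_shift)+
  have comm: "T' (T x) = T (T' x)" for x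
    by (simp add: T_def T'_def diff scaleC scaleC_diff_right scaleC_scaleC mult.commute)
  have adj: "inner (T' x) y = inner x (T y)" for x y
    by (simp add: T_def T'_def inner_diff_left inner_diff_right self_adjoint inner_scaleC_left)
  have "bij (\<lambda>x. T' (T x))"
  proof (rule coercive_invertible)
    show "bounded_linear (\<lambda>x. T' (T x))" by (rule bounded_linear_compose[OF T' T])
    show "d\<^sup>2 > 0" using d by simp
    have "(d * norm x)\<^sup>2 \<le> (norm (T x))\<^sup>2" for x
      using lower[of x] d unfolding T_def by (intro power_mono) auto
    then show "d\<^sup>2 * (norm x)\<^sup>2 \<le> inner (T' (T x)) x" for x
      by (simp add: adj power2_norm_eq_inner[symmetric] power_mult_distrib)
  qed
  then have *: "bij (\<lambda>x. T (T' x))" by (simp add: comm)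
  have "surj T"
    unfolding surj_def using surjD[OF bij_is_surj[OF *]] by blast
  moreover have "inj T"
    using injD[OF bij_is_inj[OF \<open>bij (\<lambda>x. T' (T x))\<close>]] by (intro injI) simp
  ultimately have bij: "bij T" by (simp add: bij_def)
  have "bounded_linear (inv T)"
    by (rule bounded_linear_inv_of_bounded_below[OF T bij d]) (simp add: T_def lower)
  with bij show ?thesis by (simp add: resolvent_set_def T_def)
qed

lemma resolvent_setD:
  assumes "z \<in> resolvent_set A"
  obtains d where "d > 0" "\<And>x. d * norm x \<le> norm (A x - z *\<^sub>C x)"
proof -
  define T where "T = (\<lambda>x. A x - z *\<^sub>C x)"
  have T: "bij T" "bounded_linear (inv T)" using assms by (auto simp: resolvent_set_def T_def)
  obtain K where K: "K > 0" "\<And>x. norm (inv T x) \<le> norm x * K"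
    using bounded_linear.pos_bounded[OF T(2)] by blast
  have "(1 / K) * norm x \<le> norm (T x)" for x
    using K(2)[of "T x"] K(1) T(1) by (simp add: bij_is_inj field_simps)
  then show ?thesis using that[of "1 / K"] K(1) by (simp add: T_def)
qed

text \<open>The strict inequality excludes \<open>x = 0\<close> by itself, so trial vectors can be
  used without normalization.\<close>

lemma spectrumI_approx:
  assumes "\<And>e. e > 0 \<Longrightarrow> \<exists>x. norm (A x - z *\<^sub>C x) < e * norm x"
  shows "z \<in> spectrum A"
  unfolding spectrum_def
proof
  assume "z \<in> resolvent_set A"
  then obtain d where "d > 0" "\<And>x. d * norm x \<le> norm (A x - z *\<^sub>C x)"
    by (rule resolvent_setD) blast
  then show False using assms[of d] by (meson not_le)
qed

lemma spectrum_real: "spectrum A \<subseteq> \<real>"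
proof
  fix z assume z: "z \<in> spectrum A"
  show "z \<in> \<real>"
  proof (rule ccontr)
    assume "z \<notin> \<real>"
    then have "Im z \<noteq> 0" by (simp add: complex_is_Real_iff)
    have "\<bar>Im z\<bar> * norm x \<le> norm (A x - z *\<^sub>C x)" for x
      by (rule power2_le_imp_le) (simp_all add: norm_shift power_mult_distrib)
    with \<open>Im z \<noteq> 0\<close> have "z \<in> resolvent_set A" by (intro resolvent_setI[of "\<bar>Im z\<bar>"]) auto
    with z show False by (simp add: spectrum_def)
  qed
qed

lemma essential_spectrum_real: "essential_spectrum A \<subseteq> \<real>"
  using spectrum_real by (auto simp: essential_spectrum_def)

text \<open>A point at the left end of an interval of spectrum is not isolated. The one-sided form
  fits the two applications, where the spectrum is filled upwards from 0 and from the root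
  \<open>E\<close>.\<close>

lemma essential_spectrumI:
  assumes e: "e > 0" and "\<And>b. a \<le> b \<Longrightarrow> b < a + e \<Longrightarrow> complex_of_real b \<in> spectrum A"
  shows "complex_of_real a \<in> essential_spectrum A"
proof -
  have "\<not> complex_of_real a isolated_in spectrum A"
  proof
    assume "complex_of_real a isolated_in spectrum A"
    then obtain U where U: "open U" "U \<inter> spectrum A = {complex_of_real a}"
      by (auto simp: isolated_in_def)
    then have "complex_of_real a \<in> U" by auto
    with U(1) obtain r where r: "r > 0" "ball (complex_of_real a) r \<subseteq> U"
      by (meson open_contains_ball)
    define b where "b = a + min (e / 2) (r / 2)"
    have "b \<noteq> a" "a \<le> b" "b < a + e" "\<bar>b - a\<bar> < r" using e r by (auto simp: b_def min_def)
    then have "complex_of_real b \<in> U" "complex_of_real b \<in> spectrum A"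
      using assms(2)[of b] r
      by (auto simp: dist_norm subset_iff norm_minus_commute simp flip: of_real_diff)
    then have "complex_of_real b \<in> {complex_of_real a}" unfolding U(2)[symmetric] by blast
    with \<open>b \<noteq> a\<close> show False by simp
  qed
  moreover have "complex_of_real a \<in> spectrum A" using assms by auto
  ultimately show ?thesis by (auto simp: essential_spectrum_def discrete_spectrum_def)
qed

end

section \<open>Positivity up to finite rank and the discrete spectrum\<close>

lemma inner_orthonormal_sum:
  fixes S :: "'a::real_inner set"
  assumes "finite S" "pairwise orthogonal S" "\<And>s. s \<in> S \<Longrightarrow> norm s = 1" "t \<in> S"
  shows "inner t (\<Sum>s\<in>S. inner s x *\<^sub>R s) = inner t x"
proof -
  have "inner t (\<Sum>s\<in>S. inner s x *\<^sub>R s) = (\<Sum>s\<in>S. if s = t then inner t x else 0)"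
    unfolding inner_sum_right
    using assms by (intro sum.cong) (auto simp: pairwise_def orthogonal_def norm_eq_1)
  then show ?thesis using assms by simp
qed

text \<open>A maximal orthonormal subset of the subspace is finite by Bessel's inequality, applied to the
  finitely many vectors that control the norm.\<close>

lemma finite_orthonormal_basis:
  fixes N :: "'a::real_inner set" and v :: "'e \<Rightarrow> 'a"
  assumes N: "subspace N" and E: "finite E" and c: "c > 0"
    and control: "\<And>x. x \<in> N \<Longrightarrow> c * (norm x)\<^sup>2 \<le> (\<Sum>e\<in>E. (inner (v e) x)\<^sup>2)"
  shows "\<exists>S. finite S \<and> S \<subseteq> N \<and> pairwise orthogonal S \<and> (\<forall>s\<in>S. norm s = 1) \<and>
    (\<forall>x\<in>N. (\<Sum>s\<in>S. inner s x *\<^sub>R s) = x)"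
proof -
  define good where "good S \<longleftrightarrow> finite S \<and> S \<subseteq> N \<and> pairwise orthogonal S \<and> (\<forall>s\<in>S. norm s = 1)" for S
  have proj: "inner t (x - (\<Sum>s\<in>S. inner s x *\<^sub>R s)) = 0" if "good S" "t \<in> S" for S t x
    using that by (simp add: good_def inner_diff_right inner_orthonormal_sum)
  have bessel: "(\<Sum>s\<in>S. (inner s x)\<^sup>2) \<le> (norm x)\<^sup>2" if "good S" for S x
  proof -
    define y where "y = (\<Sum>s\<in>S. inner s x *\<^sub>R s)"
    have "inner y (x - y) = (\<Sum>s\<in>S. inner s x * inner s (x - y))"
      unfolding y_def inner_sum_left by simp
    also have "\<dots> = 0" using proj[OF that] by (simp add: y_def)
    finally have "inner y x = inner y y" by (simp add: inner_diff_right)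
    then have "(norm (x - y))\<^sup>2 = (norm x)\<^sup>2 - inner y x"
      unfolding power2_norm_eq_inner
      by (simp add: inner_diff_left inner_diff_right inner_commute[of x y])
    moreover have "inner y x = (\<Sum>s\<in>S. (inner s x)\<^sup>2)"
      by (simp add: y_def inner_sum_left power2_eq_square)
    ultimately show ?thesis by (metis diff_ge_0_iff_ge zero_le_power2)
  qed
  define K where "K = (\<Sum>e\<in>E. (norm (v e))\<^sup>2)"
  have card: "real (card S) \<le> K / c" if S: "good S" for S
  proof -
    have "c * real (card S) = (\<Sum>s\<in>S. c * (norm s)\<^sup>2)" using S by (simp add: good_def)
    also have "\<dots> \<le> (\<Sum>s\<in>S. \<Sum>e\<in>E. (inner (v e) s)\<^sup>2)"
      using S by (intro sum_mono control) (auto simp: good_def)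
    also have "\<dots> = (\<Sum>e\<in>E. \<Sum>s\<in>S. (inner s (v e))\<^sup>2)"
      by (subst sum.swap) (simp add: inner_commute)
    also have "\<dots> \<le> K" unfolding K_def by (intro sum_mono bessel S)
    finally show ?thesis using c by (simp add: field_simps)
  qed
  have "good {}" by (simp add: good_def)
  moreover have "card S \<le> nat \<lfloor>K / c\<rfloor>" if "good S" for S
    using card[OF that] by linarith
  ultimately obtain S where S: "good S" and max: "\<And>S'. good S' \<Longrightarrow> card S' \<le> card S"
    using ex_has_greatest_nat[of good "{}" card "Suc (nat \<lfloor>K / c\<rfloor>)"] by (metis le_imp_less_Suc)
  show ?thesis
  proof (intro exI[of _ S] conjI ballI)
    show "finite S" "S \<subseteq> N" "pairwise orthogonal S" "\<And>s. s \<in> S \<Longrightarrow> norm s = 1"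
      using S by (auto simp: good_def)
  next
    fix x assume x: "x \<in> N"
    define y where "y = x - (\<Sum>s\<in>S. inner s x *\<^sub>R s)"
    have "y \<in> N"
      using S x N unfolding y_def good_def
      by (intro subspace_diff subspace_sum subspace_scale) auto
    have orth: "inner s y = 0" if "s \<in> S" for s using proj[OF S that] by (simp add: y_def)
    have "y = 0"
    proof (rule ccontr)
      assume "y \<noteq> 0"
      define u where "u = y /\<^sub>R norm y"
      have u: "norm u = 1" "u \<in> N" "\<And>s. s \<in> S \<Longrightarrow> inner s u = 0"
        using \<open>y \<noteq> 0\<close> \<open>y \<in> N\<close> N orth by (simp_all add: u_def subspace_scale)
      then have "u \<notin> S" by (metis norm_zero inner_eq_zero_iff zero_neq_one)
      have "good (insert u S)"
        using S u by (auto simp: good_def pairwise_insert orthogonal_def inner_commute)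
      from max[OF this] \<open>u \<notin> S\<close> S show False by (simp add: good_def)
    qed
    then show "(\<Sum>s\<in>S. inner s x *\<^sub>R s) = x" by (simp add: y_def)
  qed
qed

lemma bounded_real_sequences_convergent_subseq:
  fixes X :: "nat \<Rightarrow> 'e \<Rightarrow> real"
  assumes "finite E" "\<And>e. e \<in> E \<Longrightarrow> \<exists>B. \<forall>n. \<bar>X n e\<bar> \<le> B"
  shows "\<exists>r::nat\<Rightarrow>nat. strict_mono r \<and> (\<forall>e\<in>E. convergent (\<lambda>n. X (r n) e))"
  using assms
proof (induction E rule: finite_induct)
  case empty
  then show ?case by (intro exI[of _ id]) (auto simp: strict_mono_def)
next
  case (insert e E)
  then obtain r where r: "strict_mono (r::nat\<Rightarrow>nat)" "\<forall>e\<in>E. convergent (\<lambda>n. X (r n) e)" by auto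
  obtain B where "\<forall>n. \<bar>X n e\<bar> \<le> B" using insert.prems by auto
  then have "bounded (range (\<lambda>n. X (r n) e))" by (auto simp: bounded_iff)
  then obtain l q where q: "strict_mono (q::nat\<Rightarrow>nat)" "((\<lambda>n. X (r n) e) \<circ> q) \<longlonglongrightarrow> l"
    using bounded_imp_convergent_subsequence by blast
  have "convergent (\<lambda>n. X (r (q n)) e')" if "e' \<in> E" for e'
    using r(2) that convergent_subseq_convergent[OF _ q(1)] by (fastforce simp: o_def)
  moreover have "convergent (\<lambda>n. X (r (q n)) e)" using q(2) by (auto simp: convergent_def o_def)
  ultimately show ?case
    using strict_mono_o[OF r(1) q(1)] by (intro exI[of _ "r \<circ> q"]) (auto simp: o_def)
qed

context self_adjoint_op
begin

text \<open>\<open>N\<close> is the eigenspace. If a sequence of unit vectors orthogonal to \<open>N\<close> were almost annihilated, then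
  along a subsequence the finitely many functionals \<open>inner (v e)\<close> converge, the estimate makes the
  subsequence Cauchy, and its limit would be an eigenvector orthogonal to \<open>N\<close>.\<close>

lemma bounded_below_orthogonal_eigenspace:
  fixes v :: "'e \<Rightarrow> 'a"
  assumes E: "finite E" and c: "c > 0"
    and control: "\<And>x. c * (norm x)\<^sup>2 \<le> inner (A x - a *\<^sub>R x) x + (\<Sum>e\<in>E. (inner (v e) x)\<^sup>2)"
    and N_def: "N = {x. A x = a *\<^sub>R x}"
  obtains d where "d > 0" "\<And>x. (\<And>n. n \<in> N \<Longrightarrow> inner n x = 0) \<Longrightarrow> d * norm x \<le> norm (A x - a *\<^sub>R x)"
proof -
  define T where "T x = A x - a *\<^sub>R x" for x
  have T: "bounded_linear T"
    unfolding T_def by (intro bounded_linear_sub bounded_linear bounded_linear_scaleR_right)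
  interpret T: bounded_linear T by fact
  have "\<exists>d>0. \<forall>x. (\<forall>n\<in>N. inner n x = 0) \<longrightarrow> d * norm x \<le> norm (T x)"
  proof (rule ccontr)
    assume "\<not> ?thesis"
    then have "\<exists>x. (\<forall>n\<in>N. inner n x = 0) \<and> norm (T x) < inverse (real (Suc k)) * norm x" for k
      by (metis not_le inverse_positive_iff_positive of_nat_0_less_iff zero_less_Suc)
    then obtain x where x: "\<And>k. \<forall>n\<in>N. inner n (x k) = 0"
      "\<And>k. norm (T (x k)) < inverse (real (Suc k)) * norm (x k)" by metis
    have x0: "x k \<noteq> 0" for k using x(2)[of k] by auto
    define y where "y k = x k /\<^sub>R norm (x k)" for k
    have y1: "norm (y k) = 1" for k using x0 by (simp add: y_def)
    have yN: "inner n (y k) = 0" if "n \<in> N" for n k using x(1) that by (simp add: y_def)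
    have Ty: "norm (T (y k)) \<le> inverse (real (Suc k))" for k
      using x(2)[of k] x0[of k] by (simp add: y_def T.scaleR field_simps)
    have "\<exists>B. \<forall>n. \<bar>inner (v e) (y n)\<bar> \<le> B" for e
      using Cauchy_Schwarz_ineq2[of "v e"] by (intro exI[of _ "norm (v e)"]) (metis mult.right_neutral y1)
    then obtain r where r: "strict_mono (r::nat\<Rightarrow>nat)" "\<And>e. e \<in> E \<Longrightarrow> convergent (\<lambda>n. inner (v e) (y (r n)))"
      using bounded_real_sequences_convergent_subseq[OF E, of "\<lambda>n e. inner (v e) (y n)"] by blast
    define z where "z k = y (r k)" for k
    have Tz: "(\<lambda>k. T (z k)) \<longlonglongrightarrow> 0"
    proof (rule Lim_null_comparison)
      show "\<forall>\<^sub>F k in sequentially. norm (T (z k)) \<le> inverse (real (Suc k))"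
      proof (intro always_eventually allI)
        fix k
        have "norm (T (z k)) \<le> inverse (real (Suc (r k)))" unfolding z_def by (rule Ty)
        also have "\<dots> \<le> inverse (real (Suc k))"
          using seq_suble[OF r(1), of k] by (intro le_imp_inverse_le) auto
        finally show "norm (T (z k)) \<le> inverse (real (Suc k))" .
      qed
    qed (rule LIMSEQ_inverse_real_of_nat)
    have "Cauchy z"
    proof (rule CauchyI)
      fix \<epsilon> :: real assume \<epsilon>: "\<epsilon> > 0"
      \<comment> \<open>The form contributes at most \<open>4 * \<eta>\<close> and each of the
        \<open>card E\<close> functionals at most \<open>\<eta>\<close>; the 5 in place of 4 makes
        the final comparison with \<open>c * \<epsilon>\<^sup>2\<close> strict.\<close>
      define \<eta> where "\<eta> = c * \<epsilon>\<^sup>2 / (5 + real (card E))"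
      have \<eta>: "\<eta> > 0" using c \<epsilon> by (simp add: \<eta>_def)
      have "\<forall>\<^sub>F k in sequentially. norm (T (z k)) < \<eta>"
        using tendstoD[OF Tz \<eta>] by (simp add: dist_norm)
      then obtain k0 where k0: "\<And>k. k \<ge> k0 \<Longrightarrow> norm (T (z k)) < \<eta>"
        by (auto simp: eventually_sequentially)
      have "\<exists>k. \<forall>m\<ge>k. \<forall>n\<ge>k. norm (inner (v e) (z m) - inner (v e) (z n)) < sqrt \<eta>" if "e \<in> E" for e
        using convergent_Cauchy[OF r(2)[OF that]] \<eta> unfolding z_def
        by (intro CauchyD) auto
      then obtain h where h: "\<And>e m n. e \<in> E \<Longrightarrow> m \<ge> h e \<Longrightarrow> n \<ge> h e \<Longrightarrow> \<bar>inner (v e) (z m - z n)\<bar> < sqrt \<eta>"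
        by (simp add: inner_diff_right) metis
      define M where "M = Max (insert k0 (h ` E))"
      have M: "M \<ge> k0" "\<And>e. e \<in> E \<Longrightarrow> M \<ge> h e" using E by (auto simp: M_def)
      have "norm (z m - z n) < \<epsilon>" if "m \<ge> M" "n \<ge> M" for m n
      proof -
        have "inner (T (z m - z n)) (z m - z n) \<le> norm (T (z m - z n)) * norm (z m - z n)"
          by (rule norm_cauchy_schwarz)
        also have "\<dots> \<le> (\<eta> + \<eta>) * 2"
        proof (rule mult_mono)
          show "norm (T (z m - z n)) \<le> \<eta> + \<eta>"
            using norm_triangle_ineq4[of "T (z m)" "T (z n)"] k0[of m] k0[of n] that M
            by (simp add: T.diff)
          show "norm (z m - z n) \<le> 2"
            using norm_triangle_ineq4[of "z m" "z n"] by (simp add: z_def y1)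
        qed (use \<eta> in auto)
        finally have 1: "inner (T (z m - z n)) (z m - z n) \<le> 4 * \<eta>" by simp
        have 2: "(\<Sum>e\<in>E. (inner (v e) (z m - z n))\<^sup>2) \<le> (\<Sum>e\<in>E. \<eta>)"
        proof (rule sum_mono)
          fix e assume "e \<in> E"
          then have "\<bar>inner (v e) (z m - z n)\<bar>\<^sup>2 \<le> (sqrt \<eta>)\<^sup>2"
            using h[of e m n] M that by (intro power_mono) (auto intro: less_imp_le order_trans)
          then show "(inner (v e) (z m - z n))\<^sup>2 \<le> \<eta>" using \<eta> by simp
        qed
        have "c * (norm (z m - z n))\<^sup>2 \<le> (4 + real (card E)) * \<eta>"
          using control[of "z m - z n"] 1 2 by (simp add: T_def algebra_simps)
        also have "\<dots> < c * \<epsilon>\<^sup>2" using c \<epsilon> by (simp add: \<eta>_def field_simps)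
        finally have "(norm (z m - z n))\<^sup>2 < \<epsilon>\<^sup>2" using c by simp
        then show ?thesis using \<epsilon> by (simp add: power2_less_imp_less)
      qed
      then show "\<exists>M. \<forall>m\<ge>M. \<forall>n\<ge>M. norm (z m - z n) < \<epsilon>" by blast
    qed
    then obtain l where l: "z \<longlonglongrightarrow> l" by (auto simp: Cauchy_convergent_iff convergent_def)
    have "(\<lambda>k. norm (z k)) \<longlonglongrightarrow> norm l" by (intro tendsto_norm l)
    then have "norm l = 1" by (simp add: z_def y1 LIMSEQ_const_iff)
    have "T l = 0" using LIMSEQ_unique[OF T.tendsto[OF l] Tz] .
    then have "l \<in> N" by (simp add: T_def N_def)
    have "(\<lambda>k. inner l (z k)) \<longlonglongrightarrow> inner l l" by (intro tendsto_inner l tendsto_const)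
    moreover have "inner l (z k) = 0" for k using yN[OF \<open>l \<in> N\<close>] by (simp add: z_def)
    ultimately have "inner l l = 0" by (simp add: LIMSEQ_const_iff)
    with \<open>norm l = 1\<close> show False by simp
  qed
  then show ?thesis using that unfolding T_def by blast
qed

text \<open>On the eigenspace the form of \<open>A - a\<close> vanishes, so finitely many
  functionals control the norm and the dimension is finite. On the orthogonal complement
  \<open>A - a\<close> is bounded below by some \<open>d > 0\<close>. This gap rules out a trivial
  eigenspace when \<open>a\<close> is in the spectrum, and it isolates \<open>a\<close>.\<close>

lemma discrete_spectrumI:
  fixes v :: "'e \<Rightarrow> 'a"
  assumes E: "finite E" and c: "c > 0"
    and control: "\<And>x. c * (norm x)\<^sup>2 \<le> inner (A x - a *\<^sub>R x) x + (\<Sum>e\<in>E. (inner (v e) x)\<^sup>2)"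
    and a: "complex_of_real a \<in> spectrum A"
  shows "complex_of_real a \<in> discrete_spectrum A"
proof -
  define N where "N = {x. A x = a *\<^sub>R x}"
  have eig: "eigenspace A (complex_of_real a) = N" by (simp add: eigenspace_def N_def scaleC_of_real)
  have sub: "subspace N" by (auto simp: subspace_def N_def add scaleR scaleR_add_right)
  have cN: "c * (norm x)\<^sup>2 \<le> (\<Sum>e\<in>E. (inner (v e) x)\<^sup>2)" if "x \<in> N" for x
    using control[of x] that by (simp add: N_def)
  obtain S where S: "finite S" "S \<subseteq> N" "pairwise orthogonal S" "\<And>s. s \<in> S \<Longrightarrow> norm s = 1"
    "\<And>x. x \<in> N \<Longrightarrow> (\<Sum>s\<in>S. inner s x *\<^sub>R s) = x"
    using finite_orthonormal_basis[OF sub E c cN] by blast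
  obtain d where d: "d > 0" "\<And>x. (\<And>n. n \<in> N \<Longrightarrow> inner n x = 0) \<Longrightarrow> d * norm x \<le> norm (A x - a *\<^sub>R x)"
    using bounded_below_orthogonal_eigenspace[OF E c control N_def] by blast
  \<comment> \<open>\<open>S\<close> is an orthonormal basis over the reals, hence redundant over
    the complex numbers; for finite multiplicity a finite spanning set suffices.\<close>
  have "N \<subseteq> module.span scaleC S"
  proof
    fix x assume "x \<in> N"
    have "(\<Sum>s\<in>S. complex_of_real (inner s x) *\<^sub>C s) \<in> module.span scaleC S"
      by (intro module.span_sum[OF module_scaleC] module.span_scale[OF module_scaleC]
        module.span_base[OF module_scaleC])
    with S(5)[OF \<open>x \<in> N\<close>] show "x \<in> module.span scaleC S" by (simp add: scaleC_of_real)
  qed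
  moreover have "N \<noteq> {0}"
  proof
    assume "N = {0}"
    then have "d * norm x \<le> norm (A x - complex_of_real a *\<^sub>C x)" for x
      using d(2)[of x] by (simp add: scaleC_of_real)
    then have "complex_of_real a \<in> resolvent_set A" by (rule resolvent_setI[OF d(1)])
    with a show False by (simp add: spectrum_def)
  qed
  moreover have "complex_of_real a isolated_in spectrum A"
  proof -
    have "z \<in> resolvent_set A" if z: "z \<in> ball (complex_of_real a) d" "z \<noteq> complex_of_real a" for z
    proof (cases "z \<in> \<real>")
      case True
      then obtain b where b: "z = complex_of_real b" by (auto elim: Reals_cases)
      have ab: "\<bar>b - a\<bar> < d" "b \<noteq> a"
        using z by (auto simp: b dist_norm norm_minus_commute simp flip: of_real_diff)
      \<comment> \<open>\<open>A - b\<close> acts as \<open>a - b\<close> on the eigenspace, and on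
        its complement the gap \<open>d\<close> shrinks by at most \<open>\<bar>b - a\<bar>\<close>;
        \<open>\<delta>\<close> is the smaller of the two bounds.\<close>
      define \<delta> where "\<delta> = min \<bar>b - a\<bar> (d - \<bar>b - a\<bar>)"
      have \<delta>: "\<delta> > 0" using ab by (simp add: \<delta>_def)
      have "\<delta> * norm x \<le> norm (A x - b *\<^sub>R x)" for x
      proof -
        define n y where "n = (\<Sum>s\<in>S. inner s x *\<^sub>R s)" and "y = x - n"
        have "n \<in> N"
          using S(2) sub unfolding n_def by (intro subspace_sum subspace_scale) auto
        have Sy: "inner s y = 0" if "s \<in> S" for s
          using inner_orthonormal_sum[OF S(1,3,4) that, of x] by (simp add: y_def n_def inner_diff_right)
        have Ny: "inner m y = 0" if "m \<in> N" for m
          by (subst S(5)[OF that, symmetric]) (simp add: inner_sum_left Sy)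
        have split: "A x - b *\<^sub>R x = (a - b) *\<^sub>R n + (A y - b *\<^sub>R y)"
          using \<open>n \<in> N\<close> by (simp add: y_def diff N_def algebra_simps)
        have "inner n (A y) = 0"
          using self_adjoint[of n y] Ny[OF \<open>n \<in> N\<close>] \<open>n \<in> N\<close> by (simp add: N_def)
        then have "inner n (A y - b *\<^sub>R y) = 0" using Ny[OF \<open>n \<in> N\<close>] by (simp add: inner_diff_right)
        then have norm1: "(norm (A x - b *\<^sub>R x))\<^sup>2 = (a - b)\<^sup>2 * (norm n)\<^sup>2 + (norm (A y - b *\<^sub>R y))\<^sup>2"
          unfolding split power2_norm_eq_inner
          by (simp only: inner_add_left inner_add_right inner_scaleR_left inner_scaleR_right
              inner_commute[of "A y - b *\<^sub>R y" n] power2_eq_square)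
            (simp add: algebra_simps)
        have norm2: "(norm x)\<^sup>2 = (norm n)\<^sup>2 + (norm y)\<^sup>2"
        proof -
          have "x = n + y" by (simp add: y_def)
          then show ?thesis using Ny[OF \<open>n \<in> N\<close>] unfolding power2_norm_eq_inner
            by (simp add: inner_add_left inner_add_right inner_commute[of y n])
        qed
        have "d * norm y \<le> norm (A y - a *\<^sub>R y)" using d(2) Ny by blast
        also have "\<dots> \<le> norm (A y - b *\<^sub>R y) + \<bar>b - a\<bar> * norm y"
        proof -
          have "A y - a *\<^sub>R y = (A y - b *\<^sub>R y) + (b - a) *\<^sub>R y" by (simp add: algebra_simps)
          then show ?thesis by (metis norm_scaleR norm_triangle_ineq)
        qed
        finally have "(d - \<bar>b - a\<bar>) * norm y \<le> norm (A y - b *\<^sub>R y)" by (simp add: algebra_simps)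
        moreover have "\<delta> * norm y \<le> (d - \<bar>b - a\<bar>) * norm y"
          by (rule mult_right_mono) (auto simp: \<delta>_def)
        ultimately have "(\<delta> * norm y)\<^sup>2 \<le> (norm (A y - b *\<^sub>R y))\<^sup>2"
          using \<delta> by (intro power_mono) auto
        moreover have "\<delta>\<^sup>2 * (norm n)\<^sup>2 \<le> (a - b)\<^sup>2 * (norm n)\<^sup>2"
        proof (rule mult_right_mono)
          have "\<delta>\<^sup>2 \<le> \<bar>b - a\<bar>\<^sup>2" using \<delta> by (intro power_mono) (auto simp: \<delta>_def)
          then show "\<delta>\<^sup>2 \<le> (a - b)\<^sup>2" by (simp add: power2_commute)
        qed simp
        ultimately have "(\<delta> * norm x)\<^sup>2 \<le> (norm (A x - b *\<^sub>R x))\<^sup>2"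
          by (simp add: norm1 norm2 power_mult_distrib distrib_left)
        then show ?thesis by (rule power2_le_imp_le) simp
      qed
      then show ?thesis unfolding b by (intro resolvent_setI[OF \<delta>]) (simp add: scaleC_of_real)
    next
      case False
      then show ?thesis using spectrum_real by (auto simp: spectrum_def)
    qed
    moreover have "complex_of_real a \<in> ball (complex_of_real a) d" using d(1) by simp
    ultimately have "ball (complex_of_real a) d \<inter> spectrum A = {complex_of_real a}"
      using a unfolding spectrum_def by blast
    then show ?thesis using a unfolding isolated_in_def by blast
  qed
  ultimately show ?thesis
    using S(1) unfolding discrete_spectrum_def mem_Collect_eq eig by (intro conjI exI[of _ S])
qed

end

section \<open>Completeness of the function spaces\<close>

text \<open>Fatou's lemma in \<open>n\<close> for fixed \<open>m\<close>. Square integrability of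
  \<open>g\<close> then follows from that of \<open>f 0 - g\<close>.\<close>

lemma sq_integrable_limit_of_Cauchy:
  assumes f: "\<And>n. sq_integrable M (f n)" and cauchy: "\<And>m n. m \<le> n \<Longrightarrow> (\<integral>x. (cmod (f m x - f n x))\<^sup>2 \<partial>M) \<le> C m"
    and lim: "AE x in M. (\<lambda>n. f n x) \<longlonglongrightarrow> g x" and g [measurable]: "g \<in> borel_measurable M"
  shows "sq_integrable M g" "(\<integral>x. (cmod (f m x - g x))\<^sup>2 \<partial>M) \<le> C m"
proof -
  have [measurable]: "f n \<in> borel_measurable M" for n using f by (simp add: sq_integrable_def)
  have C: "0 \<le> C m" for m using cauchy[of m m] by simp
  have bound: "(\<integral>\<^sup>+x. ennreal ((cmod (f m x - g x))\<^sup>2) \<partial>M) \<le> ennreal (C m)" for m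
  proof -
    have "(\<integral>\<^sup>+x. ennreal ((cmod (f m x - g x))\<^sup>2) \<partial>M)
        = (\<integral>\<^sup>+x. liminf (\<lambda>n. ennreal ((cmod (f m x - f n x))\<^sup>2)) \<partial>M)"
    proof (rule nn_integral_cong_AE)
      show "AE x in M. ennreal ((cmod (f m x - g x))\<^sup>2) = liminf (\<lambda>n. ennreal ((cmod (f m x - f n x))\<^sup>2))"
        using lim
      proof eventually_elim
        case (elim x)
        have "(\<lambda>n. ennreal ((cmod (f m x - f n x))\<^sup>2)) \<longlonglongrightarrow> ennreal ((cmod (f m x - g x))\<^sup>2)"
          by (intro tendsto_ennrealI tendsto_power tendsto_norm tendsto_diff tendsto_const elim)
        then show ?case by (rule lim_imp_Liminf[OF sequentially_bot, symmetric])
      qed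
    qed
    also have "\<dots> \<le> liminf (\<lambda>n. \<integral>\<^sup>+x. ennreal ((cmod (f m x - f n x))\<^sup>2) \<partial>M)"
      by (rule nn_integral_liminf) simp
    also have "\<dots> \<le> limsup (\<lambda>n. \<integral>\<^sup>+x. ennreal ((cmod (f m x - f n x))\<^sup>2) \<partial>M)"
      by (rule Liminf_le_Limsup) simp
    also have "\<dots> \<le> ennreal (C m)"
    proof (rule Limsup_bounded)
      show "\<forall>\<^sub>F n in sequentially. (\<integral>\<^sup>+x. ennreal ((cmod (f m x - f n x))\<^sup>2) \<partial>M) \<le> ennreal (C m)"
        using eventually_ge_at_top[of m]
      proof eventually_elim
        case (elim n)
        have "integrable M (\<lambda>x. (cmod (f m x - f n x))\<^sup>2)"
          using sq_integrable_diff[OF f f, of m n] by (simp add: sq_integrable_def)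
        then show ?case using cauchy[OF elim] by (simp add: nn_integral_eq_integral ennreal_leI)
      qed
    qed
    finally show ?thesis .
  qed
  have int: "integrable M (\<lambda>x. (cmod (f m x - g x))\<^sup>2)" for m
    using le_less_trans[OF bound[of m] ennreal_less_top] by (intro integrableI_bounded) auto
  then have "sq_integrable M (\<lambda>x. f 0 x - g x)" by (simp add: sq_integrable_def)
  from sq_integrable_diff[OF f[of 0] this] show "sq_integrable M g" by simp
  have "ennreal (\<integral>x. (cmod (f m x - g x))\<^sup>2 \<partial>M) \<le> ennreal (C m)"
    using bound[of m] int[of m] by (simp add: nn_integral_eq_integral)
  then show "(\<integral>x. (cmod (f m x - g x))\<^sup>2 \<partial>M) \<le> C m"
    using C[of m] by (simp add: ennreal_le_iff)
qed

text \<open>For increments \<open>a\<^sub>n\<close> with \<open>\<integral>a\<^sub>n\<^sup>2 \<le> 4\<^sup>-\<^sup>n\<close> the series \<open>\<Sum>n. 2\<^sup>n * a\<^sub>n\<^sup>2\<close> is integrable, and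
  \<open>a\<^sub>n \<le> 2\<^sup>-\<^sup>n + 2\<^sup>n * a\<^sub>n\<^sup>2\<close> gives absolute convergence almost everywhere.\<close>

lemma AE_convergent_of_fast_Cauchy:
  fixes f :: "nat \<Rightarrow> 'a \<Rightarrow> complex"
  assumes f: "\<And>n. sq_integrable M (f n)"
    and fast: "\<And>n. (\<integral>x. (cmod (f (Suc n) x - f n x))\<^sup>2 \<partial>M) \<le> (1/4) ^ n"
  shows "AE x in M. convergent (\<lambda>n. f n x)"
proof -
  have [measurable]: "f n \<in> borel_measurable M" for n using f by (simp add: sq_integrable_def)
  define a where "a n x = cmod (f (Suc n) x - f n x)" for n x
  have a [measurable]: "a n \<in> borel_measurable M" for n unfolding a_def by measurable
  have int: "integrable M (\<lambda>x. (a n x)\<^sup>2)" for n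
    using sq_integrable_diff[OF f f, of "Suc n" n] by (simp add: sq_integrable_def a_def)
  have "(\<integral>\<^sup>+x. (\<Sum>n. ennreal (2 ^ n * (a n x)\<^sup>2)) \<partial>M) = (\<Sum>n. \<integral>\<^sup>+x. ennreal (2 ^ n * (a n x)\<^sup>2) \<partial>M)"
    by (rule nn_integral_suminf) measurable
  also have "\<dots> \<le> (\<Sum>n. ennreal ((1/2) ^ n))"
  proof (rule suminf_le)
    fix n
    have "(\<integral>\<^sup>+x. ennreal (2 ^ n * (a n x)\<^sup>2) \<partial>M) = ennreal (2 ^ n * (\<integral>x. (a n x)\<^sup>2 \<partial>M))"
      using int[of n] by (subst nn_integral_eq_integral) auto
    also have "\<dots> \<le> ennreal (2 ^ n * (1/4) ^ n)"
      using fast[of n] by (intro ennreal_leI mult_left_mono) (auto simp: a_def)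
    also have "2 ^ n * (1/4) ^ n = ((1/2) ^ n :: real)" by (simp flip: power_mult_distrib)
    finally show "(\<integral>\<^sup>+x. ennreal (2 ^ n * (a n x)\<^sup>2) \<partial>M) \<le> ennreal ((1/2) ^ n)" .
  qed auto
  also have "\<dots> = ennreal (\<Sum>n. (1/2) ^ n)" by (rule suminf_ennreal2) (auto intro: summable_geometric)
  finally have fin: "(\<integral>\<^sup>+x. (\<Sum>n. ennreal (2 ^ n * (a n x)\<^sup>2)) \<partial>M) \<noteq> \<infinity>"
    by (auto simp: top_unique)
  have "AE x in M. (\<Sum>n. ennreal (2 ^ n * (a n x)\<^sup>2)) \<noteq> \<infinity>"
    by (rule nn_integral_PInf_AE[OF _ fin]) measurable
  then show ?thesis
  proof eventually_elim
    case (elim x)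
    have "summable (\<lambda>n. 2 ^ n * (a n x)\<^sup>2)"
      by (rule summable_suminf_not_top) (use elim in auto)
    moreover have "summable (\<lambda>n. (1/2) ^ n :: real)" by (simp add: summable_geometric)
    ultimately have s: "summable (\<lambda>n. (1/2) ^ n + 2 ^ n * (a n x)\<^sup>2)" by (rule summable_add[rotated])
    have "summable (\<lambda>n. norm (f (Suc n) x - f n x))"
    proof (rule summable_comparison_test'[OF s])
      fix n
      have "a n x \<le> (1/2) ^ n + 2 ^ n * (a n x)\<^sup>2"
      proof (cases "a n x \<le> (1/2) ^ n")
        case True
        then show ?thesis by (simp add: add_increasing2)
      next
        case False
        then have "1 \<le> 2 ^ n * a n x" by (simp add: power_divide field_simps)
        then have "1 * a n x \<le> (2 ^ n * a n x) * a n x"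
          by (intro mult_right_mono) (auto simp: a_def)
        also have "\<dots> \<le> (1/2) ^ n + 2 ^ n * (a n x)\<^sup>2" by (simp add: power2_eq_square)
        finally show ?thesis by simp
      qed
      then show "norm (norm (f (Suc n) x - f n x)) \<le> (1/2) ^ n + 2 ^ n * (a n x)\<^sup>2"
        by (simp add: a_def)
    qed
    then have "summable (\<lambda>n. f (Suc n) x - f n x)" by (rule summable_norm_cancel)
    then have "convergent (\<lambda>n. \<Sum>i<n. f (Suc i) x - f i x)" by (simp add: summable_iff_convergent)
    then have "convergent (\<lambda>n. f n x - f 0 x)" by (simp add: sum_lessThan_telescope[of "\<lambda>n. f n x"])
    then obtain l where "(\<lambda>n. f n x - f 0 x) \<longlonglongrightarrow> l" by (auto simp: convergent_def)
    from tendsto_add[OF this tendsto_const[of "f 0 x"]] show ?case by (auto simp: convergent_def)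
  qed
qed

text \<open>Taking \<open>lim\<close> at every point yields a measurable function; its values where
  the sequence diverges only concern a null set.\<close>

lemma sq_integrable_limit_of_fast_Cauchy:
  assumes f: "\<And>n. sq_integrable M (f n)"
    and cauchy: "\<And>m n. m \<le> n \<Longrightarrow> (\<integral>x. (cmod (f m x - f n x))\<^sup>2 \<partial>M) \<le> (1/4) ^ m"
  shows "sq_integrable M (\<lambda>x. lim (\<lambda>n. f n x))"
    and "(\<integral>x. (cmod (f m x - lim (\<lambda>n. f n x)))\<^sup>2 \<partial>M) \<le> (1/4) ^ m"
proof -
  have [measurable]: "f n \<in> borel_measurable M" for n using f by (simp add: sq_integrable_def)
  have g: "(\<lambda>x. lim (\<lambda>n. f n x)) \<in> borel_measurable M" by measurable
  have "AE x in M. convergent (\<lambda>n. f n x)"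
    using cauchy[OF le_SucI[OF order_refl]]
    by (intro AE_convergent_of_fast_Cauchy f) (simp add: norm_minus_commute)
  then have lim: "AE x in M. (\<lambda>n. f n x) \<longlonglongrightarrow> lim (\<lambda>n. f n x)"
    by eventually_elim (simp add: convergent_LIMSEQ_iff)
  show "sq_integrable M (\<lambda>x. lim (\<lambda>n. f n x))"
    "(\<integral>x. (cmod (f m x - lim (\<lambda>n. f n x)))\<^sup>2 \<partial>M) \<le> (1/4) ^ m"
    using sq_integrable_limit_of_Cauchy[OF f cauchy lim g] by blast+
qed

lemma Cauchy_fast_subseq:
  fixes X :: "nat \<Rightarrow> 'a::real_normed_vector"
  assumes "Cauchy X"
  obtains r where "strict_mono (r::nat\<Rightarrow>nat)" "\<And>m n. m \<le> n \<Longrightarrow> norm (X (r m) - X (r n)) \<le> (1/2) ^ m"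
proof -
  have "\<exists>N. \<forall>m\<ge>N. \<forall>n\<ge>N. norm (X m - X n) < (1/2) ^ k" for k
    using CauchyD[OF assms, of "(1/2) ^ k"] by simp
  then obtain N where N: "\<And>k m n. m \<ge> N k \<Longrightarrow> n \<ge> N k \<Longrightarrow> norm (X m - X n) < (1/2) ^ k" by metis
  \<comment> \<open>The summand \<open>k\<close> makes \<open>r\<close> strictly increasing, and the
    sum dominates every \<open>N j\<close> with \<open>j \<le> k\<close>.\<close>
  define r where "r k = k + (\<Sum>j\<le>k. N j)" for k
  have "strict_mono r" by (rule strict_monoI_Suc) (simp add: r_def)
  moreover have "N m \<le> r n" if "m \<le> n" for m n
  proof -
    have "N m \<le> (\<Sum>j\<le>n. N j)" using that by (intro member_le_sum) auto
    then show ?thesis by (simp add: r_def)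
  qed
  ultimately show ?thesis using that[of r] N by (meson less_imp_le order_refl)
qed

lemma norm_abs_L2_torus:
  assumes "sq_integrable torus_measure f"
  shows "(norm (abs_L2_torus f))\<^sup>2 = (\<integral>x. (cmod (f x))\<^sup>2 \<partial>torus_measure)"
  using assms inner_L2_torus.abs_eq[of f f] unfolding norm_L2_torus_def
  by (simp add: L2_rel_def L2_inner_self)

lemma norm_abs_L2_sym:
  assumes "L2_sym_rel f f"
  shows "(norm (abs_L2_sym f))\<^sup>2 = (\<integral>x. (cmod (f x))\<^sup>2 \<partial>torus2_measure)"
  using assms inner_L2_sym.abs_eq[of f f] unfolding norm_L2_sym_def
  by (simp add: L2_inner_self)

lemma obtain_L2_torus:
  obtains f where "h = abs_L2_torus f" "sq_integrable torus_measure f"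
proof (induction h rule: L2_torus.abs_induct)
  case (1 f)
  then show ?case by (auto simp: L2_rel_def)
qed

lemma obtain_L2_sym:
  obtains f where "h = abs_L2_sym f" "L2_sym_rel f f"
  by (induction h rule: L2_sym.abs_induct) auto

lemma convergent_of_fast_subseq:
  fixes X :: "nat \<Rightarrow> 'a::real_normed_vector"
  assumes "Cauchy X" "strict_mono (r::nat\<Rightarrow>nat)" and l: "\<And>m. norm (X (r m) - l) \<le> (1/2) ^ m"
  shows "convergent X"
proof -
  have "(\<lambda>m. X (r m) - l) \<longlonglongrightarrow> 0"
    by (rule Lim_null_comparison[of _ "\<lambda>m. (1/2) ^ m"]) (auto simp: l LIMSEQ_realpow_zero)
  then have "(X \<circ> r) \<longlonglongrightarrow> l" by (simp add: LIM_zero_iff o_def)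
  then have "X \<longlonglongrightarrow> l" using Cauchy_converges_subseq[OF assms(1,2)] by blast
  then show ?thesis by (auto simp: convergent_def)
qed

instance L2_torus :: complete_space
proof
  fix X :: "nat \<Rightarrow> L2_torus" assume X: "Cauchy X"
  obtain r where r: "strict_mono (r::nat\<Rightarrow>nat)" "\<And>m n. m \<le> n \<Longrightarrow> norm (X (r m) - X (r n)) \<le> (1/2) ^ m"
    using Cauchy_fast_subseq[OF X] by blast
  have quarter: "((1/2) ^ m)\<^sup>2 = (1/4 :: real) ^ m" for m by (simp add: power2_eq_square flip: power_mult_distrib)
  have "\<forall>n. \<exists>f. X (r n) = abs_L2_torus f \<and> sq_integrable torus_measure f"
    using obtain_L2_torus by blast
  then obtain f where Xf: "\<And>n. X (r n) = abs_L2_torus (f n)" and ff: "\<And>n. sq_integrable torus_measure (f n)"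
    by metis
  have norm_diff: "(norm (abs_L2_torus h - abs_L2_torus h'))\<^sup>2 = (\<integral>x. (cmod (h x - h' x))\<^sup>2 \<partial>torus_measure)"
    if "sq_integrable torus_measure h" "sq_integrable torus_measure h'" for h h'
    using that by (subst minus_L2_torus.abs_eq)
      (simp_all add: L2_rel_def norm_abs_L2_torus sq_integrable_diff)
  have cauchy: "(\<integral>x. (cmod (f m x - f n x))\<^sup>2 \<partial>torus_measure) \<le> (1/4) ^ m" if "m \<le> n" for m n
    using power_mono[OF r(2)[OF that], of 2] unfolding Xf quarter by (simp add: norm_diff ff)
  define g where "g x = lim (\<lambda>n. f n x)" for x
  note g = sq_integrable_limit_of_fast_Cauchy[OF ff cauchy, folded g_def]
  have "norm (X (r m) - abs_L2_torus g) \<le> (1/2) ^ m" for m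
  proof (rule power2_le_imp_le)
    show "(norm (X (r m) - abs_L2_torus g))\<^sup>2 \<le> ((1/2) ^ m)\<^sup>2"
      using g(2)[of m] unfolding Xf quarter by (simp add: norm_diff ff g(1))
  qed simp
  then show "convergent X" by (rule convergent_of_fast_subseq[OF X r(1)])
qed

instance L2_sym :: complete_space
proof
  fix X :: "nat \<Rightarrow> L2_sym" assume X: "Cauchy X"
  obtain r where r: "strict_mono (r::nat\<Rightarrow>nat)" "\<And>m n. m \<le> n \<Longrightarrow> norm (X (r m) - X (r n)) \<le> (1/2) ^ m"
    using Cauchy_fast_subseq[OF X] by blast
  have quarter: "((1/2) ^ m)\<^sup>2 = (1/4 :: real) ^ m" for m by (simp add: power2_eq_square flip: power_mult_distrib)
  have "\<forall>n. \<exists>f. X (r n) = abs_L2_sym f \<and> L2_sym_rel f f"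
    using obtain_L2_sym by blast
  then obtain f where Xf: "\<And>n. X (r n) = abs_L2_sym (f n)" and ff: "\<And>n. L2_sym_rel (f n) (f n)"
    by metis
  have f: "sq_integrable torus2_measure (f n)" and sym: "AE x in torus2_measure. f n (snd x, fst x) = f n x" for n
    using ff[of n] by (simp_all add: L2_sym_rel_def L2_rel_def)
  have norm_diff: "(norm (abs_L2_sym h - abs_L2_sym h'))\<^sup>2 = (\<integral>x. (cmod (h x - h' x))\<^sup>2 \<partial>torus2_measure)"
    if "L2_sym_rel h h" "L2_sym_rel h' h'" for h h'
    using that L2_sym_rel_closure(3)[OF that]
    by (subst minus_L2_sym.abs_eq) (simp_all add: norm_abs_L2_sym)
  have cauchy: "(\<integral>x. (cmod (f m x - f n x))\<^sup>2 \<partial>torus2_measure) \<le> (1/4) ^ m" if "m \<le> n" for m n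
    using power_mono[OF r(2)[OF that], of 2] unfolding Xf quarter by (simp add: norm_diff ff)
  define g where "g x = lim (\<lambda>n. f n x)" for x
  note g = sq_integrable_limit_of_fast_Cauchy[OF f cauchy, folded g_def]
  have "AE x in torus2_measure. \<forall>n. f n (snd x, fst x) = f n x" using sym by (simp add: AE_all_countable)
  \<comment> \<open>Where all \<open>f n\<close> are symmetric the two sequences coincide term by
    term, so their \<open>lim\<close> agree whether or not they converge.\<close>
  then have "AE x in torus2_measure. g (snd x, fst x) = g x"
    by eventually_elim (simp add: g_def)
  then have gg: "L2_sym_rel g g" using g(1) by (simp add: L2_sym_rel_def L2_rel_def)
  have "norm (X (r m) - abs_L2_sym g) \<le> (1/2) ^ m" for m
  proof (rule power2_le_imp_le)
    show "(norm (X (r m) - abs_L2_sym g))\<^sup>2 \<le> ((1/2) ^ m)\<^sup>2"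
      using g(2)[of m] unfolding Xf quarter by (simp add: norm_diff ff gg)
  qed simp
  then show "convergent X" by (rule convergent_of_fast_subseq[OF X r(1)])
qed

section \<open>The operators as bounded self-adjoint operators\<close>

text \<open>Additivity and homogeneity hold because \<open>inner\<close> separates points, and the
  bound comes from testing with \<open>R x\<close>. Thus estimates for \<open>A12\<close> and
  \<open>A01\<close> carry over to \<open>A12_adj\<close> and \<open>A01_adj\<close>.\<close>

lemma bounded_linear_adjoint:
  fixes Q :: "'b::real_inner \<Rightarrow> 'a::real_inner" and R :: "'a \<Rightarrow> 'b"
  assumes Q: "bounded_linear Q" and adj: "\<And>x y. inner (Q y) x = inner y (R x)"
  shows "bounded_linear R"
proof -
  obtain K where K: "K > 0" "\<And>y. norm (Q y) \<le> norm y * K" using bounded_linear.pos_bounded[OF Q] by blast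
  have eqI: "u = v" if "\<And>y. inner y u = inner y v" for u v :: 'b
    using that[of "u - v"] by (metis inner_diff_right inner_eq_zero_iff right_minus_eq)
  show ?thesis
  proof (rule bounded_linear_intro[where K = K])
    show "R (x + y) = R x + R y" for x y
      by (rule eqI) (simp add: inner_add_right adj[symmetric])
    show "R (r *\<^sub>R x) = r *\<^sub>R R x" for r x
      by (rule eqI) (simp add: adj[symmetric])
    show "norm (R x) \<le> norm x * K" for x
    proof -
      have "norm (R x) * norm (R x) = inner (Q (R x)) x"
        by (simp add: adj power2_norm_eq_inner flip: power2_eq_square)
      also have "\<dots> \<le> norm (Q (R x)) * norm x" by (rule norm_cauchy_schwarz)
      also have "\<dots> \<le> norm (R x) * K * norm x" by (intro mult_right_mono K) simp
      finally have "norm (R x) * norm (R x) \<le> norm (R x) * (norm x * K)" by (simp add: mult_ac)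
      then show ?thesis using K(1) by (cases "norm (R x) = 0") auto
    qed
  qed
qed

lemma self_adjoint_op_block:
  fixes P :: "'a::{real_inner, complete_space, complex_normed_vector} \<Rightarrow> 'a"
    and S :: "'b::{real_inner, complete_space, complex_normed_vector} \<Rightarrow> 'b"
  assumes P: "self_adjoint_op P" and S: "self_adjoint_op S"
    and Q: "bounded_linear Q" "\<And>c y. Q (c *\<^sub>C y) = c *\<^sub>C Q y"
    and R: "\<And>c x. R (c *\<^sub>C x) = c *\<^sub>C R x" and adj: "\<And>x y. inner (Q y) x = inner y (R x)"
  shows "self_adjoint_op (\<lambda>f. (P (fst f) + \<mu> *\<^sub>R Q (snd f), \<mu> *\<^sub>R R (fst f) + S (snd f)))"
proof -
  interpret P: self_adjoint_op P by fact
  interpret S: self_adjoint_op S by fact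
  have R': "bounded_linear R" by (rule bounded_linear_adjoint[OF Q(1) adj])
  show ?thesis
  proof (rule self_adjoint_op.intro)
    show "bounded_linear (\<lambda>f. (P (fst f) + \<mu> *\<^sub>R Q (snd f), \<mu> *\<^sub>R R (fst f) + S (snd f)))"
      by (intro bounded_linear_Pair bounded_linear_add bounded_linear_const_scaleR
          bounded_linear_compose[OF P.bounded_linear bounded_linear_fst]
          bounded_linear_compose[OF S.bounded_linear bounded_linear_snd]
          bounded_linear_compose[OF Q(1) bounded_linear_snd]
          bounded_linear_compose[OF R' bounded_linear_fst])
    show "(P (fst (c *\<^sub>C f)) + \<mu> *\<^sub>R Q (snd (c *\<^sub>C f)), \<mu> *\<^sub>R R (fst (c *\<^sub>C f)) + S (snd (c *\<^sub>C f)))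
        = c *\<^sub>C (P (fst f) + \<mu> *\<^sub>R Q (snd f), \<mu> *\<^sub>R R (fst f) + S (snd f))" for c f
      by (simp add: scaleC_prod_def P.scaleC S.scaleC Q R scaleC_add_right scaleC_scaleR)
    show "inner (P (fst f) + \<mu> *\<^sub>R Q (snd f), \<mu> *\<^sub>R R (fst f) + S (snd f)) g
        = inner f (P (fst g) + \<mu> *\<^sub>R Q (snd g), \<mu> *\<^sub>R R (fst g) + S (snd g))" for f g
      using adj[of "snd f" "fst g"] adj[of "snd g" "fst f"]
      by (simp add: inner_prod_def inner_add_left inner_add_right P.self_adjoint S.self_adjoint
          inner_commute[of "R (fst f)"] inner_commute[of "Q (snd g)"])
  qed
qed

lemma L2_rel_refl: "L2_rel M f f \<longleftrightarrow> sq_integrable M f"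
  by (simp add: L2_rel_def)

text \<open>After \<open>transfer\<close> an operator identity relates two representatives that
  agree at every point; this leaves only square integrability of one of them.\<close>

lemma L2_rel_cong: "L2_rel M f f \<Longrightarrow> f = g \<Longrightarrow> L2_rel M f g"
  by simp

lemma L2_inner_mult_real:
  "L2_inner M (\<lambda>x. complex_of_real (w x) * f x) g = L2_inner M f (\<lambda>x. complex_of_real (w x) * g x)"
  by (simp add: L2_inner_def mult_ac)

lemma integral_mult_bounded_le:
  assumes f: "sq_integrable M f" and w: "w \<in> borel_measurable M" "\<And>x. \<bar>w x\<bar> \<le> B"
  shows "(\<integral>x. (cmod (complex_of_real (w x) * f x))\<^sup>2 \<partial>M) \<le> B\<^sup>2 * (\<integral>x. (cmod (f x))\<^sup>2 \<partial>M)"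
proof -
  have "(\<integral>x. (cmod (complex_of_real (w x) * f x))\<^sup>2 \<partial>M) \<le> (\<integral>x. B\<^sup>2 * (cmod (f x))\<^sup>2 \<partial>M)"
  proof (rule integral_mono)
    have "sq_integrable M (\<lambda>x. complex_of_real (w x) * f x)"
      by (rule sq_integrable_mult_bounded[OF f]) (use w in auto)
    then show "integrable M (\<lambda>x. (cmod (complex_of_real (w x) * f x))\<^sup>2)" by (simp add: sq_integrable_def)
    show "integrable M (\<lambda>x. B\<^sup>2 * (cmod (f x))\<^sup>2)" using f by (simp add: sq_integrable_def)
    show "(cmod (complex_of_real (w x) * f x))\<^sup>2 \<le> B\<^sup>2 * (cmod (f x))\<^sup>2" for x
      using power_mono[OF w(2)[of x], of 2] by (simp add: norm_mult power_mult_distrib mult_right_mono)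
  qed
  then show ?thesis by simp
qed

lemma norm_le_of_square_le: "(norm x)\<^sup>2 \<le> B\<^sup>2 * (norm y)\<^sup>2 \<Longrightarrow> 0 \<le> B \<Longrightarrow> norm x \<le> norm y * B"
  by (rule power2_le_imp_le) (simp_all add: power_mult_distrib mult.commute)

lemma bounded_linear_complex_linear:
  fixes T :: "'a::complex_normed_vector \<Rightarrow> 'b::complex_normed_vector"
  assumes "\<And>x y. T (x + y) = T x + T y" "\<And>c x. T (c *\<^sub>C x) = c *\<^sub>C T x" "\<And>x. norm (T x) \<le> norm x * K"
  shows "bounded_linear T"
  by (rule bounded_linear_intro[OF assms(1) _ assms(3)]) (simp add: assms(2) flip: scaleC_of_real)

section \<open>Diagonal blocks: multiplication operators\<close>

lemma self_adjoint_A11: "self_adjoint_op (A11 \<gamma>)"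
proof (rule self_adjoint_op.intro)
  have add: "A11 \<gamma> (f + g) = A11 \<gamma> f + A11 \<gamma> g" for f g
    by transfer (rule L2_rel_cong[OF L2_rel_mult_bounded[OF L2_rel_closure(2) _ w1_bound]],
      auto simp: distrib_left)
  show C: "A11 \<gamma> (c *\<^sub>C f) = c *\<^sub>C A11 \<gamma> f" for c f
    by transfer (rule L2_rel_cong[OF L2_rel_mult_bounded[OF L2_rel_closure(5) _ w1_bound]], auto)
  have "(norm (A11 \<gamma> f))\<^sup>2 \<le> (6 + \<bar>\<gamma>\<bar>)\<^sup>2 * (norm f)\<^sup>2" for f
    unfolding power2_norm_eq_inner
    by transfer (auto simp: L2_rel_refl L2_inner_self intro!: integral_mult_bounded_le w1_bound)
  from norm_le_of_square_le[OF this] show "bounded_linear (A11 \<gamma>)"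
    by (intro bounded_linear_complex_linear[OF add C]) auto
  show "inner (A11 \<gamma> f) g = inner f (A11 \<gamma> g)" for f g
    by transfer (simp add: L2_inner_mult_real)
qed

lemma self_adjoint_A11_fiber: "self_adjoint_op (A11_fiber k)"
proof (rule self_adjoint_op.intro)
  have add: "A11_fiber k (f + g) = A11_fiber k f + A11_fiber k g" for f g
    by transfer (rule L2_rel_cong[OF L2_rel_mult_bounded[OF L2_rel_closure(2) w2_fiber_measurable w2_bound]],
      auto simp: distrib_left)
  show C: "A11_fiber k (c *\<^sub>C f) = c *\<^sub>C A11_fiber k f" for c f
    by transfer (rule L2_rel_cong[OF L2_rel_mult_bounded[OF L2_rel_closure(5) w2_fiber_measurable w2_bound]], auto)
  have "(norm (A11_fiber k f))\<^sup>2 \<le> 18\<^sup>2 * (norm f)\<^sup>2" for f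
    unfolding power2_norm_eq_inner
    by transfer (auto simp: L2_rel_refl L2_inner_self
        intro!: integral_mult_bounded_le[OF _ w2_fiber_measurable w2_bound, simplified])
  from norm_le_of_square_le[OF this] show "bounded_linear (A11_fiber k)"
    by (intro bounded_linear_complex_linear[OF add C]) auto
  show "inner (A11_fiber k f) g = inner f (A11_fiber k g)" for f g
    by transfer (simp add: L2_inner_mult_real)
qed

lemma L2_sym_rel_mult_w2:
  "L2_sym_rel f f \<Longrightarrow> L2_sym_rel (\<lambda>x. complex_of_real (w2 (fst x) (snd x)) * f x)
     (\<lambda>x. complex_of_real (w2 (fst x) (snd x)) * f x)"
  using L2_rel_mult_bounded[OF _ w2_measurable w2_bound]
  by (auto simp: L2_sym_rel_def w2_commute elim: eventually_mono)

lemma self_adjoint_A22: "self_adjoint_op A22"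
proof (rule self_adjoint_op.intro)
  have cong: "L2_sym_rel f f \<Longrightarrow> f = g \<Longrightarrow> L2_sym_rel f g" for f g by simp
  have add: "A22 (f + g) = A22 f + A22 g" for f g
    by transfer (rule cong[OF L2_sym_rel_mult_w2[OF L2_sym_rel_closure(2)]], auto simp: distrib_left)
  show C: "A22 (c *\<^sub>C f) = c *\<^sub>C A22 f" for c f
    by transfer (rule cong[OF L2_sym_rel_mult_w2[OF L2_sym_rel_closure(5)]], auto)
  have "(norm (A22 f))\<^sup>2 \<le> 18\<^sup>2 * (norm f)\<^sup>2" for f
    unfolding power2_norm_eq_inner
    by transfer (auto simp: L2_sym_rel_def L2_rel_refl L2_inner_self
        intro!: integral_mult_bounded_le[OF _ w2_measurable w2_bound, simplified])
  from norm_le_of_square_le[OF this] show "bounded_linear A22"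
    by (intro bounded_linear_complex_linear[OF add C]) auto
  show "inner (A22 f) g = inner f (A22 g)" for f g
    by transfer (simp add: L2_inner_mult_real)
qed

lemma self_adjoint_A00: "self_adjoint_op (A00_fiber \<gamma> k)"
proof (rule self_adjoint_op.intro)
  show "bounded_linear (A00_fiber \<gamma> k)" unfolding A00_fiber_def by (rule bounded_linear_mult_right)
  show "A00_fiber \<gamma> k (c *\<^sub>C x) = c *\<^sub>C A00_fiber \<gamma> k x" for c x
    by (simp add: A00_fiber_def scaleC_complex_def)
  show "inner (A00_fiber \<gamma> k x) y = inner x (A00_fiber \<gamma> k y)" for x y
    by (simp add: A00_fiber_def inner_complex_def)
qed

section \<open>Off-diagonal blocks: integration and its adjoint\<close>

definition torus_vol :: real where "torus_vol = measure torus_measure (space torus_measure)"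

lemma torus_vol_nonneg: "0 \<le> torus_vol" by (simp add: torus_vol_def)

lemma A01_add: "A01 (f + g) = A01 f + A01 g"
  by transfer (simp add: L2_rel_refl sq_integrable_integrable finite_measure_torus distrib_left)

lemma A01_scaleC: "A01 (c *\<^sub>C f) = c *\<^sub>C A01 f"
  unfolding scaleC_complex_def by transfer simp

lemma A01_adj_scaleC: "A01_adj (c *\<^sub>C x) = c *\<^sub>C A01_adj x"
  unfolding scaleC_complex_def
  by transfer (simp add: L2_rel_refl sq_integrable_const finite_measure_torus mult_ac)

lemma bounded_linear_A01: "bounded_linear A01"
proof (rule bounded_linear_complex_linear[OF A01_add A01_scaleC])
  have "(norm (A01 f))\<^sup>2 \<le> (sqrt (torus_vol + 1))\<^sup>2 * (norm f)\<^sup>2" for f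
    unfolding power2_norm_eq_inner[of f]
  proof transfer
    fix f assume "L2_rel torus_measure f f"
    then have "(cmod (\<integral>x. f x \<partial>torus_measure))\<^sup>2 \<le> (torus_vol + 1) * (\<integral>x. (cmod (f x))\<^sup>2 \<partial>torus_measure)"
      unfolding torus_vol_def by (intro sq_integrable_integral finite_measure_torus) (simp add: L2_rel_refl)
    moreover have "(cmod (complex_of_real (1 / sqrt 2) * (\<integral>x. f x \<partial>torus_measure)))\<^sup>2
        \<le> (cmod (\<integral>x. f x \<partial>torus_measure))\<^sup>2"
      unfolding norm_mult power_mult_distrib by (simp add: norm_divide power_divide)
    ultimately have "(cmod (complex_of_real (1 / sqrt 2) * (\<integral>x. f x \<partial>torus_measure)))\<^sup>2
        \<le> (torus_vol + 1) * (\<integral>x. (cmod (f x))\<^sup>2 \<partial>torus_measure)"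
      by (rule order_trans[rotated])
    then show "(cmod (complex_of_real (1 / sqrt 2) * (\<integral>x. f x \<partial>torus_measure)))\<^sup>2
        \<le> (sqrt (torus_vol + 1))\<^sup>2 * Re (L2_inner torus_measure f f)"
      using torus_vol_nonneg by (simp add: L2_inner_self)
  qed
  then show "norm (A01 f) \<le> norm f * sqrt (torus_vol + 1)" for f
    by (rule norm_le_of_square_le) (simp add: torus_vol_nonneg)
qed

lemma torus2_integrable:
  "sq_integrable torus2_measure f \<Longrightarrow> integrable torus2_measure f"
  by (intro sq_integrable_integrable finite_measure_torus2)

lemma A12_add: "A12 (f + g) = A12 f + A12 g"
proof transfer
  fix f g assume f: "L2_sym_rel f f" and g: "L2_sym_rel g g"
  then have i: "integrable torus2_measure f" "integrable torus2_measure g"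
    by (auto simp: L2_sym_rel_def L2_rel_refl intro: torus2_integrable)
  have "AE k in torus_measure. (\<integral>t. f (k, t) + g (k, t) \<partial>torus_measure)
      = (\<integral>t. f (k, t) \<partial>torus_measure) + (\<integral>t. g (k, t) \<partial>torus_measure)"
    using torus2.AE_integrable_fst'[OF i(1)] torus2.AE_integrable_fst'[OF i(2)]
    by eventually_elim simp
  moreover have "sq_integrable torus_measure (\<lambda>k. \<integral>t. h (k, t) \<partial>torus_measure)" if "L2_sym_rel h h" for h
    using L2_rel_partial_integral[of h h] that by (simp add: L2_sym_rel_def L2_rel_refl)
  ultimately show "L2_rel torus_measure (\<lambda>k. \<integral>t. f (k, t) + g (k, t) \<partial>torus_measure)
      (\<lambda>x. (\<integral>t. f (x, t) \<partial>torus_measure) + (\<integral>t. g (x, t) \<partial>torus_measure))"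
    using L2_sym_rel_closure(2)[OF f g] f g by (simp add: L2_rel_def sq_integrable_add)
qed

lemma A12_scaleC: "A12 (c *\<^sub>C f) = c *\<^sub>C A12 f"
proof transfer
  fix c f assume "L2_sym_rel f f"
  then have "sq_integrable torus_measure (\<lambda>k. \<integral>t. f (k, t) \<partial>torus_measure)"
    using L2_rel_partial_integral[of f f] by (simp add: L2_sym_rel_def L2_rel_refl)
  then show "L2_rel torus_measure (\<lambda>k. \<integral>t. c * f (k, t) \<partial>torus_measure)
      (\<lambda>x. c * (\<integral>t. f (x, t) \<partial>torus_measure))"
    by (simp add: L2_rel_refl sq_integrable_cmult)
qed

lemma A12_adj_scaleC: "A12_adj (c *\<^sub>C x) = c *\<^sub>C A12_adj x"
proof transfer
  fix c :: complex and f assume f: "L2_rel torus_measure f f"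
  have "L2_sym_rel (\<lambda>x. (f (fst x) + f (snd x)) / 2) (\<lambda>x. (f (fst x) + f (snd x)) / 2)"
    using A12_adj.rsp f by (auto simp: rel_fun_def)
  from L2_sym_rel_closure(5)[OF this, of c]
  show "L2_sym_rel (\<lambda>x. (c * f (fst x) + c * f (snd x)) / 2) (\<lambda>x. c * ((f (fst x) + f (snd x)) / 2))"
    by (simp add: distrib_left)
qed

lemma integral_torus2_swap:
  fixes f :: "_ \<Rightarrow> 'b::{banach, second_countable_topology}"
  assumes "f \<in> borel_measurable torus2_measure"
  shows "(\<integral>x. f (snd x, fst x) \<partial>torus2_measure) = (\<integral>x. f x \<partial>torus2_measure)"
  using torus2.integral_product_swap[OF assms] by (simp add: case_prod_beta')

text \<open>By the symmetry of \<open>f\<close>, exchanging the variables shows that both summands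
  of \<open>A12_adj g\<close> contribute the same integral, which the factor 1/2 compensates; Fubini
  does the rest.\<close>

lemma A12_adj_inner: "inner (A12 f) g = inner f (A12_adj g)"
proof transfer
  fix f g assume f: "L2_sym_rel f f" and "L2_rel torus_measure g g"
  then have g: "sq_integrable torus_measure g" by (simp add: L2_rel_refl)
  have f': "sq_integrable torus2_measure f" "AE x in torus2_measure. f (snd x, fst x) = f x"
    using f by (simp_all add: L2_sym_rel_def L2_rel_refl)
  have g': "sq_integrable torus2_measure (\<lambda>x. g (fst x))" "sq_integrable torus2_measure (\<lambda>x. g (snd x))"
    using L2_rel_fst_snd[of g g] g by (simp_all add: L2_rel_refl)
  note i = sq_integrable_inner[OF f'(1) g'(1)] sq_integrable_inner[OF f'(1) g'(2)]
  have "L2_inner torus2_measure f (\<lambda>x. (g (fst x) + g (snd x)) / 2)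
      = ((\<integral>x. f x * cnj (g (fst x)) \<partial>torus2_measure) + (\<integral>x. f x * cnj (g (snd x)) \<partial>torus2_measure)) / 2"
    using i by (simp add: L2_inner_def distrib_left add_divide_distrib)
  also have "(\<integral>x. f x * cnj (g (snd x)) \<partial>torus2_measure)
      = (\<integral>x. f (snd x, fst x) * cnj (g (fst x)) \<partial>torus2_measure)"
    using integral_torus2_swap[OF borel_measurable_integrable[OF i(2)]] by simp
  also have "\<dots> = (\<integral>x. f x * cnj (g (fst x)) \<partial>torus2_measure)"
  proof (rule integral_cong_AE)
    show "AE x in torus2_measure. f (snd x, fst x) * cnj (g (fst x)) = f x * cnj (g (fst x))"
      using f'(2) by eventually_elim simp
    show "(\<lambda>x. f x * cnj (g (fst x))) \<in> borel_measurable torus2_measure"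
      using i(1) by (rule borel_measurable_integrable)
    have "(\<lambda>x. (\<lambda>x. f x * cnj (g (snd x))) (snd x, fst x)) \<in> borel_measurable torus2_measure"
      by (rule measurable_compose[OF _ borel_measurable_integrable[OF i(2)]]) simp
    then show "(\<lambda>x. f (snd x, fst x) * cnj (g (fst x))) \<in> borel_measurable torus2_measure" by simp
  qed
  also have "(\<integral>x. f x * cnj (g (fst x)) \<partial>torus2_measure)
      = (\<integral>k. (\<integral>t. f (k, t) \<partial>torus_measure) * cnj (g k) \<partial>torus_measure)"
    using torus2.integral_fst'[OF i(1)] by simp
  finally show "Re (L2_inner torus_measure (\<lambda>k. \<integral>t. f (k, t) \<partial>torus_measure) g)
      = Re (L2_inner torus2_measure f (\<lambda>x. (g (fst x) + g (snd x)) / 2))"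
    by (simp add: L2_inner_def)
qed

lemma bounded_linear_A12: "bounded_linear A12"
proof (rule bounded_linear_complex_linear[OF A12_add A12_scaleC])
  have "(norm (A12 f))\<^sup>2 \<le> (sqrt (torus_vol + 1))\<^sup>2 * (norm f)\<^sup>2" for f
    unfolding power2_norm_eq_inner
  proof transfer
    fix f assume f: "L2_sym_rel f f"
    then have sq: "sq_integrable torus2_measure f" by (simp add: L2_sym_rel_def L2_rel_refl)
    then have [measurable]: "f \<in> borel_measurable torus2_measure" by (simp add: sq_integrable_def)
    have i: "integrable torus2_measure (\<lambda>x. (cmod (f x))\<^sup>2)" using sq by (simp add: sq_integrable_def)
    have "sq_integrable torus_measure (\<lambda>k. \<integral>t. f (k, t) \<partial>torus_measure)"
      using L2_rel_partial_integral[of f f] sq by (simp add: L2_rel_refl)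
    then have "(\<integral>k. (cmod (\<integral>t. f (k, t) \<partial>torus_measure))\<^sup>2 \<partial>torus_measure)
        \<le> (\<integral>k. (torus_vol + 1) * (\<integral>t. (cmod (f (k, t)))\<^sup>2 \<partial>torus_measure) \<partial>torus_measure)"
    proof (intro integral_mono_AE)
      show "integrable torus_measure (\<lambda>k. (torus_vol + 1) * (\<integral>t. (cmod (f (k, t)))\<^sup>2 \<partial>torus_measure))"
        using torus2.integrable_fst'[OF i] by simp
      show "AE k in torus_measure. (cmod (\<integral>t. f (k, t) \<partial>torus_measure))\<^sup>2
          \<le> (torus_vol + 1) * (\<integral>t. (cmod (f (k, t)))\<^sup>2 \<partial>torus_measure)"
        using torus2.AE_integrable_fst'[OF i] AE_space
      proof eventually_elim
        case (elim k)
        have "(\<lambda>t. f (k, t)) \<in> borel_measurable torus_measure" using elim(2) by measurable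
        with elim(1) show ?case unfolding torus_vol_def
          by (intro sq_integrable_integral finite_measure_torus) (simp add: sq_integrable_def)
      qed
    qed (simp add: sq_integrable_def)
    also have "\<dots> = (torus_vol + 1) * (\<integral>x. (cmod (f x))\<^sup>2 \<partial>torus2_measure)"
      using torus2.integral_fst'[OF i] by simp
    finally show "Re (L2_inner torus_measure (\<lambda>k. \<integral>t. f (k, t) \<partial>torus_measure)
        (\<lambda>k. \<integral>t. f (k, t) \<partial>torus_measure))
        \<le> (sqrt (torus_vol + 1))\<^sup>2 * Re (L2_inner torus2_measure f f)"
      using torus_vol_nonneg by (simp add: L2_inner_self)
  qed
  then show "norm (A12 f) \<le> norm f * sqrt (torus_vol + 1)" for f
    by (rule norm_le_of_square_le) (simp add: torus_vol_nonneg)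
qed

lemma self_adjoint_A_op: "self_adjoint_op (A_op \<gamma> \<mu>)"
  unfolding A_op_def[abs_def]
  by (intro self_adjoint_op_block self_adjoint_A11 self_adjoint_A22 bounded_linear_A12 A12_scaleC
      A12_adj_scaleC A12_adj_inner)

lemma self_adjoint_A_fiber: "self_adjoint_op (A_fiber \<gamma> \<mu> k)"
  unfolding A_fiber_def[abs_def]
  by (intro self_adjoint_op_block self_adjoint_A00 self_adjoint_A11_fiber bounded_linear_A01 A01_scaleC
      A01_adj_scaleC A01_adj_inner)

section \<open>The integral of the resolvent symbol\<close>

text \<open>The symbol of the resolvent of \<open>A11_fiber k\<close> at \<open>z\<close>. Read as a
  function of both momenta, it is also the kernel of the integral operator left by the
  elimination.\<close>

definition G :: "real \<Rightarrow> real^3 \<Rightarrow> real^3 \<Rightarrow> real" where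
  "G z k p = 1 / (w2 k p - z)"

definition I_int :: "real \<Rightarrow> real^3 \<Rightarrow> real" where
  "I_int z k = (\<integral>t. G z k t \<partial>torus_measure)"

lemma eps_nonneg: "0 \<le> eps k"
  unfolding eps_def by (intro sum_nonneg) simp

lemma w2_nonneg: "0 \<le> w2 k p"
  by (simp add: w2_def eps_nonneg)

lemma G_bounds:
  assumes "z < 0" shows "0 < G z k p" "G z k p \<le> 1 / (- z)"
  using w2_nonneg[of k p] assms by (auto simp: G_def field_simps)

lemma G_commute: "G z k p = G z p k"
  by (simp add: G_def w2_commute)

lemma G_measurable2: "(\<lambda>x. G z (fst x) (snd x)) \<in> borel_measurable torus2_measure"
  unfolding G_def using w2_measurable by measurable

lemma G_measurable1: "G z k \<in> borel_measurable torus_measure"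
  unfolding G_def[abs_def] using w2_fiber_measurable by measurable

lemma G_integrable: "z < 0 \<Longrightarrow> integrable torus_measure (G z k)"
  using G_bounds[of z k]
  by (intro torus.integrable_const_bound[where B = "1 / (- z)"] G_measurable1)
    (auto simp: abs_of_pos)

lemma integral_torus_le:
  assumes "integrable torus_measure f" "\<And>t. f t \<le> B"
  shows "(\<integral>t. f t \<partial>torus_measure) \<le> torus_vol * B"
proof -
  have "(\<integral>t. f t \<partial>torus_measure) \<le> (\<integral>t. B \<partial>torus_measure)"
    by (rule integral_mono) (use assms in auto)
  then show ?thesis by (simp add: torus_vol_def)
qed

lemma I_int_bounds:
  assumes "z < 0" shows "0 \<le> I_int z k" "I_int z k \<le> torus_vol / (- z)"
proof -
  show "0 \<le> I_int z k" unfolding I_int_def by (intro Bochner_Integration.integral_nonneg) (simp add: less_imp_le G_bounds assms)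
  show "I_int z k \<le> torus_vol / (- z)"
    using integral_torus_le[OF G_integrable[OF assms] G_bounds(2)[OF assms]] by (simp add: I_int_def)
qed

section \<open>Lipschitz estimates in momentum and energy\<close>

lemma abs_cos_diff_le: "\<bar>cos x - cos y\<bar> \<le> \<bar>x - y\<bar>" for x y :: real
proof -
  have "\<bar>cos x - cos y\<bar> = 2 * (\<bar>sin ((x + y) / 2)\<bar> * \<bar>sin ((y - x) / 2)\<bar>)"
    by (simp add: cos_diff_cos abs_mult)
  also have "\<dots> \<le> 2 * (1 * \<bar>(y - x) / 2\<bar>)"
    by (intro mult_left_mono mult_mono abs_sin_le_one abs_sin_x_le_abs_x) auto
  finally show ?thesis by simp
qed

lemma eps_Lipschitz: "\<bar>eps k - eps p\<bar> \<le> 3 * norm (k - p)"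
proof -
  have "\<bar>eps k - eps p\<bar> = \<bar>\<Sum>i\<in>UNIV. cos (p $ i) - cos (k $ i)\<bar>"
    by (simp add: eps_def flip: sum_subtractf)
  also have "\<dots> \<le> (\<Sum>i\<in>(UNIV::3 set). norm (k - p))"
  proof (intro order_trans[OF sum_abs] sum_mono)
    fix i show "\<bar>cos (p $ i) - cos (k $ i)\<bar> \<le> norm (k - p)"
      using abs_cos_diff_le[of "p $ i" "k $ i"] component_le_norm_cart[of "k - p" i]
      by (simp add: abs_minus_commute)
  qed
  finally show ?thesis by simp
qed

lemma w2_Lipschitz: "\<bar>w2 k p - w2 k' p'\<bar> \<le> 5 * (norm (k - k') + norm (p - p'))"
proof -
  have "(1/2) *\<^sub>R (k + p) - (1/2) *\<^sub>R (k' + p') = (1/2) *\<^sub>R ((k - k') + (p - p'))"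
    by (simp add: algebra_simps)
  then have "norm ((1/2) *\<^sub>R (k + p) - (1/2) *\<^sub>R (k' + p')) = norm ((k - k') + (p - p')) / 2"
    by simp
  also have "\<dots> \<le> (norm (k - k') + norm (p - p')) / 2"
    using norm_triangle_ineq[of "k - k'" "p - p'"] by simp
  finally have n: "norm ((1/2) *\<^sub>R (k + p) - (1/2) *\<^sub>R (k' + p')) \<le> (norm (k - k') + norm (p - p')) / 2" .
  have "\<bar>w2 k p - w2 k' p'\<bar> \<le> \<bar>eps k - eps k'\<bar>
      + \<bar>eps ((1/2) *\<^sub>R (k + p)) - eps ((1/2) *\<^sub>R (k' + p'))\<bar> + \<bar>eps p - eps p'\<bar>"
    unfolding w2_def by linarith
  also have "\<dots> \<le> 3 * norm (k - k') + 3 * ((norm (k - k') + norm (p - p')) / 2) + 3 * norm (p - p')"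
    by (intro add_mono eps_Lipschitz order_trans[OF eps_Lipschitz] mult_left_mono n) simp
  \<comment> \<open>Each variable enters with constant \<open>3 + 3 / 2\<close>, rounded up to
    5.\<close>
  also have "\<dots> \<le> 5 * (norm (k - k') + norm (p - p'))" by (simp add: field_simps)
  finally show ?thesis .
qed

lemma abs_inverse_diff_le:
  fixes a b d :: real
  assumes "d > 0" "a \<ge> d" "b \<ge> d"
  shows "\<bar>1 / a - 1 / b\<bar> \<le> \<bar>a - b\<bar> / d\<^sup>2"
proof -
  have "\<bar>1 / a - 1 / b\<bar> = \<bar>a - b\<bar> / (a * b)"
    using assms by (simp add: field_simps abs_minus_commute flip: abs_divide) (simp add: abs_divide abs_mult abs_minus_commute)
  also have "\<dots> \<le> \<bar>a - b\<bar> / d\<^sup>2"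
    unfolding power2_eq_square using assms by (intro divide_left_mono mult_mono mult_pos_pos) auto
  finally show ?thesis .
qed

lemma G_Lipschitz:
  assumes "z < 0"
  shows "\<bar>G z k p - G z k' p'\<bar> \<le> 5 / z\<^sup>2 * (norm (k - k') + norm (p - p'))"
proof -
  have "\<bar>G z k p - G z k' p'\<bar> \<le> \<bar>(w2 k p - z) - (w2 k' p' - z)\<bar> / (- z)\<^sup>2"
    unfolding G_def using assms w2_nonneg by (intro abs_inverse_diff_le) auto
  also have "\<dots> \<le> 5 * (norm (k - k') + norm (p - p')) / (- z)\<^sup>2"
    using w2_Lipschitz[of k p k' p'] by (intro divide_right_mono) auto
  finally show ?thesis by simp
qed

lemma I_int_Lipschitz:
  assumes "z < 0"
  shows "\<bar>I_int z k - I_int z k'\<bar> \<le> torus_vol * (5 / z\<^sup>2 * norm (k - k'))"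
proof -
  have "I_int z k - I_int z k' \<le> torus_vol * (5 / z\<^sup>2 * norm (k - k'))" for k k'
  proof -
    have "I_int z k - I_int z k' = (\<integral>t. G z k t - G z k' t \<partial>torus_measure)"
      by (simp add: I_int_def G_integrable assms)
    also have "\<dots> \<le> torus_vol * (5 / z\<^sup>2 * norm (k - k'))"
    proof (rule integral_torus_le)
      show "G z k t - G z k' t \<le> 5 / z\<^sup>2 * norm (k - k')" for t
        using G_Lipschitz[OF assms, of k t k' t] by simp
    qed (simp add: G_integrable assms)
    finally show ?thesis .
  qed
  from this[of k k'] this[of k' k] show ?thesis by (simp add: norm_minus_commute abs_le_iff)
qed

lemma I_int_Lipschitz_energy:
  assumes "d > 0" "z \<le> - d" "z' \<le> - d"
  shows "\<bar>I_int z k - I_int z' k\<bar> \<le> torus_vol / d\<^sup>2 * \<bar>z - z'\<bar>"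
proof -
  have "I_int z k - I_int z' k \<le> torus_vol * (\<bar>z - z'\<bar> / d\<^sup>2)" if "z \<le> - d" "z' \<le> - d" for z z'
  proof -
    have "I_int z k - I_int z' k = (\<integral>t. G z k t - G z' k t \<partial>torus_measure)"
      using that assms(1) by (simp add: I_int_def G_integrable)
    also have "\<dots> \<le> torus_vol * (\<bar>z - z'\<bar> / d\<^sup>2)"
    proof (rule integral_torus_le)
      show "G z k t - G z' k t \<le> \<bar>z - z'\<bar> / d\<^sup>2" for t
        using abs_inverse_diff_le[of d "w2 k t - z" "w2 k t - z'"] that assms(1) w2_nonneg[of k t]
        unfolding G_def by (simp add: abs_minus_commute)
    qed (use that assms(1) in \<open>simp add: G_integrable\<close>)
    finally show ?thesis .
  qed
  from this[OF assms(2,3)] this[OF assms(3,2)] show ?thesis by (simp add: abs_le_iff abs_minus_commute)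
qed

lemma I_int_mono_energy:
  assumes "z \<le> z'" "z' < 0" shows "I_int z k \<le> I_int z' k"
  unfolding I_int_def
proof (rule integral_mono)
  show "G z k t \<le> G z' k t" for t
    unfolding G_def using assms w2_nonneg[of k t] by (intro divide_left_mono mult_pos_pos) auto
qed (use assms in \<open>auto intro: G_integrable\<close>)

subsection \<open>Comparison with the origin\<close>

definition refl_coord :: "3 \<Rightarrow> real \<Rightarrow> real^3 \<Rightarrow> real^3" where
  "refl_coord i a t = (\<chi> j. if j = i then - a - t $ j else t $ j)"

lemma distr_refl_coord: "distr lborel borel (refl_coord i a) = lborel"
proof -
  \<comment> \<open>Coefficients of the reflection as an affine map in the standard basis; the
    absolute values multiply to 1, so Lebesgue measure is preserved.\<close>
  define c where "c j = (if j = axis i (1::real) then - 1 else 1 :: real)" for j :: "real^3"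
  have "refl_coord i a x = (- a) *\<^sub>R axis i 1 + (\<Sum>j\<in>Basis. (c j * (x \<bullet> j)) *\<^sub>R j)" for x
  proof -
    have "(\<Sum>j\<in>Basis. (c j * (x \<bullet> j)) *\<^sub>R j)
        = (\<Sum>j\<in>Basis. (x \<bullet> j) *\<^sub>R j + (if j = axis i 1 then (- 2 * (x \<bullet> j)) *\<^sub>R j else 0))"
      by (intro sum.cong) (auto simp: c_def algebra_simps simp flip: scaleR_add_left)
    also have "\<dots> = x + (- 2 * (x $ i)) *\<^sub>R axis i 1"
      by (simp add: sum.distrib euclidean_representation axis_in_Basis_iff inner_axis)
    finally show ?thesis by (auto simp: refl_coord_def vec_eq_iff axis_def)
  qed
  then have eq: "refl_coord i a = (\<lambda>x. (- a) *\<^sub>R axis i 1 + (\<Sum>j\<in>Basis. (c j * (x \<bullet> j)) *\<^sub>R j))" by auto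
  have "(lborel :: (real^3) measure)
      = density (distr lborel borel (refl_coord i a)) (\<lambda>_. (\<Prod>j\<in>Basis. \<bar>c j\<bar>))"
    unfolding eq by (rule lborel_affine_euclidean) (auto simp: c_def)
  also have "(\<Prod>j\<in>Basis. \<bar>c j\<bar>) = 1" by (rule prod.neutral) (simp add: c_def)
  finally show ?thesis by (simp add: density_1)
qed

lemma refl_coord_measurable: "refl_coord i a \<in> borel_measurable borel"
proof (rule borel_measurable_continuous_onI)
  have "continuous_on UNIV (\<lambda>t. \<chi> j. if j = i then - a - t $ j else t $ j)"
  proof (rule continuous_on_vec_lambda)
    show "continuous_on UNIV (\<lambda>t. if j = i then - a - t $ j else t $ j)" for j :: 3
      by (cases "j = i") (simp_all add: continuous_intros)
  qed
  then show "continuous_on UNIV (refl_coord i a)" by (simp add: refl_coord_def[abs_def])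
qed

lemma integral_refl_coord:
  fixes f :: "real^3 \<Rightarrow> real"
  assumes [measurable]: "f \<in> borel_measurable borel"
  shows "(\<integral>t. f (refl_coord i a t) \<partial>lborel) = (\<integral>t. f t \<partial>lborel)"
  using integral_distr[of "refl_coord i a" lborel borel f] refl_coord_measurable[of i a]
  by (simp add: distr_refl_coord)

lemma integrable_refl_coord:
  fixes f :: "real^3 \<Rightarrow> real"
  assumes "integrable lborel f"
  shows "integrable lborel (\<lambda>t. f (refl_coord i a t))"
  using integrable_distr[of "refl_coord i a" lborel borel f] refl_coord_measurable[of i a] assms
  by (simp add: distr_refl_coord)

lemma one_minus_cos_mono: "\<bar>x\<bar> \<le> \<bar>y\<bar> \<Longrightarrow> \<bar>y\<bar> \<le> pi \<Longrightarrow> 1 - cos x \<le> 1 - cos y" for x y :: real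
  using cos_monotone_0_pi_le[of "\<bar>x\<bar>" "\<bar>y\<bar>"] by simp

text \<open>On both sides the two denominators have the same sum \<open>p + q + v + v'\<close>, so
  the sum of reciprocals is larger where their product is smaller; the sign condition compares the
  products.\<close>

lemma inverse_supermodular:
  fixes p q v v' :: real
  assumes "p > 0" "q > 0" "v \<ge> 0" "v' \<ge> 0" "(q - p) * (v' - v) \<ge> 0"
  shows "1 / (p + v') + 1 / (q + v) \<le> 1 / (p + v) + 1 / (q + v')"
proof -
  have le: "(p + v) * (q + v') \<le> (p + v') * (q + v)" using assms(5) by (simp add: algebra_simps)
  have "1 / (p + v') + 1 / (q + v) = (p + q + v + v') / ((p + v') * (q + v))"
    using assms by (simp add: field_simps)
  also have "\<dots> \<le> (p + q + v + v') / ((p + v) * (q + v'))"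
    using assms le by (intro divide_left_mono mult_pos_pos) auto
  also have "\<dots> = 1 / (p + v) + 1 / (q + v')" using assms by (simp add: field_simps)
  finally show ?thesis .
qed

lemma integral_torus_indicator:
  fixes f :: "real^3 \<Rightarrow> real"
  shows "(\<integral>t. f t \<partial>torus_measure) = (\<integral>t. indicator torus t * f t \<partial>lborel)"
  unfolding torus_measure_def using torus_borel by (subst integral_restrict_space) auto

lemma integrable_torus_indicator:
  fixes f :: "real^3 \<Rightarrow> real"
  shows "integrable torus_measure f \<longleftrightarrow> integrable lborel (\<lambda>t. indicator torus t * f t)"
  unfolding torus_measure_def using torus_borel by (subst integrable_restrict_space) auto

text \<open>A two-point rearrangement: the reflection exchanging \<open>t\<^sub>i\<close> and \<open>- k\<^sub>i - t\<^sub>i\<close> swaps the values of the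
  two angle-dependent terms, and \<open>1 / (c + u + v)\<close> is supermodular in \<open>(u, v)\<close>. Both \<open>1 - cos t\<^sub>i\<close>,
  extended by \<open>\<infinity>\<close> outside the torus, and \<open>1 - cos (t\<^sub>i / 2)\<close> increase with \<open>\<bar>t\<^sub>i\<bar>\<close>.\<close>

lemma I_int_le_zero_coord:
  assumes z: "z < 0" and k: "k \<in> torus"
  shows "I_int z k \<le> I_int z (\<chi> j. if j = i then 0 else k $ j)"
proof -
  define k' :: "real^3" where "k' = (\<chi> j. if j = i then 0 else k $ j)"
  define a where "a = k $ i"
  \<comment> \<open>The share of the other coordinates, which the reflection of coordinate
    \<open>i\<close> leaves unchanged; \<open>F a\<close> and \<open>F 0\<close> below then differ
    only in the half-angle term.\<close>
  define R where "R t = (\<Sum>j\<in>UNIV - {i}. (1 - cos (k $ j)) + (1 - cos ((k $ j + t $ j) / 2)) + (1 - cos (t $ j))) - z"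
    for t :: "real^3"
  have R_ge: "- z \<le> R t" for t
  proof -
    have "0 \<le> (\<Sum>j\<in>UNIV - {i}. (1 - cos (k $ j)) + (1 - cos ((k $ j + t $ j) / 2)) + (1 - cos (t $ j)))"
      by (intro sum_nonneg add_nonneg_nonneg) auto
    then show ?thesis by (simp add: R_def)
  qed
  then have R: "R t > 0" for t using z less_le_trans[of 0 "- z" "R t"] by simp
  define v where "v b = 1 - cos (b / 2)" for b :: real
  have v: "v b \<ge> 0" for b by (simp add: v_def)
  define F where "F b t = indicator torus t * (1 / (R t + (1 - cos (t $ i)) + v (b + t $ i)))" for b t
  have w2_split: "w2 q t = (\<Sum>j\<in>UNIV. (1 - cos (q $ j)) + (1 - cos ((q $ j + t $ j) / 2)) + (1 - cos (t $ j)))" for q t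
    by (simp add: w2_def eps_def flip: sum.distrib)
  have w2': "w2 k' t - z = R t + (1 - cos (t $ i)) + v (0 + t $ i)" for t
    unfolding w2_split R_def v_def
    by (subst sum.remove[of UNIV i]) (auto simp: k'_def intro!: sum.cong)
  \<comment> \<open>Here the nonnegative term \<open>1 - cos (k $ i)\<close> is dropped; for
    \<open>k'\<close> it is zero, which is why the preceding fact is an equality.\<close>
  have w2: "w2 k t - z \<ge> R t + (1 - cos (t $ i)) + v (a + t $ i)" for t
    unfolding w2_split R_def v_def by (subst sum.remove[of UNIV i]) (auto simp: a_def)
  have F_meas: "F b \<in> borel_measurable borel" for b
    unfolding F_def R_def v_def
    by (intro borel_measurable_times borel_measurable_indicator torus_borel borel_measurable_divide
        borel_measurable_const borel_measurable_continuous_onI continuous_intros) auto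
  have F_int: "integrable lborel (F b)" for b
  proof -
    have "integrable torus_measure (\<lambda>t. 1 / (R t + (1 - cos (t $ i)) + v (b + t $ i)))"
    proof (rule torus.integrable_const_bound[where B = "1 / (- z)"])
      have "- z \<le> R t + (1 - cos (t $ i)) + v (b + t $ i)" for t
        using R_ge[of t] v[of "b + t $ i"] cos_le_one[of "t $ i"] by linarith
      then show "AE t in torus_measure. norm (1 / (R t + (1 - cos (t $ i)) + v (b + t $ i))) \<le> 1 / (- z)"
        using z by (intro AE_I2) (smt (verit) norm_divide norm_one real_norm_def divide_left_mono mult_pos_pos)
      have "(\<lambda>t. 1 / (R t + (1 - cos (t $ i)) + v (b + t $ i))) \<in> borel_measurable borel"
        unfolding R_def v_def
        by (intro borel_measurable_divide borel_measurable_const borel_measurable_continuous_onI continuous_intros) auto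
      then show "(\<lambda>t. 1 / (R t + (1 - cos (t $ i)) + v (b + t $ i))) \<in> borel_measurable torus_measure"
        by (rule borel_measurable_torus)
    qed
    then show ?thesis unfolding F_def integrable_torus_indicator .
  qed
  define \<sigma> where "\<sigma> = refl_coord i a"
  have \<sigma>: "\<sigma> t $ i = - a - t $ i" "R (\<sigma> t) = R t" for t
    unfolding R_def \<sigma>_def by (auto simp: refl_coord_def intro!: sum.cong)
  have a: "\<bar>a\<bar> \<le> pi" using k by (auto simp: torus_def a_def abs_le_iff less_imp_le minus_le_iff)
  have point: "F a t + F a (\<sigma> t) \<le> F 0 t + F 0 (\<sigma> t)" for t
  proof -
    define b where "b = t $ i"
    have s1: "a + \<sigma> t $ i = - b" "0 + \<sigma> t $ i = - (a + b)" "\<sigma> t $ i = - (a + b)"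
      unfolding \<sigma> b_def by simp_all
    have v_minus: "v (- x) = v x" for x by (simp add: v_def)
    have v1: "v (a + \<sigma> t $ i) = v b" "v (0 + \<sigma> t $ i) = v (a + b)"
      unfolding s1(1,2) v_minus by (rule refl)+
    have c1: "cos (\<sigma> t $ i) = cos (a + b)" unfolding s1(3) by (rule cos_minus)
    have F1: "F a t = indicator torus t * (1 / (R t + (1 - cos b) + v (a + b)))"
      "F 0 t = indicator torus t * (1 / (R t + (1 - cos b) + v b))"
      "F a (\<sigma> t) = indicator torus (\<sigma> t) * (1 / (R t + (1 - cos (a + b)) + v b))"
      "F 0 (\<sigma> t) = indicator torus (\<sigma> t) * (1 / (R t + (1 - cos (a + b)) + v (a + b)))"
      unfolding F_def v1 c1 \<sigma>(2) by (simp_all add: b_def)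
    \<comment> \<open>The range \<open>2 * pi\<close> is available because \<open>v\<close> halves
      its argument, and it is required because \<open>\<bar>a + b\<bar>\<close> can exceed
      \<open>pi\<close> when the reflected point lies outside the torus.\<close>
    have v_mono: "v x \<le> v y" if "\<bar>x\<bar> \<le> \<bar>y\<bar>" "\<bar>y\<bar> \<le> 2 * pi" for x y
      unfolding v_def using that by (intro one_minus_cos_mono) auto
    have tor: "\<bar>b\<bar> \<le> pi" if "t \<in> torus"
      using that by (auto simp: torus_def b_def abs_le_iff less_imp_le minus_le_iff)
    have tor': "\<bar>a + b\<bar> \<le> pi" if "\<sigma> t \<in> torus"
    proof -
      have "- pi < \<sigma> t $ i" "\<sigma> t $ i \<le> pi" using that by (auto simp: torus_def)
      then show ?thesis by (simp add: \<sigma> b_def)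
    qed
    have inv_mono: "1 / (R t + (1 - cos x) + v y) \<le> 1 / (R t + (1 - cos x) + v y')" if "v y' \<le> v y" for x y y'
    proof -
      have "0 < R t + (1 - cos x) + v y" "0 < R t + (1 - cos x) + v y'"
        using R[of t] v[of y] v[of y'] cos_le_one[of x] by linarith+
      with that show ?thesis by (intro divide_left_mono mult_pos_pos) auto
    qed
    have other: "j \<noteq> i \<Longrightarrow> \<sigma> t $ j = t $ j" for j by (simp add: \<sigma>_def refl_coord_def)
    consider "t \<in> torus" "\<sigma> t \<in> torus" | "t \<in> torus" "\<sigma> t \<notin> torus"
      | "t \<notin> torus" "\<sigma> t \<in> torus" | "t \<notin> torus" "\<sigma> t \<notin> torus" by blast
    then show ?thesis
    proof cases
      case 1
      have "((R t + (1 - cos (a + b))) - (R t + (1 - cos b))) * (v (a + b) - v b) \<ge> 0"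
      proof (cases "\<bar>b\<bar> \<le> \<bar>a + b\<bar>")
        case True
        then show ?thesis
          using one_minus_cos_mono[of b "a + b"] v_mono[of b "a + b"] tor'[OF 1(2)] pi_gt_zero
          by (intro mult_nonneg_nonneg) auto
      next
        case False
        then show ?thesis
          using one_minus_cos_mono[of "a + b" b] v_mono[of "a + b" b] tor[OF 1(1)] pi_gt_zero
          by (intro mult_nonpos_nonpos) auto
      qed
      then show ?thesis
        unfolding F1 using 1 inverse_supermodular[of "R t + (1 - cos b)" "R t + (1 - cos (a + b))" "v b" "v (a + b)"]
          R[of t] v by (simp add: add_pos_nonneg)
    next
      \<comment> \<open>Only coordinate \<open>i\<close> moves, so it is the one leaving the cube.
        Then \<open>\<bar>b\<bar> \<le> pi \<le> \<bar>a + b\<bar>\<close>, with equality possible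
        on the face \<open>- pi\<close> missing from the half-open cube.\<close>
      case 2
      then obtain j where j: "\<not> (- pi < \<sigma> t $ j \<and> \<sigma> t $ j \<le> pi)" by (auto simp: torus_def)
      have "j = i"
      proof (rule ccontr)
        assume "j \<noteq> i"
        then have "\<sigma> t $ j = t $ j" by (rule other)
        with j 2(1) show False by (simp add: torus_def)
      qed
      then have "pi \<le> \<bar>a + b\<bar>" using j by (auto simp: \<sigma> b_def)
      then have "v b \<le> v (a + b)" using tor[OF 2(1)] a by (intro v_mono) auto
      with 2 show ?thesis unfolding F1 using inv_mono[of b "a + b" b] by simp
    next
      case 3
      then obtain j where j: "\<not> (- pi < t $ j \<and> t $ j \<le> pi)" by (auto simp: torus_def)
      have "j = i"
      proof (rule ccontr)
        assume "j \<noteq> i"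
        then have "\<sigma> t $ j = t $ j" by (rule other)
        with j 3(2) show False unfolding torus_def by (metis (mono_tags, lifting) mem_Collect_eq)
      qed
      then have "pi \<le> \<bar>b\<bar>" using j by (auto simp: b_def)
      then have "v (a + b) \<le> v b" using tor'[OF 3(2)] a by (intro v_mono) auto
      with 3 show ?thesis unfolding F1 using inv_mono[of b "a + b" "a + b"] inv_mono[where y' = "a + b" and y = b and x = "a + b"] by simp
    next
      case 4
      then show ?thesis unfolding F1 by simp
    qed
  qed
  have "2 * (\<integral>t. F a t \<partial>lborel) = (\<integral>t. F a t + F a (\<sigma> t) \<partial>lborel)"
    unfolding \<sigma>_def using F_int[of a] integrable_refl_coord[OF F_int[of a]] integral_refl_coord[OF F_meas[of a]]
    by simp
  also have "\<dots> \<le> (\<integral>t. F 0 t + F 0 (\<sigma> t) \<partial>lborel)"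
    unfolding \<sigma>_def by (intro integral_mono point[unfolded \<sigma>_def] Bochner_Integration.integrable_add F_int integrable_refl_coord)
  also have "\<dots> = 2 * (\<integral>t. F 0 t \<partial>lborel)"
    unfolding \<sigma>_def using F_int[of 0] integrable_refl_coord[OF F_int[of 0]] integral_refl_coord[OF F_meas[of 0]]
    by simp
  finally have le: "(\<integral>t. F a t \<partial>lborel) \<le> (\<integral>t. F 0 t \<partial>lborel)" by simp
  have "I_int z k \<le> (\<integral>t. F a t \<partial>lborel)"
    unfolding I_int_def integral_torus_indicator
  proof (rule integral_mono)
    show "integrable lborel (\<lambda>t. indicator torus t * G z k t)"
      using G_integrable[OF z] by (simp add: integrable_torus_indicator)
    show "indicator torus t * G z k t \<le> F a t" for t
    proof -
      have "0 < R t + (1 - cos (t $ i)) + v (a + t $ i)"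
        using R[of t] v[of "a + t $ i"] cos_le_one[of "t $ i"] by linarith
      with w2[of t] show ?thesis
        unfolding F_def G_def by (intro mult_left_mono divide_left_mono mult_pos_pos) auto
    qed
  qed (rule F_int)
  also note le
  also have "(\<integral>t. F 0 t \<partial>lborel) = I_int z k'"
    unfolding I_int_def integral_torus_indicator F_def G_def w2' ..
  finally show ?thesis by (simp add: k'_def)
qed

lemma I_int_le_origin:
  assumes z: "z < 0" and k: "k \<in> torus"
  shows "I_int z k \<le> I_int z 0"
proof -
  have "I_int z k \<le> I_int z (\<chi> j. if j \<in> S then 0 else k $ j)" if "finite S" for S
    using that
  proof (induction S rule: finite_induct)
    case empty
    then show ?case by simp
  next
    case (insert i S)
    define q :: "real^3" where "q = (\<chi> j. if j \<in> S then 0 else k $ j)"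
    have "q \<in> torus" using k by (auto simp: torus_def q_def)
    from I_int_le_zero_coord[OF z this, of i]
    have "I_int z q \<le> I_int z (\<chi> j. if j = i then 0 else q $ j)" .
    also have "(\<chi> j. if j = i then 0 else q $ j) = (\<chi> j. if j \<in> insert i S then 0 else k $ j)"
      by (auto simp: q_def vec_eq_iff)
    finally show ?case using insert.IH by (simp add: q_def)
  qed
  from this[of UNIV] show ?thesis by (simp add: zero_vec_def)
qed

subsection \<open>The singular integral at the bottom of the continuum\<close>

text \<open>Doubling an angle multiplies \<open>1 - cos\<close> by at most 4, since
  \<open>1 - cos (2 * y) = 2 * (1 - cos y) * (1 + cos y)\<close>. The induction starts at angle
  \<open>pi / 2\<close>, where the value is 1.\<close>

lemma one_minus_cos_dyadic: "(1/4) ^ n \<le> 1 - cos (pi / 2 ^ n / 2)"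
proof (induction n)
  case 0
  then show ?case by simp
next
  case (Suc n)
  define y where "y = pi / 2 ^ Suc n / 2"
  have "1 - cos (2 * y) = 2 * ((1 - cos y) * (1 + cos y))"
    unfolding cos_double_cos by (simp add: power2_eq_square algebra_simps)
  also have "\<dots> \<le> 2 * ((1 - cos y) * 2)" by (intro mult_left_mono) auto
  finally have "1 - cos (2 * y) \<le> 4 * (1 - cos y)" by simp
  moreover have "2 * y = pi / 2 ^ n / 2" by (simp add: y_def)
  ultimately have "(1/4) ^ n \<le> 4 * (1 - cos y)" using Suc by simp
  then show ?case unfolding y_def[symmetric] by simp
qed

text \<open>The half-angle term alone suffices: \<open>t $ i / 2\<close> stays within
  \<open>pi / 2\<close> of the origin, where \<open>1 - cos\<close> increases with the absolute
  value.\<close>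

lemma w2_zero_ge_dyadic:
  assumes "t \<in> torus" "pi / 2 ^ n \<le> \<bar>t $ i\<bar>"
  shows "(1/4) ^ n \<le> w2 0 t"
proof -
  have "\<bar>t $ i\<bar> \<le> pi" using assms(1) by (auto simp: torus_def abs_le_iff less_imp_le minus_le_iff)
  then have "1 - cos (pi / 2 ^ n / 2) \<le> 1 - cos (t $ i / 2)"
    using assms(2) pi_gt_zero by (intro one_minus_cos_mono) auto
  also have "\<dots> \<le> eps ((1/2) *\<^sub>R t)"
    using member_le_sum[of i UNIV "\<lambda>j. 1 - cos (((1/2) *\<^sub>R t) $ j)"] by (simp add: eps_def)
  also have "\<dots> \<le> w2 0 t" by (simp add: w2_def eps_nonneg)
  finally show ?thesis using one_minus_cos_dyadic[of n] by linarith
qed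

lemma torus_dyadic:
  assumes "t \<in> torus" "t \<noteq> 0"
  obtains n i where "\<And>j. \<bar>t $ j\<bar> \<le> pi / 2 ^ n" "pi / 2 ^ Suc n \<le> \<bar>t $ i\<bar>"
proof -
  obtain i where i: "t $ i \<noteq> 0" using assms(2) by (auto simp: vec_eq_iff)
  have "\<exists>n. (1/2) ^ n < \<bar>t $ i\<bar> / pi" using i by (intro real_arch_pow_inv) auto
  then obtain n0 where "(1/2) ^ n0 < \<bar>t $ i\<bar> / pi" ..
  then have ex: "\<exists>i. pi / 2 ^ n0 < \<bar>t $ i\<bar>" by (intro exI[of _ i]) (simp add: field_simps)
  \<comment> \<open>The least such \<open>m\<close> is positive because all coordinates are bounded
    by \<open>pi\<close>; its predecessor is the index of the dyadic shell containing
    \<open>t\<close>.\<close>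
  define m where "m = (LEAST m. \<exists>i. pi / 2 ^ m < \<bar>t $ i\<bar>)"
  obtain i where i: "pi / 2 ^ m < \<bar>t $ i\<bar>" using LeastI[of "\<lambda>m. \<exists>i. pi / 2 ^ m < \<bar>t $ i\<bar>", OF ex] unfolding m_def by blast
  have "\<bar>t $ j\<bar> \<le> pi" for j using assms(1) by (auto simp: torus_def abs_le_iff less_imp_le minus_le_iff)
  then have "m \<noteq> 0" using i by (metis div_by_1 not_le power_0)
  then obtain n where n: "m = Suc n" by (cases m) auto
  have "\<not> (\<exists>i. pi / 2 ^ n < \<bar>t $ i\<bar>)" using not_less_Least[of n "\<lambda>m. \<exists>i. pi / 2 ^ m < \<bar>t $ i\<bar>"] n unfolding m_def by simp
  then show ?thesis using that[of n i] i n by (auto simp: not_less less_imp_le)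
qed

lemma w2_zero_pos: "t \<in> torus \<Longrightarrow> t \<noteq> 0 \<Longrightarrow> 0 < w2 0 t"
  using torus_dyadic[of t] w2_zero_ge_dyadic[of t]
  by (meson less_le_trans zero_less_divide_1_iff zero_less_numeral zero_less_power)

definition cube :: "real^3 \<Rightarrow> real \<Rightarrow> (real^3) set" where
  "cube k r = cbox (k - (\<chi> i. r)) (k + (\<chi> i. r))"

lemma mem_cube: "t \<in> cube k r \<longleftrightarrow> (\<forall>i. \<bar>t $ i - k $ i\<bar> \<le> r)"
  by (auto simp: cube_def mem_box_cart abs_le_iff algebra_simps)

lemma emeasure_cube: "0 \<le> r \<Longrightarrow> emeasure lborel (cube k r) = ennreal ((2 * r) ^ 3)"
proof -
  assume r: "0 \<le> r"
  have "cube k r \<noteq> {}" using mem_cube[of k k r] r by auto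
  then have "measure lborel (cube k r) = (\<Prod>i\<in>(UNIV::3 set). 2 * r)"
    unfolding cube_def by (subst content_cbox_cart) (auto intro!: prod.cong)
  also have "\<dots> = (2 * r) ^ 3" by simp
  finally show ?thesis
    using emeasure_lborel_cbox_finite[of "k - (\<chi> i. r)" "k + (\<chi> i. r)"]
    by (subst emeasure_eq_ennreal_measure) (auto simp: cube_def top_unique)
qed

text \<open>On the dyadic shell number \<open>n\<close> the integrand is at most
  \<open>4 ^ Suc n\<close>, while the cube \<open>Q n\<close> enclosing the shell has volume
  \<open>(2 * pi) ^ 3 / 8 ^ n\<close>. In dimension 3 the volume wins and the shell contributions
  form a geometric series.\<close>

lemma integrable_inverse_w2_zero: "integrable torus_measure (\<lambda>t. 1 / w2 0 t)"
proof (rule integrableI_bounded)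
  show "(\<lambda>t. 1 / w2 0 t) \<in> borel_measurable torus_measure"
    using w2_fiber_measurable[of 0] by measurable
  define Q where "Q n = cube 0 (pi / 2 ^ n)" for n :: nat
  have [measurable]: "Q n \<in> sets borel" for n by (simp add: Q_def cube_def)
  have "(\<integral>\<^sup>+t. ennreal (norm (1 / w2 0 t)) \<partial>torus_measure)
      = (\<integral>\<^sup>+t. ennreal (norm (1 / w2 0 t)) * indicator torus t \<partial>lborel)"
    unfolding torus_measure_def using torus_borel by (subst nn_integral_restrict_space) auto
  also have "\<dots> \<le> (\<integral>\<^sup>+t. (\<Sum>n. ennreal (4 ^ Suc n) * indicator (Q n) t) \<partial>lborel)"
  proof (rule nn_integral_mono)
    fix t :: "real^3"
    show "ennreal (norm (1 / w2 0 t)) * indicator torus t \<le> (\<Sum>n. ennreal (4 ^ Suc n) * indicator (Q n) t)"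
    proof (cases "t \<in> torus \<and> t \<noteq> 0")
      case True
      then obtain n i where n: "\<And>j. \<bar>t $ j\<bar> \<le> pi / 2 ^ n" "pi / 2 ^ Suc n \<le> \<bar>t $ i\<bar>"
        using torus_dyadic by blast
      have "(1/4) ^ Suc n \<le> w2 0 t" using w2_zero_ge_dyadic[OF _ n(2)] True by blast
      then have "1 / w2 0 t \<le> 1 / (1/4) ^ Suc n"
        using w2_zero_pos True by (intro divide_left_mono mult_pos_pos) auto
      then have "norm (1 / w2 0 t) \<le> 4 ^ Suc n" using w2_nonneg[of 0 t] by (simp add: power_divide)
      then have "ennreal (norm (1 / w2 0 t)) * indicator torus t \<le> ennreal (4 ^ Suc n) * indicator (Q n) t"
        using n(1) True by (auto simp: Q_def mem_cube intro!: ennreal_leI)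
      also have "\<dots> \<le> (\<Sum>n. ennreal (4 ^ Suc n) * indicator (Q n) t)"
      proof -
        define f where "f n = ennreal (4 ^ Suc n) * indicator (Q n) t" for n
        have "(\<Sum>n\<in>{n}. f n) \<le> suminf f" by (rule sum_le_suminf) auto
        then have "f n \<le> suminf f" by simp
        then show ?thesis unfolding f_def .
      qed
      finally show ?thesis .
    next
      case False
      \<comment> \<open>At the origin the integrand is \<open>1 / 0 = 0\<close>, so the pointwise
        bound extends to the singularity.\<close>
      moreover have "w2 0 0 = 0" by (simp add: w2_def eps_def)
      ultimately show ?thesis by auto
    qed
  qed
  also have "\<dots> = (\<Sum>n. \<integral>\<^sup>+t. ennreal (4 ^ Suc n) * indicator (Q n) t \<partial>lborel)"
    by (rule nn_integral_suminf) measurable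
  also have "\<dots> = (\<Sum>n. ennreal (4 * (2 * pi) ^ 3 * (1/2) ^ n))"
  proof (rule suminf_cong)
    fix n
    have "(\<integral>\<^sup>+t. ennreal (4 ^ Suc n) * indicator (Q n) t \<partial>lborel) = ennreal (4 ^ Suc n) * ennreal ((2 * (pi / 2 ^ n)) ^ 3)"
      by (subst nn_integral_cmult_indicator) (simp_all add: Q_def emeasure_cube, simp add: cube_def)
    also have "\<dots> = ennreal (4 ^ Suc n * (2 * (pi / 2 ^ n)) ^ 3)" by (simp add: ennreal_mult)
    also have "4 ^ Suc n * (2 * (pi / 2 ^ n)) ^ 3 = 4 * (2 * pi) ^ 3 * (1/2) ^ n"
    proof -
      have "(4::real) ^ n = 2 ^ n * 2 ^ n" by (simp flip: power_mult_distrib)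
      then show ?thesis by (simp add: power3_eq_cube field_simps)
    qed
    finally show "(\<integral>\<^sup>+t. ennreal (4 ^ Suc n) * indicator (Q n) t \<partial>lborel) = ennreal (4 * (2 * pi) ^ 3 * (1/2) ^ n)" .
  qed
  also have "\<dots> = ennreal (\<Sum>n. 4 * (2 * pi) ^ 3 * (1/2) ^ n)"
    by (rule suminf_ennreal2) (auto intro!: summable_mult summable_geometric)
  also have "\<dots> < \<infinity>" by simp
  finally show "(\<integral>\<^sup>+t. ennreal (norm (1 / w2 0 t)) \<partial>torus_measure) < \<infinity>" .
qed

lemma AE_torus_nonzero: "AE t in torus_measure. t \<in> torus \<and> t \<noteq> 0"
proof -
  have "AE t in lborel. (t::real^3) \<noteq> 0"
    by (rule AE_lborel_singleton)
  then have "AE t in torus_measure. t \<noteq> 0"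
    unfolding torus_measure_def using torus_borel by (subst AE_restrict_space_iff) (auto elim: eventually_mono)
  moreover have "AE t in torus_measure. t \<in> torus"
    using AE_space[of torus_measure] by (simp add: torus_measure_def space_restrict_space)
  ultimately show ?thesis by eventually_elim simp
qed

lemma torus_vol_pos: "0 < torus_vol"
proof -
  have "emeasure lborel (cube 0 1) \<le> emeasure lborel torus"
  proof (rule emeasure_mono)
    show "cube 0 1 \<subseteq> torus"
    proof
      fix t assume "t \<in> cube 0 1"
      then have "\<bar>t $ i\<bar> \<le> 1" for i by (simp add: mem_cube)
      then show "t \<in> torus" using pi_gt3 unfolding torus_def by (simp add: abs_le_iff) (smt (verit))
    qed
  qed (simp add: torus_borel)
  then have "0 < emeasure torus_measure (space torus_measure)"
    using torus_borel emeasure_cube[of 1 0]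
    by (simp add: torus_measure_def emeasure_restrict_space space_restrict_space) (metis ennreal_less_zero_iff less_le_trans zero_less_numeral ennreal_numeral)
  then show ?thesis by (simp add: torus_vol_def torus.emeasure_eq_measure)
qed

lemma I00_pos: "0 < I00"
proof -
  have "torus_vol * (1 / 18) = (\<integral>t. 1 / 18 \<partial>torus_measure)" by (simp add: torus_vol_def)
  also have "\<dots> \<le> I00"
    unfolding I00_def
  proof (rule integral_mono_AE)
    show "AE t in torus_measure. 1 / 18 \<le> 1 / w2 0 t"
      using AE_torus_nonzero
    proof eventually_elim
      case (elim t)
      then show ?case using w2_zero_pos[of t] w2_bound[of 0 t] by (simp add: field_simps)
    qed
  qed (use integrable_inverse_w2_zero in auto)
  finally show ?thesis using torus_vol_pos by simp
qed

lemma I_int_zero_le_I00: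
  assumes "z < 0" shows "I_int z 0 \<le> I00"
  unfolding I_int_def I00_def
proof (rule integral_mono_AE)
  show "AE t in torus_measure. G z 0 t \<le> 1 / w2 0 t"
    using AE_torus_nonzero
  proof eventually_elim
    case (elim t)
    then show ?case
      unfolding G_def using w2_zero_pos[of t] assms by (intro divide_left_mono mult_pos_pos) auto
  qed
qed (use assms integrable_inverse_w2_zero G_integrable in auto)

lemma I_int_tendsto_I00: "(\<lambda>n. I_int (- inverse (real (Suc n))) 0) \<longlonglongrightarrow> I00"
  unfolding I_int_def I00_def
proof (rule integral_dominated_convergence[where w = "\<lambda>t. 1 / w2 0 t"])
  show "AE t in torus_measure. (\<lambda>n. G (- inverse (real (Suc n))) 0 t) \<longlonglongrightarrow> 1 / w2 0 t"
    using AE_torus_nonzero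
  proof eventually_elim
    case (elim t)
    have "(\<lambda>n. 1 / (w2 0 t - (- inverse (real (Suc n))))) \<longlonglongrightarrow> 1 / (w2 0 t - (- 0))"
      using w2_zero_pos[of t] elim
      by (intro tendsto_divide tendsto_diff tendsto_const tendsto_minus LIMSEQ_inverse_real_of_nat) auto
    then show ?case by (simp add: G_def)
  qed
  show "AE t in torus_measure. norm (G (- inverse (real (Suc n))) 0 t) \<le> 1 / w2 0 t" for n
    using AE_torus_nonzero
  proof eventually_elim
    case (elim t)
    then have "G (- inverse (real (Suc n))) 0 t \<le> 1 / w2 0 t"
      unfolding G_def using w2_zero_pos[of t] by (intro divide_left_mono mult_pos_pos add_pos_pos) (auto simp: add_pos_pos)
    moreover have "0 < G (- inverse (real (Suc n))) 0 t" by (rule G_bounds) simp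
    ultimately show ?case by simp
  qed
  show "(\<lambda>t. 1 / w2 0 t) \<in> borel_measurable torus_measure"
    using integrable_inverse_w2_zero by (rule borel_measurable_integrable)
qed (use integrable_inverse_w2_zero G_measurable1 in auto)

section \<open>The Fredholm determinant\<close>

text \<open>The factor 1/2 is the product of the two factors \<open>1 / sqrt 2\<close> in
  \<open>A01\<close> and \<open>A01_adj\<close>; for \<open>A_op\<close> it is the 1/2 of
  \<open>A12_adj\<close>. Hence one function serves both operators.\<close>

definition Dl :: "real \<Rightarrow> real \<Rightarrow> real \<Rightarrow> real^3 \<Rightarrow> real" where
  "Dl \<gamma> \<mu> z k = w1 \<gamma> k - z - \<mu>\<^sup>2 / 2 * I_int z k"

lemma Dl_ge_origin:
  assumes "z < 0" "k \<in> torus"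
  shows "eps k + Dl \<gamma> \<mu> z 0 \<le> Dl \<gamma> \<mu> z k"
proof -
  have "eps 0 = 0" by (simp add: eps_def)
  then show ?thesis
    using mult_left_mono[OF I_int_le_origin[OF assms], of "\<mu>\<^sup>2 / 2"] by (simp add: Dl_def w1_def)
qed

lemma Dl_strict_antimono:
  assumes "z < z'" "z' < 0" shows "Dl \<gamma> \<mu> z' k < Dl \<gamma> \<mu> z k"
  using assms mult_left_mono[OF I_int_mono_energy[of z z' k], of "\<mu>\<^sup>2 / 2"] by (simp add: Dl_def)

lemma continuous_on_Dl_energy: "continuous_on {..<0} (\<lambda>z. Dl \<gamma> \<mu> z k)"
proof -
  have "continuous (at z) (\<lambda>z. I_int z k)" if z: "z < 0" for z
    unfolding continuous_at_eps_delta
  proof (intro allI impI)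
    fix e :: real assume e: "e > 0"
    define d where "d = - z / 2"
    have d: "d > 0" using z by (simp add: d_def)
    define L where "L = torus_vol / d\<^sup>2 + 1"
    have L: "L > 0" using d torus_vol_nonneg by (simp add: L_def add_nonneg_pos)
    have "\<bar>I_int z' k - I_int z k\<bar> < e" if "\<bar>z' - z\<bar> < min d (e / L)" for z'
    proof -
      have "\<bar>I_int z' k - I_int z k\<bar> \<le> torus_vol / d\<^sup>2 * \<bar>z' - z\<bar>"
        using that d by (intro I_int_Lipschitz_energy) (auto simp: d_def)
      also have "\<dots> \<le> L * \<bar>z' - z\<bar>" by (intro mult_right_mono) (auto simp: L_def)
      also have "\<dots> < e" using that L by (simp add: field_simps)
      finally show ?thesis .
    qed
    then show "\<exists>d>0. \<forall>x'. dist x' z < d \<longrightarrow> dist (I_int x' k) (I_int z k) < e"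
      using d e L by (intro exI[of _ "min d (e / L)"]) (auto simp: dist_real_def)
  qed
  then have "continuous_on {..<0} (\<lambda>z. I_int z k)"
    by (auto intro: continuous_at_imp_continuous_on)
  then show ?thesis unfolding Dl_def by (intro continuous_intros)
qed

lemma Dl_Lipschitz:
  assumes "z < 0"
  shows "\<bar>Dl \<gamma> \<mu> z k - Dl \<gamma> \<mu> z k'\<bar> \<le> (3 + \<mu>\<^sup>2 / 2 * (torus_vol * (5 / z\<^sup>2))) * norm (k - k')"
proof -
  have "\<bar>Dl \<gamma> \<mu> z k - Dl \<gamma> \<mu> z k'\<bar> = \<bar>(eps k - eps k') - \<mu>\<^sup>2 / 2 * (I_int z k - I_int z k')\<bar>"
    by (simp add: Dl_def w1_def right_diff_distrib)
  also have "\<dots> \<le> \<bar>eps k - eps k'\<bar> + \<mu>\<^sup>2 / 2 * \<bar>I_int z k - I_int z k'\<bar>"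
    using abs_triangle_ineq4[of "eps k - eps k'" "\<mu>\<^sup>2 / 2 * (I_int z k - I_int z k')"] by (simp add: abs_mult)
  also have "\<dots> \<le> 3 * norm (k - k') + \<mu>\<^sup>2 / 2 * (torus_vol * (5 / z\<^sup>2 * norm (k - k')))"
    by (intro add_mono mult_left_mono eps_Lipschitz I_int_Lipschitz assms) simp
  finally show ?thesis by (simp add: algebra_simps)
qed

lemma continuous_on_Dl:
  assumes "z < 0" shows "continuous_on S (Dl \<gamma> \<mu> z)"
proof -
  have "lipschitz_on (3 + \<mu>\<^sup>2 / 2 * (torus_vol * (5 / z\<^sup>2))) S (Dl \<gamma> \<mu> z)"
    using Dl_Lipschitz[OF assms] torus_vol_nonneg
    by (intro lipschitz_onI) (auto simp: dist_norm)
  then show ?thesis by (rule lipschitz_on_continuous_on)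
qed

text \<open>Intermediate values: towards energy 0 the function tends to
  \<open>\<gamma> - \<mu>\<^sup>2 / 2 * I00 < 0\<close>, and at very negative energy the term
  \<open>- z\<close> dominates.\<close>

lemma Dl_root:
  assumes \<mu>: "\<mu> > 0" and "\<gamma> < \<mu>\<^sup>2 / 2 * I00"
  obtains E where "E < 0" "Dl \<gamma> \<mu> E 0 = 0"
proof -
  have eps0: "w1 \<gamma> 0 = \<gamma>" by (simp add: w1_def eps_def)
  have "(\<lambda>n. Dl \<gamma> \<mu> (- inverse (real (Suc n))) 0) \<longlonglongrightarrow> \<gamma> - (- 0) - \<mu>\<^sup>2 / 2 * I00"
    unfolding Dl_def eps0
    by (intro tendsto_diff tendsto_mult tendsto_const I_int_tendsto_I00 tendsto_minus LIMSEQ_inverse_real_of_nat)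
  then have "\<forall>\<^sub>F n in sequentially. Dl \<gamma> \<mu> (- inverse (real (Suc n))) 0 < 0"
    using assms(2) by (intro order_tendstoD(2)) auto
  then obtain n where n: "Dl \<gamma> \<mu> (- inverse (real (Suc n))) 0 < 0" by (auto simp: eventually_sequentially)
  define b where "b = - inverse (real (Suc n))"
  have b: "b < 0" "Dl \<gamma> \<mu> b 0 < 0" using n unfolding b_def by simp_all
  \<comment> \<open>Below \<open>- 1\<close> the integral is at most \<open>torus_vol\<close>, and
    the last entry lets \<open>- a\<close> outweigh \<open>\<bar>\<gamma>\<bar>\<close> together
    with the interaction term; \<open>b - 1\<close> places \<open>a\<close> to the left of
    \<open>b\<close>.\<close>
  define a where "a = min (b - 1) (min (- 1) (- \<bar>\<gamma>\<bar> - \<mu>\<^sup>2 / 2 * torus_vol))"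
  have a: "a < b" "a \<le> - 1" "a \<le> - \<bar>\<gamma>\<bar> - \<mu>\<^sup>2 / 2 * torus_vol" by (auto simp: a_def)
  have "I_int a 0 \<le> torus_vol"
  proof -
    have "torus_vol / (- a) \<le> torus_vol / 1"
      using a(2) torus_vol_nonneg by (intro divide_left_mono) auto
    then show ?thesis using I_int_bounds(2)[of a 0] a(2) by simp
  qed
  then have "\<mu>\<^sup>2 / 2 * I_int a 0 \<le> \<mu>\<^sup>2 / 2 * torus_vol" by (intro mult_left_mono) auto
  then have "0 \<le> Dl \<gamma> \<mu> a 0" using a(3) unfolding Dl_def eps0 by linarith
  moreover have "continuous_on {a..b} (\<lambda>z. Dl \<gamma> \<mu> z 0)"
    by (rule continuous_on_subset[OF continuous_on_Dl_energy]) (use b in auto)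
  ultimately obtain E where "a \<le> E" "E \<le> b" "Dl \<gamma> \<mu> E 0 = 0"
    using IVT2'[of "\<lambda>z. Dl \<gamma> \<mu> z 0" b 0 a] a(1) b by auto
  with b(1) show ?thesis by (intro that[of E]) auto
qed

section \<open>Points of the spectrum\<close>

lemma space_torus_measure [simp]: "space torus_measure = torus"
  by (simp add: torus_measure_def space_restrict_space)

lemma A_op_minus:
  "A_op \<gamma> \<mu> x - z *\<^sub>C x = (A11 \<gamma> (fst x) + \<mu> *\<^sub>R A12 (snd x) - z *\<^sub>C fst x,
    \<mu> *\<^sub>R A12_adj (fst x) + A22 (snd x) - z *\<^sub>C snd x)"
  by (simp add: A_op_def scaleC_prod_def)

lemma A_fiber_minus:
  "A_fiber \<gamma> \<mu> k x - z *\<^sub>C x = (A00_fiber \<gamma> k (fst x) + \<mu> *\<^sub>R A01 (snd x) - z * fst x,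
    \<mu> *\<^sub>R A01_adj (fst x) + A11_fiber k (snd x) - z *\<^sub>C snd x)"
  by (simp add: A_fiber_def scaleC_prod_def scaleC_complex_def)

section \<open>Elimination of the two-particle component\<close>

lemma norm_G_le: "z < 0 \<Longrightarrow> cmod (complex_of_real (G z k p)) \<le> 1 / (- z)"
  using G_bounds[of z k p] by (simp add: abs_of_pos)

lemma sq_integrable_G_mult:
  assumes "z < 0" "sq_integrable torus2_measure f"
  shows "sq_integrable torus2_measure (\<lambda>x. complex_of_real (G z (fst x) (snd x)) * f x)"
  by (rule sq_integrable_mult_bounded[OF assms(2) _ norm_G_le[OF assms(1)]]) (use G_measurable2[of z] in simp)

text \<open>The two-particle component solving the second equation of \<open>(A - z) x = 0\<close>; it leaves
  \<open>Dl \<cdot> \<phi>\<close> minus an integral operator in the first one.\<close>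

definition two_particle :: "real \<Rightarrow> real \<Rightarrow> (real^3 \<Rightarrow> complex) \<Rightarrow> (real^3) \<times> (real^3) \<Rightarrow> complex" where
  "two_particle \<mu> z \<phi> x =
     complex_of_real (G z (fst x) (snd x)) * (complex_of_real (- \<mu> / 2) * (\<phi> (fst x) + \<phi> (snd x)))"

lemma two_particle_rel:
  assumes "z < 0" "sq_integrable torus_measure \<phi>"
  shows "L2_sym_rel (two_particle \<mu> z \<phi>) (two_particle \<mu> z \<phi>)"
proof -
  have "sq_integrable torus2_measure (\<lambda>x. complex_of_real (- \<mu> / 2) * (\<phi> (fst x) + \<phi> (snd x)))"
    using L2_rel_fst_snd[of \<phi> \<phi>] assms(2)
    by (intro sq_integrable_cmult sq_integrable_add) (auto simp: L2_rel_refl)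
  from sq_integrable_G_mult[OF assms(1) this] show ?thesis
    by (simp add: L2_sym_rel_def L2_rel_refl two_particle_def[abs_def] G_commute[of z "snd _"] add.commute)
qed

lemma integrable_G_mult:
  assumes "z < 0" "sq_integrable torus_measure \<phi>"
  shows "integrable torus_measure (\<lambda>t. complex_of_real (G z k t) * \<phi> t)"
proof (rule sq_integrable_integrable[OF finite_measure_torus])
  show "sq_integrable torus_measure (\<lambda>t. complex_of_real (G z k t) * \<phi> t)"
    by (rule sq_integrable_mult_bounded[OF assms(2) _ norm_G_le[OF assms(1)]]) (use G_measurable1[of z k] in simp)
qed

text \<open>The second component is chosen so that the second residual vanishes exactly. In the
  first one, the part of \<open>two_particle\<close> carrying \<open>\<phi> k\<close> integrates to
  \<open>I_int z k\<close> and completes \<open>Dl\<close>, while the part carrying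
  \<open>\<phi> t\<close> becomes the integral operator. Small residuals can thus be sought by
  varying \<open>\<phi>\<close> alone.\<close>

lemma schur_reduction:
  fixes z \<mu> \<gamma> :: real and \<phi> :: "real^3 \<Rightarrow> complex"
  assumes z: "z < 0" and \<phi>: "sq_integrable torus_measure \<phi>"
  defines "x \<equiv> (abs_L2_torus \<phi>, abs_L2_sym (two_particle \<mu> z \<phi>))"
  shows "(norm (A_op \<gamma> \<mu> x - complex_of_real z *\<^sub>C x))\<^sup>2
    = (\<integral>k. (cmod (complex_of_real (Dl \<gamma> \<mu> z k) * \<phi> k
        - complex_of_real (\<mu>\<^sup>2 / 2) * (\<integral>t. complex_of_real (G z k t) * \<phi> t \<partial>torus_measure)))\<^sup>2 \<partial>torus_measure)"
    (is "_ = (\<integral>k. (cmod (?h k))\<^sup>2 \<partial>_)")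
proof -
  define \<psi> where "\<psi> = two_particle \<mu> z \<phi>"
  have \<psi>: "L2_sym_rel \<psi> \<psi>" unfolding \<psi>_def by (rule two_particle_rel[OF z \<phi>])
  have \<phi>': "L2_rel torus_measure \<phi> \<phi>" using \<phi> by (simp add: L2_rel_refl)
  note w1\<phi> = L2_rel_mult_bounded[OF \<phi>' _ w1_bound, of \<gamma>]
  have int\<psi>: "sq_integrable torus_measure (\<lambda>k. \<integral>t. \<psi> (k, t) \<partial>torus_measure)"
    using L2_rel_partial_integral[of \<psi> \<psi>] \<psi> by (simp add: L2_sym_rel_def L2_rel_refl)
  define g where "g k = complex_of_real (w1 \<gamma> k) * \<phi> k + complex_of_real \<mu> * (\<integral>t. \<psi> (k, t) \<partial>torus_measure)
      - complex_of_real z * \<phi> k" for k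
  have first: "A11 \<gamma> (abs_L2_torus \<phi>) + \<mu> *\<^sub>R A12 (abs_L2_sym \<psi>) - complex_of_real z *\<^sub>C abs_L2_torus \<phi>
      = abs_L2_torus g"
    using w1\<phi> int\<psi> \<phi> \<phi>' \<psi>
    by (simp add: A11.abs_eq A12.abs_eq scaleR_L2_torus.abs_eq scaleC_L2_torus.abs_eq
        plus_L2_torus.abs_eq minus_L2_torus.abs_eq L2_rel_refl sq_integrable_cmult sq_integrable_add
        g_def[abs_def])
  have g: "sq_integrable torus_measure g"
    unfolding g_def using w1\<phi> int\<psi> \<phi>
    by (intro sq_integrable_diff sq_integrable_add sq_integrable_cmult) (auto simp: L2_rel_refl)
  have gh: "g k = ?h k" for k
  proof -
    have i: "integrable torus_measure (\<lambda>t. \<phi> k * complex_of_real (G z k t))"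
      using G_integrable[OF z] by simp
    have I: "(\<integral>t. complex_of_real (G z k t) \<partial>torus_measure) = complex_of_real (I_int z k)"
      by (simp add: I_int_def)
    have "(\<integral>t. \<psi> (k, t) \<partial>torus_measure)
        = (\<integral>t. complex_of_real (- \<mu> / 2) * (\<phi> k * complex_of_real (G z k t) + complex_of_real (G z k t) * \<phi> t) \<partial>torus_measure)"
      by (rule Bochner_Integration.integral_cong[OF refl]) (simp add: \<psi>_def two_particle_def algebra_simps)
    also have "\<dots> = complex_of_real (- \<mu> / 2) * (\<phi> k * complex_of_real (I_int z k)
        + (\<integral>t. complex_of_real (G z k t) * \<phi> t \<partial>torus_measure))"
      unfolding integral_mult_right_zero Bochner_Integration.integral_add[OF i integrable_G_mult[OF z \<phi>]] I ..
    finally have \<psi>_int: "(\<integral>t. \<psi> (k, t) \<partial>torus_measure) = complex_of_real (- \<mu> / 2)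
        * (\<phi> k * complex_of_real (I_int z k) + (\<integral>t. complex_of_real (G z k t) * \<phi> t \<partial>torus_measure))" .
    show ?thesis
      unfolding g_def Dl_def \<psi>_int by (simp add: power2_eq_square algebra_simps)
  qed
  have "sq_integrable torus2_measure (\<lambda>x. \<phi> (fst x) + \<phi> (snd x))"
    using L2_rel_fst_snd[OF \<phi>'] by (intro sq_integrable_add) (auto simp: L2_rel_refl)
  from sq_integrable_cmult[OF this, of "1/2"]
  have adj: "L2_sym_rel (\<lambda>x. (\<phi> (fst x) + \<phi> (snd x)) / 2) (\<lambda>x. (\<phi> (fst x) + \<phi> (snd x)) / 2)"
    by (simp add: L2_sym_rel_def L2_rel_refl add.commute)
  note w2\<psi> = L2_sym_rel_mult_w2[OF \<psi>]
  have "\<mu> *\<^sub>R A12_adj (abs_L2_torus \<phi>) + A22 (abs_L2_sym \<psi>) - complex_of_real z *\<^sub>C abs_L2_sym \<psi>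
      = abs_L2_sym (\<lambda>x. complex_of_real \<mu> * ((\<phi> (fst x) + \<phi> (snd x)) / 2)
          + complex_of_real (w2 (fst x) (snd x)) * \<psi> x - complex_of_real z * \<psi> x)"
    using adj w2\<psi> \<phi>' \<psi> L2_sym_rel_closure(5)[OF adj, of "complex_of_real \<mu>"]
      L2_sym_rel_closure(5)[OF \<psi>, of "complex_of_real z"]
      L2_sym_rel_closure(2)[OF L2_sym_rel_closure(5)[OF adj, of "complex_of_real \<mu>"] w2\<psi>]
    by (simp only: A12_adj.abs_eq A22.abs_eq scaleR_L2_sym.abs_eq scaleC_L2_sym.abs_eq
        plus_L2_sym.abs_eq minus_L2_sym.abs_eq)
  also have "\<dots> = abs_L2_sym (\<lambda>x. 0)"
  proof (rule arg_cong[where f = abs_L2_sym], rule ext)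
    fix x
    have pos: "w2 (fst x) (snd x) - z \<noteq> 0" using w2_nonneg[of "fst x" "snd x"] z by simp
    have "complex_of_real (w2 (fst x) (snd x)) * \<psi> x - complex_of_real z * \<psi> x
        = complex_of_real ((w2 (fst x) (snd x) - z) * G z (fst x) (snd x)) * (complex_of_real (- \<mu> / 2) * (\<phi> (fst x) + \<phi> (snd x)))"
      by (simp add: \<psi>_def two_particle_def algebra_simps)
    also have "(w2 (fst x) (snd x) - z) * G z (fst x) (snd x) = 1" using pos by (simp add: G_def)
    finally show "complex_of_real \<mu> * ((\<phi> (fst x) + \<phi> (snd x)) / 2)
          + complex_of_real (w2 (fst x) (snd x)) * \<psi> x - complex_of_real z * \<psi> x = 0"
      by (simp add: add_divide_distrib algebra_simps)
  qed
  also have "\<dots> = 0" by (simp add: zero_L2_sym_def)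
  finally have second: "\<mu> *\<^sub>R A12_adj (abs_L2_torus \<phi>) + A22 (abs_L2_sym \<psi>) - complex_of_real z *\<^sub>C abs_L2_sym \<psi> = 0" .
  have "A_op \<gamma> \<mu> x - complex_of_real z *\<^sub>C x = (abs_L2_torus g, 0)"
    unfolding x_def A_op_minus fst_conv snd_conv \<psi>_def[symmetric] first second ..
  then show ?thesis by (simp add: norm_Pair norm_abs_L2_torus g gh)
qed

section \<open>Singular sequences on small cubes centred on the diagonal\<close>

definition diag :: "real \<Rightarrow> real^3" where "diag s = (\<chi> i. s)"

text \<open>The coordinates lie between \<open>- 1\<close> and 2, within the open interval of radius
  \<open>pi\<close>. The segment \<open>0 \<le> s \<le> 1\<close> of the diagonal is the path along
  which intermediate values are taken later.\<close>

lemma cube_diag_subset_torus: "0 \<le> s \<Longrightarrow> s \<le> 1 \<Longrightarrow> r \<le> 1 \<Longrightarrow> cube (diag s) r \<subseteq> torus"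
proof
  fix t assume s: "0 \<le> s" "s \<le> 1" "r \<le> 1" and "t \<in> cube (diag s) r"
  then have "\<bar>t $ i - s\<bar> \<le> r" for i by (simp add: mem_cube diag_def)
  then have "- pi < t $ i \<and> t $ i \<le> pi" for i using s pi_gt3 by (smt (verit))
  then show "t \<in> torus" by (simp add: torus_def)
qed

lemma measure_torus_cube:
  assumes "cube k r \<subseteq> torus" "0 \<le> r"
  shows "measure torus_measure (cube k r) = (2 * r) ^ 3" "cube k r \<in> sets torus_measure"
proof -
  have b: "cube k r \<in> sets borel" by (simp add: cube_def)
  show "cube k r \<in> sets torus_measure"
    using assms(1) b torus_borel by (simp add: torus_measure_def sets_restrict_space_iff)
  show "measure torus_measure (cube k r) = (2 * r) ^ 3"
    using assms b torus_borel emeasure_cube[OF assms(2), of k]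
    by (simp add: torus_measure_def measure_restrict_space measure_def emeasure_restrict_space)
qed

lemma cube_diag:
  assumes "0 \<le> s" "s \<le> 1" "0 < r" "r \<le> 1"
  shows "measure torus_measure (cube (diag s) r) = (2 * r) ^ 3" "cube (diag s) r \<in> sets torus_measure"
    "cube (diag s) r \<subseteq> torus" "integrable torus_measure (indicat_real (cube (diag s) r))"
proof -
  show sub: "cube (diag s) r \<subseteq> torus" by (rule cube_diag_subset_torus) (use assms in auto)
  show "measure torus_measure (cube (diag s) r) = (2 * r) ^ 3"
    and sets: "cube (diag s) r \<in> sets torus_measure"
    using measure_torus_cube[OF sub] assms by auto
  show "integrable torus_measure (indicat_real (cube (diag s) r))"
    by (rule integrable_real_indicator[OF sets]) (simp add: torus.emeasure_eq_measure)
qed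

lemma norm_diff_cube: "t \<in> cube k r \<Longrightarrow> norm (t - k) \<le> 3 * r"
proof -
  assume "t \<in> cube k r"
  then have "(\<Sum>i\<in>UNIV. \<bar>(t - k) $ i\<bar>) \<le> (\<Sum>i\<in>(UNIV::3 set). r)"
    by (intro sum_mono) (simp add: mem_cube)
  then show ?thesis using norm_le_l1_cart[of "t - k"] by simp
qed

lemma small_argument:
  fixes f :: "real \<Rightarrow> real"
  assumes "isCont f 0" "f 0 = 0" "e > 0"
  obtains r where "0 < r" "r \<le> 1" "f r < e"
proof -
  obtain d where d: "d > 0" "\<And>x. \<bar>x\<bar> < d \<Longrightarrow> \<bar>f x\<bar> < e"
    using assms unfolding continuous_at_eps_delta dist_real_def by auto
  have "\<bar>f (min 1 (d / 2))\<bar> < e" using d(1) by (intro d(2)) auto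
  then show ?thesis using that[of "min 1 (d / 2)"] d(1) by auto
qed

text \<open>The trial function is the indicator of a cube of volume \<open>m\<close> around the
  root. There \<open>Dl\<close> is of order \<open>r\<close> by its Lipschitz bound. The integral
  operator has a bounded kernel, so its output is of size \<open>m\<close> everywhere: its squared
  norm is of order \<open>m\<^sup>2\<close>, negligible against the squared norm \<open>m\<close> of
  the trial function.\<close>

lemma one_particle_spectrum:
  assumes z: "z < 0" and s: "0 \<le> s" "s \<le> 1" and root: "Dl \<gamma> \<mu> z (diag s) = 0"
  shows "complex_of_real z \<in> spectrum (A_op \<gamma> \<mu>)"
proof -
  interpret self_adjoint_op "A_op \<gamma> \<mu>" by (rule self_adjoint_A_op)
  show ?thesis
  proof (rule spectrumI_approx)
    fix e :: real assume e: "e > 0"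
    define L where "L = 3 + \<mu>\<^sup>2 / 2 * (torus_vol * (5 / z\<^sup>2))"
    define C where "C = \<mu>\<^sup>2 / 2 / (- z)"
    \<comment> \<open>The left side of the third condition bounds the squared residual after
      division by \<open>m = (2 * r) ^ 3\<close>.\<close>
    obtain r where r: "0 < r" "r \<le> 1" "2 * (L * (3 * r))\<^sup>2 + 2 * C\<^sup>2 * torus_vol * (2 * r) ^ 3 < e\<^sup>2"
      by (rule small_argument[of "\<lambda>r. 2 * (L * (3 * r))\<^sup>2 + 2 * C\<^sup>2 * torus_vol * (2 * r) ^ 3" "e\<^sup>2"])
        (use e in \<open>auto intro!: continuous_intros\<close>)
    define U where "U = cube (diag s) r"
    define m where "m = (2 * r) ^ 3"
    note U' = cube_diag[OF s r(1,2), folded U_def m_def]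
    have m: "m > 0" using r by (simp add: m_def)
    define \<phi> where "\<phi> = (\<lambda>t. indicator U t :: complex)"
    have [measurable]: "\<phi> \<in> borel_measurable torus_measure" unfolding \<phi>_def using U'(2) by simp
    have \<phi>2: "(cmod (\<phi> t))\<^sup>2 = indicator U t" for t by (simp add: \<phi>_def indicator_def)
    have indU: "integrable torus_measure (indicat_real U)" and U: "U \<subseteq> torus" by (rule U')+
    then have \<phi>: "sq_integrable torus_measure \<phi>" by (simp add: sq_integrable_def \<phi>2)
    have norm\<phi>: "(norm (abs_L2_torus \<phi>))\<^sup>2 = m"
      using U' U by (simp add: norm_abs_L2_torus \<phi> \<phi>2 Int_absorb2)
    define x where "x = (abs_L2_torus \<phi>, abs_L2_sym (two_particle \<mu> z \<phi>))"
    define c where "c k = (\<integral>t. complex_of_real (G z k t) * \<phi> t \<partial>torus_measure)" for k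
    have c: "cmod (c k) \<le> m / (- z)" for k
    proof -
      have "cmod (c k) \<le> (\<integral>t. norm (complex_of_real (G z k t) * \<phi> t) \<partial>torus_measure)"
        unfolding c_def by (rule integral_norm_bound)
      also have "\<dots> \<le> (\<integral>t. 1 / (- z) * indicator U t \<partial>torus_measure)"
      proof (rule integral_mono)
        show "integrable torus_measure (\<lambda>t. norm (complex_of_real (G z k t) * \<phi> t))"
          using integrable_G_mult[OF z \<phi>] by (rule integrable_norm)
        show "norm (complex_of_real (G z k t) * \<phi> t) \<le> 1 / (- z) * indicator U t" for t
          using G_bounds[OF z, of k t] by (simp add: \<phi>_def norm_mult indicator_def)
      qed (use indU in simp)
      also have "\<dots> = m / (- z)" using U' U by (simp add: Int_absorb2)
      finally show ?thesis .
    qed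
    have point: "(cmod (complex_of_real (Dl \<gamma> \<mu> z k) * \<phi> k - complex_of_real (\<mu>\<^sup>2 / 2) * c k))\<^sup>2
        \<le> 2 * (L * (3 * r))\<^sup>2 * indicator U k + 2 * C\<^sup>2 * m\<^sup>2" for k
    proof -
      have "(cmod (u - v))\<^sup>2 \<le> 2 * (cmod u)\<^sup>2 + 2 * (cmod v)\<^sup>2" for u v
      proof -
        have "(cmod (u - v))\<^sup>2 \<le> (cmod u + cmod v)\<^sup>2" by (intro power_mono norm_triangle_ineq4) simp
        also have "\<dots> \<le> 2 * (cmod u)\<^sup>2 + 2 * (cmod v)\<^sup>2"
          using sum_squares_bound[of "cmod u" "cmod v"] by (simp add: power2_sum)
        finally show ?thesis .
      qed
      note two = this
      have 1: "(cmod (complex_of_real (Dl \<gamma> \<mu> z k) * \<phi> k))\<^sup>2 \<le> (L * (3 * r))\<^sup>2 * indicator U k"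
      proof (cases "k \<in> U")
        case True
        have "\<bar>Dl \<gamma> \<mu> z k\<bar> \<le> L * norm (k - diag s)"
          using Dl_Lipschitz[OF z, of \<gamma> \<mu> k "diag s"] root by (simp add: L_def)
        also have "\<dots> \<le> L * (3 * r)"
          using norm_diff_cube[of k "diag s" r] True torus_vol_nonneg
          by (intro mult_left_mono) (auto simp: U_def L_def)
        finally have "\<bar>Dl \<gamma> \<mu> z k\<bar>\<^sup>2 \<le> (L * (3 * r))\<^sup>2" by (intro power_mono) auto
        with True show ?thesis by (simp add: \<phi>_def)
      qed (simp add: \<phi>_def)
      have "cmod (complex_of_real (\<mu>\<^sup>2 / 2) * c k) \<le> \<mu>\<^sup>2 / 2 * (m / (- z))"
        unfolding norm_mult norm_of_real by (intro mult_mono c) auto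
      also have "\<dots> = C * m" by (simp add: C_def)
      finally have "(cmod (complex_of_real (\<mu>\<^sup>2 / 2) * c k))\<^sup>2 \<le> (C * m)\<^sup>2" by (intro power_mono) auto
      then show ?thesis
        using two[of "complex_of_real (Dl \<gamma> \<mu> z k) * \<phi> k" "complex_of_real (\<mu>\<^sup>2 / 2) * c k"] 1
        by (simp add: power_mult_distrib[of C m])
    qed
    have "(norm (A_op \<gamma> \<mu> x - complex_of_real z *\<^sub>C x))\<^sup>2
        = (\<integral>k. (cmod (complex_of_real (Dl \<gamma> \<mu> z k) * \<phi> k - complex_of_real (\<mu>\<^sup>2 / 2) * c k))\<^sup>2 \<partial>torus_measure)"
      unfolding x_def schur_reduction[OF z \<phi>] c_def ..
    also have "\<dots> \<le> (\<integral>k. 2 * (L * (3 * r))\<^sup>2 * indicator U k + 2 * C\<^sup>2 * m\<^sup>2 \<partial>torus_measure)"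
      using indU by (intro Bochner_Integration.integral_mono_AE' AE_I2 point) auto
    also have "\<dots> = 2 * (L * (3 * r))\<^sup>2 * m + torus_vol * (2 * C\<^sup>2 * m\<^sup>2)"
      using U' U indU by (simp add: torus_vol_def Int_absorb2)
    also have "\<dots> = (2 * (L * (3 * r))\<^sup>2 + 2 * C\<^sup>2 * torus_vol * (2 * r) ^ 3) * m"
      unfolding m_def[symmetric] by (simp add: power2_eq_square algebra_simps)
    also have "\<dots> < e\<^sup>2 * m" using r(3) m by (intro mult_strict_right_mono) auto
    also have "\<dots> \<le> e\<^sup>2 * (norm x)\<^sup>2"
      unfolding norm\<phi>[symmetric] by (intro mult_left_mono) (simp_all add: x_def norm_Pair)
    also have "\<dots> = (e * norm x)\<^sup>2" by (simp add: power_mult_distrib)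
    finally have "norm (A_op \<gamma> \<mu> x - complex_of_real z *\<^sub>C x) < e * norm x"
      by (rule power2_less_imp_less) (use e in simp)
    then show "\<exists>x. norm (A_op \<gamma> \<mu> x - complex_of_real z *\<^sub>C x) < e * norm x" ..
  qed
qed

text \<open>The trial vector has first component 0 and second component the indicator of
  \<open>U \<times> U\<close>, of squared norm \<open>m\<^sup>2\<close>. The coupling
  \<open>A12\<close> integrates one variable out and leaves squared norm \<open>m ^ 3\<close>, while
  \<open>A22 - b\<close> is of order \<open>r\<close> on the support.\<close>

lemma two_particle_spectrum:
  assumes s: "0 \<le> s" "s \<le> 1"
  shows "complex_of_real (w2 (diag s) (diag s)) \<in> spectrum (A_op \<gamma> \<mu>)"
proof -
  interpret self_adjoint_op "A_op \<gamma> \<mu>" by (rule self_adjoint_A_op)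
  define b where "b = w2 (diag s) (diag s)"
  have "complex_of_real b \<in> spectrum (A_op \<gamma> \<mu>)"
  proof (rule spectrumI_approx)
    fix e :: real assume e: "e > 0"
    \<comment> \<open>\<open>30 = 5 * (3 + 3)\<close>: the Lipschitz constant of \<open>w2\<close>
      times the distance bound \<open>3 * r\<close> from the centre in each variable.\<close>
    obtain r where r: "0 < r" "r \<le> 1" "\<mu>\<^sup>2 * (2 * r) ^ 3 + (30 * r)\<^sup>2 < e\<^sup>2"
      by (rule small_argument[of "\<lambda>r. \<mu>\<^sup>2 * (2 * r) ^ 3 + (30 * r)\<^sup>2" "e\<^sup>2"])
        (use e in \<open>auto intro!: continuous_intros\<close>)
    define U where "U = cube (diag s) r"
    define m where "m = (2 * r) ^ 3"
    note U' = cube_diag[OF s r(1,2), folded U_def m_def]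
    have m: "m > 0" using r by (simp add: m_def)
    have U: "U \<subseteq> torus" by (rule U'(3))
    define \<psi> where "\<psi> = (\<lambda>x. indicator (U \<times> U) x :: complex)"
    have UU: "U \<times> U \<in> sets torus2_measure" using U'(2) by simp
    have mUU: "measure torus2_measure (U \<times> U) = m\<^sup>2"
    proof (rule measure_eq_emeasure_eq_ennreal)
      show "emeasure torus2_measure (U \<times> U) = ennreal (m\<^sup>2)"
        using torus.emeasure_pair_measure_Times[OF U'(2) U'(2)] U'(1) m
        by (simp add: torus.emeasure_eq_measure ennreal_mult power2_eq_square)
    qed simp
    have \<psi>2: "(cmod (\<psi> x))\<^sup>2 = indicator (U \<times> U) x" for x by (simp add: \<psi>_def indicator_def)
    interpret t2: finite_measure torus2_measure by (rule finite_measure_torus2)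
    have indUU: "integrable torus2_measure (indicat_real (U \<times> U))"
      by (rule integrable_real_indicator[OF UU]) (simp add: t2.emeasure_eq_measure)
    have "\<psi> \<in> borel_measurable torus2_measure" unfolding \<psi>_def using UU by simp
    then have sq: "sq_integrable torus2_measure \<psi>" using indUU by (simp add: sq_integrable_def \<psi>2)
    have "\<psi> (snd x, fst x) = \<psi> x" for x by (cases x) (simp add: \<psi>_def indicator_def conj_commute)
    with sq have \<psi>: "L2_sym_rel \<psi> \<psi>" by (simp add: L2_sym_rel_def L2_rel_refl)
    have space2: "U \<times> U \<subseteq> space torus2_measure" using U by (auto simp: space_pair_measure)
    have norm\<psi>: "(norm (abs_L2_sym \<psi>))\<^sup>2 = m\<^sup>2"
      using mUU UU space2 by (simp add: norm_abs_L2_sym \<psi> \<psi>2 Int_absorb2)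
    define x where "x = (0 :: L2_torus, abs_L2_sym \<psi>)"
    have "(norm (A12 (abs_L2_sym \<psi>)))\<^sup>2 = m\<^sup>2 * m"
    proof -
      have eq: "(\<integral>t. \<psi> (k, t) \<partial>torus_measure) = complex_of_real m * indicator U k" for k
      proof -
        have "(\<integral>t. (indicator U t :: complex) \<partial>torus_measure) = (\<integral>t. complex_of_real (indicator U t) \<partial>torus_measure)"
          by (rule Bochner_Integration.integral_cong) (auto simp: indicator_def)
        also have "\<dots> = complex_of_real m" using U' U by (simp add: Int_absorb2)
        finally show ?thesis by (simp add: \<psi>_def indicator_times)
      qed
      have "sq_integrable torus_measure (\<lambda>k. \<integral>t. \<psi> (k, t) \<partial>torus_measure)"
        using L2_rel_partial_integral[of \<psi> \<psi>] \<psi> by (simp add: L2_sym_rel_def L2_rel_refl)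
      moreover have "(cmod (complex_of_real m * indicator U k))\<^sup>2 = m\<^sup>2 * indicator U k" for k
        by (simp add: indicator_def)
      ultimately show ?thesis
        using U' U by (simp add: A12.abs_eq \<psi> norm_abs_L2_torus eq Int_absorb2)
    qed
    moreover have "(norm (A22 (abs_L2_sym \<psi>) - complex_of_real b *\<^sub>C abs_L2_sym \<psi>))\<^sup>2 \<le> (30 * r)\<^sup>2 * m\<^sup>2"
    proof -
      define h where "h x = complex_of_real (w2 (fst x) (snd x)) * \<psi> x - complex_of_real b * \<psi> x" for x
      have h: "L2_sym_rel h h"
        unfolding h_def using L2_sym_rel_closure(3)[OF L2_sym_rel_mult_w2[OF \<psi>] L2_sym_rel_closure(5)[OF \<psi>]] .
      have "A22 (abs_L2_sym \<psi>) - complex_of_real b *\<^sub>C abs_L2_sym \<psi> = abs_L2_sym h"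
        using \<psi> L2_sym_rel_mult_w2[OF \<psi>] L2_sym_rel_closure(5)[OF \<psi>]
        by (simp add: A22.abs_eq scaleC_L2_sym.abs_eq minus_L2_sym.abs_eq h_def[abs_def])
      then have "(norm (A22 (abs_L2_sym \<psi>) - complex_of_real b *\<^sub>C abs_L2_sym \<psi>))\<^sup>2
          = (\<integral>x. (cmod (h x))\<^sup>2 \<partial>torus2_measure)" by (simp add: norm_abs_L2_sym h)
      also have "\<dots> \<le> (\<integral>x. (30 * r)\<^sup>2 * indicator (U \<times> U) x \<partial>torus2_measure)"
      proof (intro Bochner_Integration.integral_mono_AE' AE_I2)
        fix x
        have "h x = complex_of_real (w2 (fst x) (snd x) - b) * \<psi> x" by (simp add: h_def algebra_simps)
        then have "(cmod (h x))\<^sup>2 = (w2 (fst x) (snd x) - b)\<^sup>2 * indicator (U \<times> U) x"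
          by (simp only: norm_mult norm_of_real power_mult_distrib power2_abs \<psi>2)
        moreover have "\<bar>w2 (fst x) (snd x) - b\<bar> \<le> 30 * r" if "x \<in> U \<times> U"
          using w2_Lipschitz[of "fst x" "snd x" "diag s" "diag s"] that
            norm_diff_cube[of "fst x" "diag s" r] norm_diff_cube[of "snd x" "diag s" r]
          by (auto simp: U_def b_def)
        then have "(w2 (fst x) (snd x) - b)\<^sup>2 \<le> (30 * r)\<^sup>2" if "x \<in> U \<times> U"
          using that r by (metis abs_ge_zero power2_abs power_mono)
        ultimately show "(cmod (h x))\<^sup>2 \<le> (30 * r)\<^sup>2 * indicator (U \<times> U) x"
          by (cases "x \<in> U \<times> U") simp_all
      qed (use indUU in auto)
      also have "\<dots> = (30 * r)\<^sup>2 * m\<^sup>2" using mUU UU space2 by (simp add: Int_absorb2)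
      finally show ?thesis .
    qed
    moreover have "(norm (A_op \<gamma> \<mu> x - complex_of_real b *\<^sub>C x))\<^sup>2
        = \<mu>\<^sup>2 * (norm (A12 (abs_L2_sym \<psi>)))\<^sup>2 + (norm (A22 (abs_L2_sym \<psi>) - complex_of_real b *\<^sub>C abs_L2_sym \<psi>))\<^sup>2"
    proof -
      have 0: "A11 \<gamma> 0 = 0" using self_adjoint_op.bounded_linear[OF self_adjoint_A11] by (rule linear_0[OF bounded_linear.linear])
      have 1: "A12_adj 0 = 0" using A12_adj_scaleC[of 0 0] by (metis mult_zero_left norm_eq_zero norm_scaleC norm_zero)
      show ?thesis unfolding A_op_minus
        by (simp add: x_def 0 1 norm_Pair power_mult_distrib)
    qed
    ultimately have "(norm (A_op \<gamma> \<mu> x - complex_of_real b *\<^sub>C x))\<^sup>2 \<le> (\<mu>\<^sup>2 * (2 * r) ^ 3 + (30 * r)\<^sup>2) * m\<^sup>2"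
      unfolding m_def[symmetric] by (simp add: algebra_simps)
    also have "\<dots> < e\<^sup>2 * m\<^sup>2" using r(3) m by (intro mult_strict_right_mono) auto
    also have "\<dots> = (e * norm x)\<^sup>2"
      by (simp add: norm\<psi> power_mult_distrib x_def norm_Pair)
    finally have "norm (A_op \<gamma> \<mu> x - complex_of_real b *\<^sub>C x) < e * norm x"
      by (rule power2_less_imp_less) (use e in simp)
    then show "\<exists>x. norm (A_op \<gamma> \<mu> x - complex_of_real b *\<^sub>C x) < e * norm x" ..
  qed
  then show ?thesis by (simp add: b_def)
qed

text \<open>On the diagonal the three terms of \<open>w2\<close> coincide, and so do the three
  coordinates within each. The values \<open>9 * (1 - cos s)\<close> fill an interval of spectrum
  starting at 0.\<close>

lemma zero_essential_spectrum: "0 \<in> essential_spectrum (A_op \<gamma> \<mu>)"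
proof -
  interpret self_adjoint_op "A_op \<gamma> \<mu>" by (rule self_adjoint_A_op)
  define f where "f s = w2 (diag s) (diag s)" for s
  have half: "(1/2) *\<^sub>R (diag s + diag s) = diag s" for s by (simp add: diag_def vec_eq_iff)
  have f: "f s = 9 * (1 - cos s)" for s
    unfolding f_def w2_def half by (simp add: eps_def diag_def)
  have f0: "f 0 = 0" by (simp add: f)
  have "cos 1 < cos (0::real)" using pi_gt3 by (intro cos_monotone_0_pi) auto
  then have "f 1 > 0" by (simp add: f)
  moreover have "complex_of_real b \<in> spectrum (A_op \<gamma> \<mu>)" if "0 \<le> b" "b < 0 + f 1" for b
  proof -
    have "continuous_on {0..1} f" unfolding f[abs_def] by (intro continuous_intros)
    then have "\<exists>s. 0 \<le> s \<and> s \<le> 1 \<and> f s = b"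
      using that f0 by (intro IVT') auto
    then obtain s where "0 \<le> s" "s \<le> 1" "f s = b" by blast
    then show ?thesis using two_particle_spectrum[of s \<gamma> \<mu>] by (simp add: f_def)
  qed
  ultimately show ?thesis using essential_spectrumI[of "f 1" 0] by simp
qed

text \<open>Just above \<open>E\<close> the determinant is negative at the origin and positive at \<open>diag 1\<close>, so it has a
  root in between; hence \<open>E\<close> is not isolated.\<close>

lemma root_essential_spectrum:
  assumes E: "E < 0" "Dl \<gamma> \<mu> E 0 = 0"
  shows "complex_of_real E \<in> essential_spectrum (A_op \<gamma> \<mu>)"
proof -
  interpret self_adjoint_op "A_op \<gamma> \<mu>" by (rule self_adjoint_A_op)
  have diag0: "diag 0 = 0" by (simp add: diag_def zero_vec_def)
  have diag_torus: "diag 1 \<in> torus" using pi_gt3 by (simp add: diag_def torus_def)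
  have "cos 1 < cos (0::real)" using pi_gt3 by (intro cos_monotone_0_pi) auto
  then have "0 < eps (diag 1)" by (simp add: eps_def diag_def)
  then have pos: "0 < Dl \<gamma> \<mu> E (diag 1)" using Dl_ge_origin[OF E(1) diag_torus, of \<gamma> \<mu>] E(2) by simp
  have "isCont (\<lambda>z. Dl \<gamma> \<mu> z (diag 1)) E"
    using continuous_on_Dl_energy[of \<gamma> \<mu> "diag 1"] E(1) by (simp add: continuous_on_eq_continuous_at)
  then obtain d where d: "d > 0" "\<And>z. \<bar>z - E\<bar> < d \<Longrightarrow> \<bar>Dl \<gamma> \<mu> z (diag 1) - Dl \<gamma> \<mu> E (diag 1)\<bar> < Dl \<gamma> \<mu> E (diag 1)"
    using pos unfolding continuous_at_eps_delta dist_real_def by blast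
  have "complex_of_real b \<in> spectrum (A_op \<gamma> \<mu>)" if "E \<le> b" "b < E + min d (- E)" for b
  proof -
    have b: "b < 0" "\<bar>b - E\<bar> < d" using that by auto
    have "0 \<le> Dl \<gamma> \<mu> b (diag 1)" using d(2)[OF b(2)] by linarith
    moreover have "Dl \<gamma> \<mu> b (diag 0) \<le> 0"
      using Dl_strict_antimono[of E b \<gamma> \<mu> 0] b(1) that(1) E(2) by (cases "b = E") (auto simp: diag0)
    moreover have "continuous_on {0..1} (\<lambda>s. Dl \<gamma> \<mu> b (diag s))"
      unfolding diag_def
      by (intro continuous_on_compose2[OF continuous_on_Dl[OF b(1), of UNIV]] continuous_intros) auto
    ultimately obtain s where "0 \<le> s" "s \<le> 1" "Dl \<gamma> \<mu> b (diag s) = 0"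
      using IVT'[of "\<lambda>s. Dl \<gamma> \<mu> b (diag s)" 0 0 1] by auto
    then show ?thesis using one_particle_spectrum[OF b(1)] by blast
  qed
  then show ?thesis using d(1) E(1) by (intro essential_spectrumI[of "min d (- E)"]) auto
qed

section \<open>The fiber operators\<close>

lemma A11_fiber_nonneg: "0 \<le> inner (A11_fiber k f) f"
proof transfer
  fix k f assume f: "L2_rel torus_measure f f"
  have "L2_inner torus_measure (\<lambda>p. complex_of_real (w2 k p) * f p) f
      = (\<integral>p. complex_of_real (w2 k p * (cmod (f p))\<^sup>2) \<partial>torus_measure)"
    unfolding L2_inner_def
    by (rule Bochner_Integration.integral_cong[OF refl])
      (simp add: mult.assoc complex_norm_square[symmetric] flip: of_real_power)
  also have "\<dots> = complex_of_real (\<integral>p. w2 k p * (cmod (f p))\<^sup>2 \<partial>torus_measure)"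
    by (rule integral_complex_of_real)
  finally show "0 \<le> Re (L2_inner torus_measure (\<lambda>p. complex_of_real (w2 k p) * f p) f)"
    by (simp add: w2_nonneg)
qed

text \<open>\<open>A11_fiber k\<close> is nonnegative and the remaining component is one complex
  dimension, so for \<open>b < 0\<close> the form of \<open>A_fiber \<gamma> \<mu> k - b\<close> is
  coercive after a correction in that component. The two values of \<open>e\<close> give its real
  and imaginary part.\<close>

lemma A_fiber_discrete_spectrumI:
  assumes b: "b < 0" and spec: "complex_of_real b \<in> spectrum (A_fiber \<gamma> \<mu> k)"
  shows "complex_of_real b \<in> discrete_spectrum (A_fiber \<gamma> \<mu> k)"
proof -
  interpret self_adjoint_op "A_fiber \<gamma> \<mu> k" by (rule self_adjoint_A_fiber)
  obtain K where K: "K > 0" "\<And>g. norm (A01 g) \<le> norm g * K"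
    using bounded_linear.pos_bounded[OF bounded_linear_A01] by blast
  \<comment> \<open>Completing the square in \<open>norm g\<close> spends half of \<open>- b\<close>
    on the coupling; \<open>W\<close> is the resulting coefficient of
    \<open>(cmod c)\<^sup>2\<close>.\<close>
  define W where "W = 2 * \<mu>\<^sup>2 * K\<^sup>2 / (- b)"
  define s where "s = sqrt (\<bar>w1 \<gamma> k\<bar> + W)"
  have s2: "s\<^sup>2 = \<bar>w1 \<gamma> k\<bar> + W"
    unfolding s_def W_def using b by (intro real_sqrt_pow2 add_nonneg_nonneg divide_nonneg_nonneg) auto
  define v :: "bool \<Rightarrow> complex \<times> L2_torus"
    where "v e = (if e then complex_of_real s else complex_of_real s * \<i>, 0)" for e
  show ?thesis
  proof (rule discrete_spectrumI[of UNIV "- b / 2" b v])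
    fix x :: "complex \<times> L2_torus"
    obtain c g where x: "x = (c, g)" by (cases x)
    have ctrl: "(\<Sum>e\<in>UNIV. (inner (v e) x)\<^sup>2) = s\<^sup>2 * (cmod c)\<^sup>2"
      by (simp add: UNIV_bool v_def x inner_prod_def inner_complex_def cmod_power2 power_mult_distrib distrib_left)
    have "\<bar>inner c (A01 g)\<bar> \<le> cmod c * (norm g * K)"
      by (intro order_trans[OF Cauchy_Schwarz_ineq2] mult_left_mono K) simp
    then have "2 * \<bar>\<mu>\<bar> * \<bar>inner c (A01 g)\<bar> \<le> 2 * \<bar>\<mu>\<bar> * (cmod c * (norm g * K))"
      by (rule mult_left_mono) simp
    then have "\<bar>2 * \<mu> * inner c (A01 g)\<bar> \<le> 2 * (\<bar>\<mu>\<bar> * K * cmod c) * norm g"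
      by (simp add: abs_mult mult_ac)
    also have "\<dots> \<le> (- b / 2) * (norm g)\<^sup>2 + W * (cmod c)\<^sup>2"
    proof -
      define p where "p = \<bar>\<mu>\<bar> * K * cmod c"
      have "0 \<le> (- b / 2) * (norm g - 2 * p / (- b))\<^sup>2"
        by (intro mult_nonneg_nonneg) (use b in auto)
      also have "\<dots> = (- b / 2) * (norm g)\<^sup>2 - 2 * p * norm g + 2 * p\<^sup>2 / (- b)"
        using b by (simp add: power2_eq_square field_simps)
      finally show ?thesis by (simp add: p_def W_def power_mult_distrib)
    qed
    finally have cross: "- (2 * \<mu> * inner c (A01 g)) \<le> (- b / 2) * (norm g)\<^sup>2 + W * (cmod c)\<^sup>2"
      by (simp add: abs_le_iff)
    have "inner (A_fiber \<gamma> \<mu> k x - b *\<^sub>R x) x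
        = w1 \<gamma> k * (cmod c)\<^sup>2 + 2 * \<mu> * inner c (A01 g) + inner (A11_fiber k g) g - b * (cmod c)\<^sup>2 - b * (norm g)\<^sup>2"
      using A01_adj_inner[of g c]
      by (simp add: x A_fiber_def A00_fiber_def inner_prod_def inner_add_left inner_diff_left
          inner_commute[of "A01 g" c] inner_commute[of "A01_adj c" g] power2_norm_eq_inner
          inner_mult_left flip: scaleR_conv_of_real)
    moreover have "- \<bar>w1 \<gamma> k\<bar> * (cmod c)\<^sup>2 \<le> w1 \<gamma> k * (cmod c)\<^sup>2" by (intro mult_right_mono) auto
    moreover have "0 \<le> - b * (cmod c)\<^sup>2" by (intro mult_nonneg_nonneg) (use b in auto)
    moreover have "(norm x)\<^sup>2 = (cmod c)\<^sup>2 + (norm g)\<^sup>2" by (simp add: x norm_Pair)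
    ultimately show "- b / 2 * (norm x)\<^sup>2 \<le> inner (A_fiber \<gamma> \<mu> k x - b *\<^sub>R x) x + (\<Sum>e\<in>UNIV. (inner (v e) x)\<^sup>2)"
      unfolding ctrl s2 using cross A11_fiber_nonneg[of k g] by (simp add: distrib_right distrib_left)
  qed (use b spec in auto)
qed

text \<open>An explicit eigenvector: with first component 1 the second row forces
  \<open>f p = - \<mu> / sqrt 2 * G b k p\<close>, and the first row then reads
  \<open>Dl \<gamma> \<mu> b k = 0\<close>.\<close>

lemma fiber_root_spectrum:
  assumes b: "b < 0" and root: "Dl \<gamma> \<mu> b k = 0"
  shows "complex_of_real b \<in> spectrum (A_fiber \<gamma> \<mu> k)"
proof -
  interpret self_adjoint_op "A_fiber \<gamma> \<mu> k" by (rule self_adjoint_A_fiber)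
  define f where "f p = complex_of_real (- \<mu> / sqrt 2 * G b k p)" for p
  have f: "sq_integrable torus_measure f"
  proof -
    have "sq_integrable torus_measure (\<lambda>p. complex_of_real (G b k p) * complex_of_real (- \<mu> / sqrt 2))"
      by (rule sq_integrable_mult_bounded[OF sq_integrable_const[OF finite_measure_torus] _ norm_G_le[OF b]])
        (use G_measurable1[of b k] in simp)
    then show ?thesis by (simp add: f_def[abs_def] mult.commute)
  qed
  then have f': "L2_rel torus_measure f f" by (simp add: L2_rel_refl)
  define x where "x = (1 :: complex, abs_L2_torus f)"
  have "A01 (abs_L2_torus f) = complex_of_real (1 / sqrt 2) * (\<integral>t. f t \<partial>torus_measure)"
    using f' by (rule A01.abs_eq)
  also have "(\<integral>t. f t \<partial>torus_measure) = complex_of_real (- \<mu> / sqrt 2 * I_int b k)"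
    unfolding f_def integral_complex_of_real I_int_def by simp
  finally have A01f: "A01 (abs_L2_torus f) = complex_of_real (- \<mu> / 2 * I_int b k)"
    by (simp flip: of_real_mult)
  have 1: "A00_fiber \<gamma> k 1 + \<mu> *\<^sub>R A01 (abs_L2_torus f) - complex_of_real b * 1 = 0"
  proof -
    have "A00_fiber \<gamma> k 1 + \<mu> *\<^sub>R A01 (abs_L2_torus f) - complex_of_real b * 1 = complex_of_real (Dl \<gamma> \<mu> b k)"
      unfolding A01f by (simp add: A00_fiber_def Dl_def scaleR_conv_of_real power2_eq_square)
    then show ?thesis by (simp add: root)
  qed
  have c: "L2_rel torus_measure (\<lambda>t. complex_of_real (1 / sqrt 2) * 1) (\<lambda>t. complex_of_real (1 / sqrt 2) * 1)"
    by (simp add: L2_rel_refl sq_integrable_const finite_measure_torus)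
  note w = L2_rel_mult_bounded[OF f' w2_fiber_measurable w2_bound, of k]
  have "\<mu> *\<^sub>R A01_adj 1 + A11_fiber k (abs_L2_torus f) - complex_of_real b *\<^sub>C abs_L2_torus f
      = abs_L2_torus (\<lambda>p. complex_of_real \<mu> * (complex_of_real (1 / sqrt 2) * 1)
          + complex_of_real (w2 k p) * f p - complex_of_real b * f p)"
    using f' c w L2_rel_closure(5)[OF c, of "complex_of_real \<mu>"]
      L2_rel_closure(2)[OF L2_rel_closure(5)[OF c, of "complex_of_real \<mu>"] w]
      L2_rel_closure(5)[OF f', of "complex_of_real b"]
    by (simp only: A01_adj.abs_eq A11_fiber.abs_eq scaleR_L2_torus.abs_eq scaleC_L2_torus.abs_eq
        plus_L2_torus.abs_eq minus_L2_torus.abs_eq)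
  also have "\<dots> = abs_L2_torus (\<lambda>p. 0)"
  proof (rule arg_cong[where f = abs_L2_torus], rule ext)
    fix p
    have "(w2 k p - b) * G b k p = 1" using w2_nonneg[of k p] b by (simp add: G_def)
    then have "(w2 k p - b) * (- \<mu> / sqrt 2 * G b k p) = - \<mu> / sqrt 2" by (simp add: mult.left_commute)
    then have r: "\<mu> / sqrt 2 + (w2 k p - b) * (- \<mu> / sqrt 2 * G b k p) = 0" by simp
    have "complex_of_real \<mu> * (complex_of_real (1 / sqrt 2) * 1)
          + complex_of_real (w2 k p) * f p - complex_of_real b * f p
        = complex_of_real (\<mu> / sqrt 2 + (w2 k p - b) * (- \<mu> / sqrt 2 * G b k p))"
      by (simp add: f_def diff_divide_distrib algebra_simps)
    then show "complex_of_real \<mu> * (complex_of_real (1 / sqrt 2) * 1)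
          + complex_of_real (w2 k p) * f p - complex_of_real b * f p = 0"
      unfolding r by simp
  qed
  also have "\<dots> = 0" by (simp add: zero_L2_torus_def)
  finally have 2: "\<mu> *\<^sub>R A01_adj 1 + A11_fiber k (abs_L2_torus f) - complex_of_real b *\<^sub>C abs_L2_torus f = 0" .
  have "A_fiber \<gamma> \<mu> k x - complex_of_real b *\<^sub>C x = 0"
    unfolding A_fiber_minus x_def fst_conv snd_conv 1 2 by (simp add: zero_prod_def)
  moreover have "x \<noteq> 0" by (simp add: x_def zero_prod_def)
  ultimately show ?thesis by (intro spectrumI_approx exI[of _ x]) simp
qed

text \<open>The same elimination backwards. The scalar component cannot vanish, for otherwise the
  nonnegative operator \<open>A11_fiber k\<close> would have the negative eigenvalue
  \<open>b\<close>.\<close>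

lemma fiber_eigenvalue_root:
  assumes b: "b < 0" and x: "x \<noteq> 0" "A_fiber \<gamma> \<mu> k x = complex_of_real b *\<^sub>C x"
  shows "Dl \<gamma> \<mu> b k = 0"
proof -
  obtain c g where xc: "x = (c, g)" by (cases x)
  have "A_fiber \<gamma> \<mu> k x - complex_of_real b *\<^sub>C x = (0, 0)" using x(2) by (simp add: zero_prod_def)
  then have 1: "A00_fiber \<gamma> k c + \<mu> *\<^sub>R A01 g = complex_of_real b * c"
    and 2: "\<mu> *\<^sub>R A01_adj c + A11_fiber k g = complex_of_real b *\<^sub>C g"
    by (simp_all add: A_fiber_minus xc)
  have "c \<noteq> 0"
  proof
    assume "c = 0"
    then have "\<mu> *\<^sub>R A01_adj c = 0"
      using A01_adj_scaleC[of 0 0] by (metis mult_zero_left norm_eq_zero norm_scaleC norm_zero scaleR_zero_right)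
    with 2 have "A11_fiber k g = b *\<^sub>R g" by (simp add: scaleC_of_real)
    then have "0 \<le> b * (norm g)\<^sup>2" using A11_fiber_nonneg[of k g] by (simp add: power2_norm_eq_inner)
    then have "g = 0" using b by (simp add: zero_le_mult_iff)
    with \<open>c = 0\<close> x(1) xc show False by (simp add: zero_prod_def)
  qed
  obtain f where g: "g = abs_L2_torus f" and f: "sq_integrable torus_measure f" by (rule obtain_L2_torus)
  have f': "L2_rel torus_measure f f" using f by (simp add: L2_rel_refl)
  have cc: "L2_rel torus_measure (\<lambda>t. complex_of_real (1 / sqrt 2) * c) (\<lambda>t. complex_of_real (1 / sqrt 2) * c)"
    by (simp add: L2_rel_refl sq_integrable_const finite_measure_torus)
  note w = L2_rel_mult_bounded[OF f' w2_fiber_measurable w2_bound, of k]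
  note lhs = L2_rel_closure(2)[OF L2_rel_closure(5)[OF cc, of "complex_of_real \<mu>"] w]
  note rhs = L2_rel_closure(5)[OF f', of "complex_of_real b"]
  have "abs_L2_torus (\<lambda>p. complex_of_real \<mu> * (complex_of_real (1 / sqrt 2) * c) + complex_of_real (w2 k p) * f p)
      = abs_L2_torus (\<lambda>p. complex_of_real b * f p)"
    using 2 f' cc w L2_rel_closure(5)[OF cc, of "complex_of_real \<mu>"] lhs rhs unfolding g
    by (simp only: A01_adj.abs_eq A11_fiber.abs_eq scaleR_L2_torus.abs_eq scaleC_L2_torus.abs_eq
        plus_L2_torus.abs_eq)
  \<comment> \<open>Equality of classes is turned back into equality almost everywhere, so that the
    equation can be solved for \<open>f\<close> pointwise.\<close>
  then have "L2_rel torus_measure (\<lambda>p. complex_of_real \<mu> * (complex_of_real (1 / sqrt 2) * c) + complex_of_real (w2 k p) * f p)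
      (\<lambda>p. complex_of_real b * f p)"
    using Quotient3_rel[OF Quotient3_L2_torus] lhs rhs by blast
  then have "AE p in torus_measure. complex_of_real \<mu> * (complex_of_real (1 / sqrt 2) * c) + complex_of_real (w2 k p) * f p
      = complex_of_real b * f p" by (simp add: L2_rel_def)
  then have "AE p in torus_measure. f p = complex_of_real (- \<mu> / sqrt 2 * G b k p) * c"
  proof eventually_elim
    case (elim p)
    have pos: "w2 k p - b > 0" using w2_nonneg[of k p] b by simp
    have "complex_of_real (w2 k p - b) * f p = - (complex_of_real (\<mu> / sqrt 2) * c)"
      using elim by (simp add: algebra_simps add_eq_0_iff)
    then have "complex_of_real (G b k p) * (complex_of_real (w2 k p - b) * f p)
        = complex_of_real (- \<mu> / sqrt 2 * G b k p) * c" by simp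
    moreover have "complex_of_real (G b k p) * (complex_of_real (w2 k p - b) * f p)
        = complex_of_real (G b k p * (w2 k p - b)) * f p" by (simp only: of_real_mult mult.assoc)
    moreover have "G b k p * (w2 k p - b) = 1" using pos by (simp add: G_def)
    ultimately show ?case by simp
  qed
  then have "(\<integral>p. f p \<partial>torus_measure) = (\<integral>p. complex_of_real (- \<mu> / sqrt 2 * G b k p) * c \<partial>torus_measure)"
    using f G_measurable1[of b k] by (intro integral_cong_AE) (auto simp: sq_integrable_def)
  also have "\<dots> = complex_of_real (- \<mu> / sqrt 2 * I_int b k) * c"
    unfolding integral_mult_left_zero integral_complex_of_real I_int_def by simp
  finally have "A01 g = complex_of_real (1 / sqrt 2) * (complex_of_real (- \<mu> / sqrt 2 * I_int b k) * c)"
    unfolding g A01.abs_eq[OF f'] by simp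
  then have A01g: "A01 g = complex_of_real (- \<mu> / 2 * I_int b k) * c"
    by (simp add: mult.assoc[symmetric] flip: of_real_mult)
  have "complex_of_real (Dl \<gamma> \<mu> b k) * c = A00_fiber \<gamma> k c + \<mu> *\<^sub>R A01 g - complex_of_real b * c"
    unfolding A01g by (simp add: A00_fiber_def Dl_def scaleR_conv_of_real power2_eq_square algebra_simps)
  then show ?thesis using 1 \<open>c \<noteq> 0\<close> by simp
qed

text \<open>Below \<open>E\<close> the determinant is positive at the origin because it decreases in
  the energy, and then positive at every \<open>k\<close> by comparison with the origin; no fiber
  has an eigenvalue there.\<close>

lemma is_min_Lambda:
  assumes E: "E < 0" "Dl \<gamma> \<mu> E 0 = 0"
  shows "is_min (Lambda \<gamma> \<mu> \<inter> complex_of_real ` {..0}) E"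
  unfolding is_min_def
proof (intro conjI ballI)
  show "Lambda \<gamma> \<mu> \<inter> complex_of_real ` {..0} \<subseteq> \<real>" by auto
  have "0 \<in> torus" by (simp add: torus_def)
  then show "complex_of_real E \<in> Lambda \<gamma> \<mu> \<inter> complex_of_real ` {..0}"
    using A_fiber_discrete_spectrumI[OF E(1) fiber_root_spectrum[OF E]] E(1) by (auto simp: Lambda_def)
  fix z assume z: "z \<in> Lambda \<gamma> \<mu> \<inter> complex_of_real ` {..0}"
  then obtain b k where b: "z = complex_of_real b" and k: "k \<in> torus" "z \<in> discrete_spectrum (A_fiber \<gamma> \<mu> k)"
    by (auto simp: Lambda_def)
  show "E \<le> Re z"
  proof (rule ccontr)
    assume "\<not> E \<le> Re z"
    then have bE: "b < E" by (simp add: b)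
    then have "0 < Dl \<gamma> \<mu> b k"
      using Dl_ge_origin[OF _ k(1), of b \<gamma> \<mu>] Dl_strict_antimono[OF bE E(1), of \<gamma> \<mu> 0] E eps_nonneg[of k] by simp
    moreover obtain x where "x \<noteq> 0" "A_fiber \<gamma> \<mu> k x = complex_of_real b *\<^sub>C x"
    proof -
      have "0 \<in> eigenspace (A_fiber \<gamma> \<mu> k) z"
        using linear_0[OF bounded_linear.linear[OF self_adjoint_op.bounded_linear[OF self_adjoint_A_fiber]]]
        by (simp add: eigenspace_def)
      moreover have "eigenspace (A_fiber \<gamma> \<mu> k) z \<noteq> {0}" using k(2) by (simp add: discrete_spectrum_def)
      ultimately obtain x where "x \<in> eigenspace (A_fiber \<gamma> \<mu> k) z" "x \<noteq> 0" by blast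
      then show ?thesis using that by (simp add: eigenspace_def b)
    qed
    ultimately show False using fiber_eigenvalue_root[of b x \<gamma> \<mu> k] bE E(1) by simp
  qed
qed

lemma is_min_unique: "is_min S a \<Longrightarrow> is_min S b \<Longrightarrow> a = b"
  unfolding is_min_def by (metis Re_complex_of_real order_antisym)

lemma E1_eq:
  assumes "E < 0" "Dl \<gamma> \<mu> E 0 = 0" shows "E1 \<gamma> \<mu> = E"
  unfolding E1_def using is_min_Lambda[OF assms] by (intro the_equality is_min_unique)

section \<open>Discreteness below the bottom of the continuum\<close>

text \<open>Rounding down to the lattice of mesh \<open>1 / n\<close>. For \<open>n > 0\<close> its
  level sets cut the torus into finitely many small Borel cells.\<close>

definition grid :: "nat \<Rightarrow> real^3 \<Rightarrow> real^3" where
  "grid n p = (\<chi> i. real_of_int \<lfloor>real n * p $ i\<rfloor> / real n)"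

lemma norm_grid_le:
  assumes "n > 0" shows "norm (p - grid n p) \<le> 3 / real n"
proof -
  have "\<bar>(p - grid n p) $ i\<bar> \<le> 1 / real n" for i
  proof -
    have "real n * ((p - grid n p) $ i) = real n * p $ i - real_of_int \<lfloor>real n * p $ i\<rfloor>"
      using assms by (simp add: grid_def right_diff_distrib)
    then have "0 \<le> real n * ((p - grid n p) $ i)" "real n * ((p - grid n p) $ i) \<le> 1" by linarith+
    then show ?thesis using assms by (simp add: field_simps zero_le_mult_iff)
  qed
  then have "(\<Sum>i\<in>UNIV. \<bar>(p - grid n p) $ i\<bar>) \<le> (\<Sum>i\<in>(UNIV::3 set). 1 / real n)" by (intro sum_mono)
  then show ?thesis using norm_le_l1_cart[of "p - grid n p"] by simp
qed

lemma finite_grid: "finite (grid n ` torus)"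
proof -
  define S where "S = {\<lfloor>- real n * pi\<rfloor>..\<lfloor>real n * pi\<rfloor>}"
  have "grid n ` torus \<subseteq> (\<lambda>f. \<chi> i. real_of_int (f i) / real n) ` (PiE UNIV (\<lambda>_. S))"
  proof
    fix q assume "q \<in> grid n ` torus"
    then obtain p where p: "p \<in> torus" "q = grid n p" by blast
    have "\<lfloor>real n * p $ i\<rfloor> \<in> S" for i
    proof -
      have "- pi \<le> p $ i" "p $ i \<le> pi" using p(1) by (auto simp: torus_def less_imp_le)
      then have "real n * - pi \<le> real n * p $ i" "real n * p $ i \<le> real n * pi" by (intro mult_left_mono; simp)+
      then show ?thesis by (auto simp: S_def intro!: floor_mono)
    qed
    then show "q \<in> (\<lambda>f. \<chi> i. real_of_int (f i) / real n) ` (PiE UNIV (\<lambda>_. S))"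
      unfolding p(2) grid_def by (intro image_eqI[of _ _ "\<lambda>i. \<lfloor>real n * p $ i\<rfloor>"]) auto
  qed
  then show ?thesis by (rule finite_subset) (simp add: S_def finite_PiE)
qed

lemma grid_fiber_borel: "{p. grid n p = q} \<in> sets borel"
proof -
  have [measurable]: "(\<lambda>p::real^3. p $ i) \<in> borel_measurable borel" for i
    by (intro borel_measurable_continuous_onI continuous_intros)
  have "{p. grid n p = q} = (\<Inter>i\<in>UNIV. {p \<in> space borel. real_of_int \<lfloor>real n * p $ i\<rfloor> / real n = q $ i})"
    by (auto simp: grid_def vec_eq_iff)
  also have "\<dots> \<in> sets borel" by (intro sets.finite_INT) auto
  finally show ?thesis .
qed

text \<open>Freezing \<open>p\<close> at the lattice point of its cell turns the kernel into a
  finite sum of products, with a uniform error by the Lipschitz bound. This is the compactness of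
  the integral operator in quantitative form.\<close>

lemma G_degenerate_approx:
  assumes b: "b < 0" and \<eta>: "\<eta> > 0"
  obtains R S where "finite R" "\<And>q. S q \<in> sets borel"
    "\<And>k p. p \<in> torus \<Longrightarrow> \<bar>G b k p - (\<Sum>q\<in>R. G b k q * indicator (S q) p)\<bar> \<le> \<eta>"
proof -
  \<comment> \<open>\<open>15 = 5 * 3\<close>: the Lipschitz constant \<open>5 / b\<^sup>2\<close>
    of \<open>G\<close> times the rounding error \<open>3 / n\<close>.\<close>
  obtain n :: nat where n: "15 / b\<^sup>2 / \<eta> < real n" using reals_Archimedean2 by blast
  have "0 \<le> 15 / b\<^sup>2 / \<eta>" using \<eta> by simp
  with n have n0: "n > 0" by (simp only: of_nat_0_less_iff[symmetric, where 'a = real])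
  define S where "S q = {p. grid n p = q}" for q
  show ?thesis
  proof (rule that[of "grid n ` torus" S])
    show "finite (grid n ` torus)" by (rule finite_grid)
    show "S q \<in> sets borel" for q unfolding S_def by (rule grid_fiber_borel)
    fix k p :: "real^3" assume p: "p \<in> torus"
    have "(\<Sum>q\<in>grid n ` torus. G b k q * indicator (S q) p) = (\<Sum>q\<in>grid n ` torus. if q = grid n p then G b k (grid n p) else 0)"
      by (intro sum.cong) (auto simp: S_def indicator_def)
    also have "\<dots> = G b k (grid n p)" using p finite_grid[of n] by simp
    finally have eq: "(\<Sum>q\<in>grid n ` torus. G b k q * indicator (S q) p) = G b k (grid n p)" .
    have "\<bar>G b k p - G b k (grid n p)\<bar> \<le> 5 / b\<^sup>2 * norm (p - grid n p)"
      using G_Lipschitz[OF b, of k p k "grid n p"] by simp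
    also have "\<dots> \<le> 5 / b\<^sup>2 * (3 / real n)" by (intro mult_left_mono norm_grid_le n0) simp
    also have "\<dots> \<le> \<eta>" using n n0 b \<eta> by (simp add: field_simps)
    finally show "\<bar>G b k p - (\<Sum>q\<in>grid n ` torus. G b k q * indicator (S q) p)\<bar> \<le> \<eta>" unfolding eq .
  qed
qed

section \<open>The quadratic form of the integral operator\<close>

lemma torus2_integral_product:
  assumes f: "sq_integrable torus_measure f" and g: "sq_integrable torus_measure g"
  shows "integrable torus2_measure (\<lambda>x. f (fst x) * cnj (g (snd x)))"
    and "(\<integral>x. f (fst x) * cnj (g (snd x)) \<partial>torus2_measure)
      = (\<integral>k. f k \<partial>torus_measure) * cnj (\<integral>p. g p \<partial>torus_measure)"
proof -
  show i: "integrable torus2_measure (\<lambda>x. f (fst x) * cnj (g (snd x)))"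
    using L2_rel_fst_snd[of f f] L2_rel_fst_snd[of g g] f g by (intro sq_integrable_inner) (auto simp: L2_rel_refl)
  show "(\<integral>x. f (fst x) * cnj (g (snd x)) \<partial>torus2_measure)
      = (\<integral>k. f k \<partial>torus_measure) * cnj (\<integral>p. g p \<partial>torus_measure)"
    using torus2.integral_fst'[OF i] by simp
qed

lemma sq_integrable_bounded_mult:
  assumes "sq_integrable M f" "w \<in> borel_measurable M" "\<And>x. \<bar>w x\<bar> \<le> B"
  shows "sq_integrable M (\<lambda>x. complex_of_real (w x) * f x)"
  by (rule sq_integrable_mult_bounded[OF assms(1), where B = B]) (use assms in auto)

lemma G_abs_le: "b < 0 \<Longrightarrow> \<bar>G b k p\<bar> \<le> 1 / (- b)"
  using G_bounds[of b k p] by simp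

definition kernel_form :: "real \<Rightarrow> (real^3 \<Rightarrow> complex) \<Rightarrow> complex" where
  "kernel_form b \<phi> = (\<integral>x. complex_of_real (G b (fst x) (snd x)) * (\<phi> (fst x) * cnj (\<phi> (snd x))) \<partial>torus2_measure)"

lemma integrable_kernel_form:
  assumes b: "b < 0" and \<phi>: "sq_integrable torus_measure \<phi>"
  shows "integrable torus2_measure (\<lambda>x. complex_of_real (G b (fst x) (snd x)) * (\<phi> (fst x) * cnj (\<phi> (snd x))))"
proof -
  have p: "sq_integrable torus2_measure (\<lambda>x. \<phi> (fst x))" "sq_integrable torus2_measure (\<lambda>x. \<phi> (snd x))"
    using L2_rel_fst_snd[of \<phi> \<phi>] \<phi> by (auto simp: L2_rel_refl)
  have "sq_integrable torus2_measure (\<lambda>x. complex_of_real (G b (fst x) (snd x)) * \<phi> (fst x))"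
    by (rule sq_integrable_bounded_mult[OF p(1) G_measurable2 G_abs_le[OF b]])
  from sq_integrable_inner[OF this p(2)] show ?thesis by (simp add: mult.assoc)
qed

text \<open>The kernel error costs \<open>\<eta>\<close> times the square of the integral of
  \<open>cmod (\<phi> k)\<close>, which Cauchy-Schwarz turns into a small multiple of the squared
  norm. The degenerate part separates into products of two integrals of \<open>\<phi>\<close>, that
  is, finitely many bounded functionals.\<close>

lemma kernel_form_bound:
  assumes b: "b < 0" and \<phi>: "sq_integrable torus_measure \<phi>" and R: "finite R" "\<And>q. S q \<in> sets borel"
    and approx: "\<And>k p. p \<in> torus \<Longrightarrow> \<bar>G b k p - (\<Sum>q\<in>R. G b k q * indicator (S q) p)\<bar> \<le> \<eta>"
  shows "cmod (kernel_form b \<phi>) \<le> \<eta> * (torus_vol + 1) * (\<integral>k. (cmod (\<phi> k))\<^sup>2 \<partial>torus_measure)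
    + (\<Sum>q\<in>R. cmod (\<integral>k. complex_of_real (G b k q) * \<phi> k \<partial>torus_measure)
        * cmod (\<integral>p. complex_of_real (indicator (S q) p) * \<phi> p \<partial>torus_measure))"
proof -
  have \<phi>m [measurable]: "\<phi> \<in> borel_measurable torus_measure" using \<phi> by (simp add: sq_integrable_def)
  define c where "c q k = complex_of_real (G b k q) * \<phi> k" for q k
  define d where "d q p = complex_of_real (indicator (S q) p) * \<phi> p" for q p
  have c: "sq_integrable torus_measure (c q)" for q
    unfolding c_def using G_measurable1[of b q] G_abs_le[OF b]
    by (intro sq_integrable_bounded_mult[OF \<phi>, where B = "1 / (- b)"]) (simp_all add: G_commute[of b _ q] cong: measurable_cong)
  have d: "sq_integrable torus_measure (d q)" for q
    unfolding d_def using R(2)[of q]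
    by (intro sq_integrable_bounded_mult[OF \<phi>, where B = 1]) (auto simp: indicator_def)
  define F where "F x = complex_of_real (G b (fst x) (snd x)) * (\<phi> (fst x) * cnj (\<phi> (snd x)))" for x
  have F: "integrable torus2_measure F" unfolding F_def by (rule integrable_kernel_form[OF b \<phi>])
  define D where "D x = (\<Sum>q\<in>R. c q (fst x) * cnj (d q (snd x)))" for x
  have D: "integrable torus2_measure D"
    unfolding D_def by (intro Bochner_Integration.integrable_sum torus2_integral_product c d)
  have D_int: "(\<integral>x. D x \<partial>torus2_measure) = (\<Sum>q\<in>R. (\<integral>k. c q k \<partial>torus_measure) * cnj (\<integral>p. d q p \<partial>torus_measure))"
    unfolding D_def
    by (subst Bochner_Integration.integral_sum) (auto intro!: sum.cong torus2_integral_product c d)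
  have FD: "F x - D x = complex_of_real (G b (fst x) (snd x) - (\<Sum>q\<in>R. G b (fst x) q * indicator (S q) (snd x)))
      * (\<phi> (fst x) * cnj (\<phi> (snd x)))" for x
    unfolding F_def D_def c_def d_def of_real_diff left_diff_distrib of_real_sum sum_distrib_right
    by (simp add: mult_ac)
  have abs_\<phi>: "sq_integrable torus_measure (\<lambda>k. complex_of_real (cmod (\<phi> k)))"
    using \<phi> by (simp add: sq_integrable_def)
  have "cmod (\<integral>x. F x - D x \<partial>torus2_measure) \<le> (\<integral>x. norm (F x - D x) \<partial>torus2_measure)"
    by (rule integral_norm_bound)
  also have "\<dots> \<le> (\<integral>x. \<eta> * (cmod (\<phi> (fst x)) * cmod (\<phi> (snd x))) \<partial>torus2_measure)"
  proof (rule integral_mono_AE)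
    show "integrable torus2_measure (\<lambda>x. norm (F x - D x))" using F D by (intro integrable_norm Bochner_Integration.integrable_diff)
    show "integrable torus2_measure (\<lambda>x. \<eta> * (cmod (\<phi> (fst x)) * cmod (\<phi> (snd x))))"
      using integrable_norm[OF torus2_integral_product(1)[OF \<phi> \<phi>]] by (simp add: norm_mult)
    show "AE x in torus2_measure. norm (F x - D x) \<le> \<eta> * (cmod (\<phi> (fst x)) * cmod (\<phi> (snd x)))"
      using AE_space
    proof eventually_elim
      case (elim x)
      then have "snd x \<in> torus" by (auto simp: space_pair_measure)
      then show ?case unfolding FD norm_mult norm_of_real complex_mod_cnj
        by (intro mult_right_mono approx) auto
    qed
  qed
  also have "\<dots> = \<eta> * (\<integral>x. cmod (\<phi> (fst x)) * cmod (\<phi> (snd x)) \<partial>torus2_measure)" by simp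
  also have "(\<integral>x. cmod (\<phi> (fst x)) * cmod (\<phi> (snd x)) \<partial>torus2_measure) = (\<integral>k. cmod (\<phi> k) \<partial>torus_measure)\<^sup>2"
  proof -
    have i: "integrable torus2_measure (\<lambda>x. cmod (\<phi> (fst x)) * cmod (\<phi> (snd x)))"
      using integrable_norm[OF torus2_integral_product(1)[OF \<phi> \<phi>]] by (simp add: norm_mult)
    show ?thesis using torus2.integral_fst'[OF i] by (simp add: power2_eq_square)
  qed
  also have "\<eta> * \<dots> \<le> \<eta> * ((torus_vol + 1) * (\<integral>k. (cmod (\<phi> k))\<^sup>2 \<partial>torus_measure))"
  proof (rule mult_left_mono)
    show "(\<integral>k. cmod (\<phi> k) \<partial>torus_measure)\<^sup>2 \<le> (torus_vol + 1) * (\<integral>k. (cmod (\<phi> k))\<^sup>2 \<partial>torus_measure)"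
      using sq_integrable_integral[OF finite_measure_torus abs_\<phi>] by (simp add: torus_vol_def)
    have "0 \<in> torus" by (simp add: torus_def)
    from approx[OF this, of 0] show "0 \<le> \<eta>" by linarith
  qed
  finally have 1: "cmod (\<integral>x. F x - D x \<partial>torus2_measure) \<le> \<eta> * (torus_vol + 1) * (\<integral>k. (cmod (\<phi> k))\<^sup>2 \<partial>torus_measure)"
    by (simp add: mult.assoc)
  have 2: "cmod (\<integral>x. D x \<partial>torus2_measure) \<le> (\<Sum>q\<in>R. cmod (\<integral>k. c q k \<partial>torus_measure) * cmod (\<integral>p. d q p \<partial>torus_measure))"
    unfolding D_int by (rule order_trans[OF norm_sum]) (simp add: norm_mult)
  have "kernel_form b \<phi> = (\<integral>x. F x - D x \<partial>torus2_measure) + (\<integral>x. D x \<partial>torus2_measure)"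
  proof -
    have "kernel_form b \<phi> = (\<integral>x. F x \<partial>torus2_measure)" by (simp only: kernel_form_def F_def)
    with F D show ?thesis by simp
  qed
  then have "cmod (kernel_form b \<phi>) \<le> cmod (\<integral>x. F x - D x \<partial>torus2_measure) + cmod (\<integral>x. D x \<partial>torus2_measure)"
    by (simp add: norm_triangle_ineq)
  with 1 2 show ?thesis unfolding c_def d_def by linarith
qed

lemma inner_abs_L2_torus:
  assumes "sq_integrable torus_measure f" "sq_integrable torus_measure g"
  shows "inner (abs_L2_torus f) (abs_L2_torus g) = Re (\<integral>k. f k * cnj (g k) \<partial>torus_measure)"
  using assms by (simp add: inner_L2_torus.abs_eq L2_rel_refl L2_inner_def)

lemma inner_abs_L2_sym:
  assumes "L2_sym_rel f f" "L2_sym_rel g g"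
  shows "inner (abs_L2_sym f) (abs_L2_sym g) = Re (\<integral>x. f x * cnj (g x) \<partial>torus2_measure)"
  using assms by (simp add: inner_L2_sym.abs_eq L2_inner_def)

text \<open>\<open>inner\<close> sees only real parts; testing with \<open>g\<close> and with
  \<open>\<i> * g\<close> recovers both components of the complex integral.\<close>

lemma functional_norm_sq:
  assumes g: "sq_integrable torus_measure (\<lambda>t. complex_of_real (g t))" and \<phi>: "sq_integrable torus_measure \<phi>"
  shows "(inner (abs_L2_torus (\<lambda>t. complex_of_real (g t))) (abs_L2_torus \<phi>))\<^sup>2
    + (inner (abs_L2_torus (\<lambda>t. \<i> * complex_of_real (g t))) (abs_L2_torus \<phi>))\<^sup>2
    = (cmod (\<integral>t. complex_of_real (g t) * \<phi> t \<partial>torus_measure))\<^sup>2"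
proof -
  define w where "w = (\<integral>t. complex_of_real (g t) * \<phi> t \<partial>torus_measure)"
  have w: "(\<integral>t. complex_of_real (g t) * cnj (\<phi> t) \<partial>torus_measure) = cnj w"
    unfolding w_def by (subst Bochner_Integration.integral_cnj[symmetric]) simp
  have 1: "inner (abs_L2_torus (\<lambda>t. complex_of_real (g t))) (abs_L2_torus \<phi>) = Re w"
    by (simp add: inner_abs_L2_torus g \<phi> w)
  have 2: "inner (abs_L2_torus (\<lambda>t. \<i> * complex_of_real (g t))) (abs_L2_torus \<phi>) = Im w"
    by (simp add: inner_abs_L2_torus sq_integrable_cmult g \<phi> w mult.assoc del: integral_complex_of_real)
  show ?thesis unfolding 1 2 w_def[symmetric] by (simp add: cmod_power2)
qed

lemma complete_square:
  fixes \<mu> s \<kappa> p q :: real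
  assumes "s > 0" "\<kappa> > 0"
  shows "2 * (\<bar>\<mu>\<bar> * p * q) \<le> \<kappa> * \<mu>\<^sup>2 * p\<^sup>2 / s + s * q\<^sup>2 / \<kappa>"
proof -
  have "0 \<le> (\<kappa> * \<bar>\<mu>\<bar> * p - s * q)\<^sup>2 / (\<kappa> * s)" using assms by simp
  also have "\<dots> = \<kappa> * \<mu>\<^sup>2 * p\<^sup>2 / s + s * q\<^sup>2 / \<kappa> - 2 * (\<bar>\<mu>\<bar> * p * q)"
    using assms by (simp add: power2_diff power_mult_distrib field_simps power2_eq_square)
  finally show ?thesis by simp
qed

text \<open>Completing the square in the two-particle component, with \<open>\<kappa> > 1\<close> leaving a part of
  \<open>A22 - b\<close> over.\<close>

lemma A_op_form_lower_bound:
  assumes b: "b < 0" and \<kappa>: "\<kappa> > 1" and \<phi>: "sq_integrable torus_measure \<phi>" and \<psi>: "L2_sym_rel \<psi> \<psi>"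
  defines "x \<equiv> (abs_L2_torus \<phi>, abs_L2_sym \<psi>)"
  shows "(\<integral>k. (Dl \<gamma> \<mu> b k - (\<kappa> - 1) * (\<mu>\<^sup>2 / 2 * I_int b k)) * (cmod (\<phi> k))\<^sup>2 \<partial>torus_measure)
      - \<kappa> * \<mu>\<^sup>2 / 2 * Re (kernel_form b \<phi>) + (1 - 1 / \<kappa>) * (- b) * (norm (abs_L2_sym \<psi>))\<^sup>2
    \<le> inner (A_op \<gamma> \<mu> x - b *\<^sub>R x) x"
proof -
  have \<phi>': "L2_rel torus_measure \<phi> \<phi>" using \<phi> by (simp add: L2_rel_refl)
  have \<phi>m [measurable]: "\<phi> \<in> borel_measurable torus_measure" using \<phi> by (simp add: sq_integrable_def)
  have \<psi>': "sq_integrable torus2_measure \<psi>" using \<psi> by (simp add: L2_sym_rel_def L2_rel_refl)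
  define h where "h x = (\<phi> (fst x) + \<phi> (snd x)) / 2" for x
  have p: "sq_integrable torus2_measure (\<lambda>x. \<phi> (fst x))" "sq_integrable torus2_measure (\<lambda>x. \<phi> (snd x))"
    using L2_rel_fst_snd[OF \<phi>'] by (auto simp: L2_rel_refl)
  have h: "sq_integrable torus2_measure h"
    using sq_integrable_cmult[OF sq_integrable_add[OF p], of "1/2"] by (simp add: h_def[abs_def])
  then have h': "L2_sym_rel h h" by (simp add: L2_sym_rel_def L2_rel_refl h_def add.commute)
  define W where "W x = w2 (fst x) (snd x)" for x
  define g where "g x = G b (fst x) (snd x)" for x
  have Wm: "W \<in> borel_measurable torus2_measure" unfolding W_def using w2_measurable .
  have gm: "g \<in> borel_measurable torus2_measure" unfolding g_def using G_measurable2 .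
  have W: "\<bar>W x\<bar> \<le> 18" for x unfolding W_def by (rule w2_bound)
  have g: "\<bar>g x\<bar> \<le> 1 / (- b)" "0 < g x" for x unfolding g_def using G_abs_le[OF b] G_bounds(1)[OF b] by auto
  have sq_int: "integrable torus2_measure (\<lambda>x. u x * (cmod (f x))\<^sup>2)"
    if f: "sq_integrable torus2_measure f" and u: "u \<in> borel_measurable torus2_measure" "\<And>x. \<bar>u x\<bar> \<le> B" for f u B
  proof -
    have "integrable torus2_measure (\<lambda>x. Re (complex_of_real (u x) * f x * cnj (f x)))"
      using sq_integrable_inner[OF sq_integrable_bounded_mult[OF f u] f] by (rule integrable_Re)
    moreover have "Re (complex_of_real (u x) * f x * cnj (f x)) = u x * (cmod (f x))\<^sup>2" for x
      by (simp add: mult.assoc complex_norm_square[symmetric] flip: of_real_power of_real_mult)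
    ultimately show ?thesis by simp
  qed
  have N1: "(norm (abs_L2_torus \<phi>))\<^sup>2 = (\<integral>k. (cmod (\<phi> k))\<^sup>2 \<partial>torus_measure)" by (rule norm_abs_L2_torus[OF \<phi>])
  have N2: "(norm (abs_L2_sym \<psi>))\<^sup>2 = (\<integral>x. (cmod (\<psi> x))\<^sup>2 \<partial>torus2_measure)" by (rule norm_abs_L2_sym[OF \<psi>])
  have A11: "inner (A11 \<gamma> (abs_L2_torus \<phi>)) (abs_L2_torus \<phi>) = (\<integral>k. w1 \<gamma> k * (cmod (\<phi> k))\<^sup>2 \<partial>torus_measure)"
  proof -
    have "complex_of_real (w1 \<gamma> k) * \<phi> k * cnj (\<phi> k) = complex_of_real (w1 \<gamma> k * (cmod (\<phi> k))\<^sup>2)" for k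
      by (simp add: mult.assoc complex_norm_square[symmetric] flip: of_real_power)
    then show ?thesis
      using L2_rel_mult_bounded[OF \<phi>' _ w1_bound, of \<gamma>] \<phi>
      by (simp add: A11.abs_eq[OF \<phi>'] inner_abs_L2_torus L2_rel_refl del: of_real_mult)
  qed
  have A22: "inner (A22 (abs_L2_sym \<psi>)) (abs_L2_sym \<psi>) = (\<integral>x. W x * (cmod (\<psi> x))\<^sup>2 \<partial>torus2_measure)"
  proof -
    have "complex_of_real (w2 (fst x) (snd x)) * \<psi> x * cnj (\<psi> x) = complex_of_real (W x * (cmod (\<psi> x))\<^sup>2)" for x
      by (simp add: W_def mult.assoc complex_norm_square[symmetric] flip: of_real_power)
    then show ?thesis
      using L2_sym_rel_mult_w2[OF \<psi>] \<psi> by (simp add: A22.abs_eq inner_abs_L2_sym del: of_real_mult)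
  qed
  have i_h\<psi>: "integrable torus2_measure (\<lambda>x. h x * cnj (\<psi> x))" by (rule sq_integrable_inner[OF h \<psi>'])
  define \<rho> where "\<rho> x = Re (h x * cnj (\<psi> x))" for x
  have i_\<rho>: "integrable torus2_measure \<rho>" unfolding \<rho>_def by (rule integrable_Re[OF i_h\<psi>])
  have "inner (A12_adj (abs_L2_torus \<phi>)) (abs_L2_sym \<psi>) = Re (\<integral>x. h x * cnj (\<psi> x) \<partial>torus2_measure)"
    using h' \<psi> by (simp add: A12_adj.abs_eq[OF \<phi>'] inner_abs_L2_sym h_def[symmetric, abs_def])
  also have "\<dots> = (\<integral>x. \<rho> x \<partial>torus2_measure)"
    unfolding \<rho>_def by (rule integral_Re[OF i_h\<psi>, symmetric])
  finally have A12: "inner (A12_adj (abs_L2_torus \<phi>)) (abs_L2_sym \<psi>) = (\<integral>x. \<rho> x \<partial>torus2_measure)" .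
  have i1: "integrable torus2_measure (\<lambda>x. (W x - b) * (cmod (\<psi> x))\<^sup>2)"
  proof (rule sq_int[OF \<psi>'])
    show "(\<lambda>x. W x - b) \<in> borel_measurable torus2_measure" using Wm by measurable
    show "\<bar>W x - b\<bar> \<le> 18 - b" for x using W[of x] b by linarith
  qed
  have i2: "integrable torus2_measure (\<lambda>x. g x * (cmod (h x))\<^sup>2)" by (rule sq_int[OF h gm g(1)])
  have i3: "integrable torus2_measure (\<lambda>x. (cmod (\<psi> x))\<^sup>2)" using \<psi>' by (simp add: sq_integrable_def)
  have i4: "integrable torus2_measure (\<lambda>x. W x * (cmod (\<psi> x))\<^sup>2)" by (rule sq_int[OF \<psi>' Wm W])
  have "inner (A_op \<gamma> \<mu> x - b *\<^sub>R x) x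
      = inner (A11 \<gamma> (abs_L2_torus \<phi>)) (abs_L2_torus \<phi>) - b * (norm (abs_L2_torus \<phi>))\<^sup>2
        + (2 * \<mu> * inner (A12_adj (abs_L2_torus \<phi>)) (abs_L2_sym \<psi>)
        + inner (A22 (abs_L2_sym \<psi>)) (abs_L2_sym \<psi>) - b * (norm (abs_L2_sym \<psi>))\<^sup>2)"
    using A12_adj_inner[of "abs_L2_sym \<psi>" "abs_L2_torus \<phi>"]
    by (simp add: x_def A_op_def inner_prod_def inner_add_left inner_diff_left power2_norm_eq_inner
        inner_commute[of "abs_L2_sym \<psi>" "A12_adj (abs_L2_torus \<phi>)"])
  also have "2 * \<mu> * inner (A12_adj (abs_L2_torus \<phi>)) (abs_L2_sym \<psi>)
        + inner (A22 (abs_L2_sym \<psi>)) (abs_L2_sym \<psi>) - b * (norm (abs_L2_sym \<psi>))\<^sup>2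
      = (\<integral>x. 2 * \<mu> * \<rho> x + (W x - b) * (cmod (\<psi> x))\<^sup>2 \<partial>torus2_measure)"
    using i_\<rho> i1 i3 i4 unfolding A12 A22 N2 by (simp add: left_diff_distrib)
  finally have form: "inner (A_op \<gamma> \<mu> x - b *\<^sub>R x) x = (\<integral>k. w1 \<gamma> k * (cmod (\<phi> k))\<^sup>2 \<partial>torus_measure)
      - b * (\<integral>k. (cmod (\<phi> k))\<^sup>2 \<partial>torus_measure)
      + (\<integral>x. 2 * \<mu> * \<rho> x + (W x - b) * (cmod (\<psi> x))\<^sup>2 \<partial>torus2_measure)"
    unfolding A11 N1 .
  have "(\<integral>x. (1 - 1 / \<kappa>) * (- b) * (cmod (\<psi> x))\<^sup>2 - \<kappa> * \<mu>\<^sup>2 * (g x * (cmod (h x))\<^sup>2) \<partial>torus2_measure)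
      \<le> (\<integral>x. 2 * \<mu> * \<rho> x + (W x - b) * (cmod (\<psi> x))\<^sup>2 \<partial>torus2_measure)"
  proof (rule integral_mono)
    fix x
    have s: "W x - b > 0" using w2_nonneg[of "fst x" "snd x"] b by (simp add: W_def)
    have "\<bar>\<rho> x\<bar> \<le> cmod (h x) * cmod (\<psi> x)"
      using abs_Re_le_cmod[of "h x * cnj (\<psi> x)"] unfolding \<rho>_def norm_mult complex_mod_cnj .
    then have "\<bar>\<mu>\<bar> * \<bar>\<rho> x\<bar> \<le> \<bar>\<mu>\<bar> * (cmod (h x) * cmod (\<psi> x))" by (rule mult_left_mono) simp
    then have "- (2 * \<mu> * \<rho> x) \<le> 2 * (\<bar>\<mu>\<bar> * cmod (h x) * cmod (\<psi> x))"
      using abs_ge_minus_self[of "\<mu> * \<rho> x"] by (simp only: abs_mult mult.assoc)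
    also have "\<dots> \<le> \<kappa> * \<mu>\<^sup>2 * (cmod (h x))\<^sup>2 / (W x - b) + (W x - b) * (cmod (\<psi> x))\<^sup>2 / \<kappa>"
      by (rule complete_square[OF s]) (use \<kappa> in simp)
    also have "\<kappa> * \<mu>\<^sup>2 * (cmod (h x))\<^sup>2 / (W x - b) = \<kappa> * \<mu>\<^sup>2 * (g x * (cmod (h x))\<^sup>2)"
      by (simp add: g_def G_def W_def)
    finally have 1: "- (2 * \<mu> * \<rho> x)
        \<le> \<kappa> * \<mu>\<^sup>2 * (g x * (cmod (h x))\<^sup>2) + (W x - b) * (cmod (\<psi> x))\<^sup>2 / \<kappa>" .
    have "(1 - 1 / \<kappa>) * (- b) * (cmod (\<psi> x))\<^sup>2 \<le> (1 - 1 / \<kappa>) * (W x - b) * (cmod (\<psi> x))\<^sup>2"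
      using \<kappa> w2_nonneg[of "fst x" "snd x"] by (intro mult_right_mono mult_left_mono) (auto simp: W_def)
    also have "\<dots> = (W x - b) * (cmod (\<psi> x))\<^sup>2 - (W x - b) * (cmod (\<psi> x))\<^sup>2 / \<kappa>"
      by (simp add: field_simps)
    finally show "(1 - 1 / \<kappa>) * (- b) * (cmod (\<psi> x))\<^sup>2 - \<kappa> * \<mu>\<^sup>2 * (g x * (cmod (h x))\<^sup>2)
        \<le> 2 * \<mu> * \<rho> x + (W x - b) * (cmod (\<psi> x))\<^sup>2"
      using 1 by linarith
  qed (use i1 i2 i3 i_\<rho> in auto)
  also have "(\<integral>x. (1 - 1 / \<kappa>) * (- b) * (cmod (\<psi> x))\<^sup>2 - \<kappa> * \<mu>\<^sup>2 * (g x * (cmod (h x))\<^sup>2) \<partial>torus2_measure)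
      = (1 - 1 / \<kappa>) * (- b) * (norm (abs_L2_sym \<psi>))\<^sup>2 - \<kappa> * \<mu>\<^sup>2 * (\<integral>x. g x * (cmod (h x))\<^sup>2 \<partial>torus2_measure)"
    using i2 i3 unfolding N2 by simp
  finally have lower: "(1 - 1 / \<kappa>) * (- b) * (norm (abs_L2_sym \<psi>))\<^sup>2 - \<kappa> * \<mu>\<^sup>2 * (\<integral>x. g x * (cmod (h x))\<^sup>2 \<partial>torus2_measure)
      \<le> (\<integral>x. 2 * \<mu> * \<rho> x + (W x - b) * (cmod (\<psi> x))\<^sup>2 \<partial>torus2_measure)" .
  have diag: "(\<integral>x. g x * (cmod (\<phi> (fst x)))\<^sup>2 \<partial>torus2_measure) = (\<integral>k. I_int b k * (cmod (\<phi> k))\<^sup>2 \<partial>torus_measure)"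
    "integrable torus_measure (\<lambda>k. I_int b k * (cmod (\<phi> k))\<^sup>2)"
  proof -
    have "(\<integral>p. g (k, p) \<partial>torus_measure) = I_int b k" for k
      by (simp add: g_def I_int_def)
    with torus2.integral_fst'[OF sq_int[OF p(1) gm g(1)]] torus2.integrable_fst'[OF sq_int[OF p(1) gm g(1)]]
    show "(\<integral>x. g x * (cmod (\<phi> (fst x)))\<^sup>2 \<partial>torus2_measure) = (\<integral>k. I_int b k * (cmod (\<phi> k))\<^sup>2 \<partial>torus_measure)"
      "integrable torus_measure (\<lambda>k. I_int b k * (cmod (\<phi> k))\<^sup>2)" by simp_all
  qed
  have swap: "(\<integral>x. g x * (cmod (\<phi> (snd x)))\<^sup>2 \<partial>torus2_measure) = (\<integral>x. g x * (cmod (\<phi> (fst x)))\<^sup>2 \<partial>torus2_measure)"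
    using integral_torus2_swap[OF borel_measurable_integrable[OF sq_int[OF p(1) gm g(1)]]]
    by (simp add: g_def G_commute)
  define \<tau> where "\<tau> x = Re (complex_of_real (g x) * (\<phi> (fst x) * cnj (\<phi> (snd x))))" for x
  have i_\<tau>: "integrable torus2_measure \<tau>"
    unfolding \<tau>_def g_def by (rule integrable_Re[OF integrable_kernel_form[OF b \<phi>]])
  \<comment> \<open>Expansion of the square of the mean: the two diagonal terms have equal integrals
    and together give half of \<open>I_int\<close>, the mixed term gives half of
    \<open>kernel_form\<close>. Multiplied by \<open>\<kappa> * \<mu>\<^sup>2\<close>, the former is
    the interaction term of \<open>Dl\<close> enlarged by the factor
    \<open>\<kappa>\<close>.\<close>
  have "g x * (cmod (h x))\<^sup>2 = 1/4 * (g x * (cmod (\<phi> (fst x)))\<^sup>2) + 1/4 * (g x * (cmod (\<phi> (snd x)))\<^sup>2)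
      + 1/2 * \<tau> x" for x
  proof -
    have "(cmod (u + v))\<^sup>2 = (cmod u)\<^sup>2 + (cmod v)\<^sup>2 + 2 * Re (u * cnj v)" for u v
      unfolding cmod_power2 by (simp add: power2_eq_square algebra_simps)
    note * = this
    define r where "r = Re (\<phi> (fst x) * cnj (\<phi> (snd x)))"
    have "(cmod (h x))\<^sup>2 = ((cmod (\<phi> (fst x)))\<^sup>2 + (cmod (\<phi> (snd x)))\<^sup>2 + 2 * r) / 4"
      unfolding h_def norm_divide power_divide * r_def by simp
    moreover have "\<tau> x = g x * r" unfolding \<tau>_def r_def by (simp add: algebra_simps)
    ultimately show ?thesis by (simp add: field_simps)
  qed
  then have "(\<integral>x. g x * (cmod (h x))\<^sup>2 \<partial>torus2_measure)
      = (\<integral>x. 1/4 * (g x * (cmod (\<phi> (fst x)))\<^sup>2) + 1/4 * (g x * (cmod (\<phi> (snd x)))\<^sup>2)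
      + 1/2 * \<tau> x \<partial>torus2_measure)" by simp
  also have "\<dots> = 1/4 * (\<integral>x. g x * (cmod (\<phi> (fst x)))\<^sup>2 \<partial>torus2_measure)
      + 1/4 * (\<integral>x. g x * (cmod (\<phi> (snd x)))\<^sup>2 \<partial>torus2_measure)
      + 1/2 * (\<integral>x. \<tau> x \<partial>torus2_measure)"
    using sq_int[OF p(1) gm g(1)] sq_int[OF p(2) gm g(1)] i_\<tau>
    by simp
  also have "(\<integral>x. \<tau> x \<partial>torus2_measure) = Re (kernel_form b \<phi>)"
    unfolding kernel_form_def g_def \<tau>_def by (rule integral_Re[OF integrable_kernel_form[OF b \<phi>]])
  finally have gh: "(\<integral>x. g x * (cmod (h x))\<^sup>2 \<partial>torus2_measure)
      = 1/2 * (\<integral>k. I_int b k * (cmod (\<phi> k))\<^sup>2 \<partial>torus_measure) + 1/2 * Re (kernel_form b \<phi>)"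
    unfolding swap diag(1) by simp
  have i5: "integrable torus_measure (\<lambda>k. (cmod (\<phi> k))\<^sup>2)" using \<phi> by (simp add: sq_integrable_def)
  have i6: "integrable torus_measure (\<lambda>k. w1 \<gamma> k * (cmod (\<phi> k))\<^sup>2)"
  proof (rule Bochner_Integration.integrable_bound[of _ "\<lambda>k. (6 + \<bar>\<gamma>\<bar>) * (cmod (\<phi> k))\<^sup>2"])
    show "AE k in torus_measure. norm (w1 \<gamma> k * (cmod (\<phi> k))\<^sup>2) \<le> norm ((6 + \<bar>\<gamma>\<bar>) * (cmod (\<phi> k))\<^sup>2)"
      using w1_bound[of \<gamma>] by (intro AE_I2) (simp add: abs_mult mult_right_mono)
  qed (use i5 in auto)
  have "(\<integral>k. (Dl \<gamma> \<mu> b k - (\<kappa> - 1) * (\<mu>\<^sup>2 / 2 * I_int b k)) * (cmod (\<phi> k))\<^sup>2 \<partial>torus_measure)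
      = (\<integral>k. w1 \<gamma> k * (cmod (\<phi> k))\<^sup>2 - b * (cmod (\<phi> k))\<^sup>2 - \<kappa> * \<mu>\<^sup>2 / 2 * (I_int b k * (cmod (\<phi> k))\<^sup>2) \<partial>torus_measure)"
    by (rule Bochner_Integration.integral_cong[OF refl]) (simp add: Dl_def field_simps)
  also have "\<dots> = (\<integral>k. w1 \<gamma> k * (cmod (\<phi> k))\<^sup>2 \<partial>torus_measure) - b * (\<integral>k. (cmod (\<phi> k))\<^sup>2 \<partial>torus_measure)
      - \<kappa> * \<mu>\<^sup>2 / 2 * (\<integral>k. I_int b k * (cmod (\<phi> k))\<^sup>2 \<partial>torus_measure)"
    using i5 i6 diag(2) by simp
  finally show ?thesis unfolding form using lower unfolding gh by (simp add: algebra_simps)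
qed

text \<open>The margin \<open>\<delta> = Dl \<gamma> \<mu> b 0\<close> is a lower bound for
  \<open>Dl\<close> on the torus and is spent in parts: a quarter pays for
  \<open>\<kappa> > 1\<close>, which keeps a positive multiple of the two-particle norm, a quarter
  for the error of the degenerate kernel, and the remaining half is the coercivity in the
  one-particle component.\<close>

lemma A_op_discrete_spectrumI:
  assumes b: "b < 0" and pos: "0 < Dl \<gamma> \<mu> b 0" and spec: "complex_of_real b \<in> spectrum (A_op \<gamma> \<mu>)"
  shows "complex_of_real b \<in> discrete_spectrum (A_op \<gamma> \<mu>)"
proof -
  interpret self_adjoint_op "A_op \<gamma> \<mu>" by (rule self_adjoint_A_op)
  define \<delta> where "\<delta> = Dl \<gamma> \<mu> b 0"
  define X where "X = \<mu>\<^sup>2 / 2 * (torus_vol / (- b))"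
  have X: "X \<ge> 0" unfolding X_def using b torus_vol_nonneg by (intro mult_nonneg_nonneg divide_nonneg_nonneg) auto
  \<comment> \<open>Dividing by \<open>X + 1\<close> instead of \<open>X\<close> covers a vanishing
    interaction; the same precaution explains \<open>Y + 1\<close> in \<open>\<eta>\<close>.\<close>
  define \<kappa> where "\<kappa> = 1 + \<delta> / 4 / (X + 1)"
  have \<delta>: "\<delta> > 0" using pos by (simp add: \<delta>_def)
  have \<kappa>: "\<kappa> > 1" using \<delta> X by (simp add: \<kappa>_def)
  have cancel: "u / w * w = u" if "w \<noteq> 0" for u w :: real using that by simp
  have \<kappa>X: "(\<kappa> - 1) * X \<le> \<delta> / 4"
  proof -
    have "(\<kappa> - 1) * X \<le> (\<kappa> - 1) * (X + 1)" using \<kappa> by (intro mult_left_mono) auto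
    also have "\<dots> = \<delta> / 4" unfolding \<kappa>_def add_diff_cancel_left' by (rule cancel) (use X in simp)
    finally show ?thesis .
  qed
  define Y where "Y = \<kappa> * \<mu>\<^sup>2 / 2"
  have Y: "Y \<ge> 0" using \<kappa> by (simp add: Y_def)
  define \<eta> where "\<eta> = \<delta> / 4 / (Y + 1) / (torus_vol + 1)"
  have \<eta>: "\<eta> > 0" using \<delta> Y torus_vol_nonneg by (simp add: \<eta>_def)
  have Y\<eta>: "Y * (\<eta> * (torus_vol + 1)) \<le> \<delta> / 4"
  proof -
    have "Y * (\<eta> * (torus_vol + 1)) \<le> (Y + 1) * (\<eta> * (torus_vol + 1))"
      using \<eta> torus_vol_nonneg by (intro mult_right_mono) auto
    also have "\<dots> = \<delta> / 4"
    proof -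
      have "\<eta> * (torus_vol + 1) = \<delta> / 4 / (Y + 1)"
        unfolding \<eta>_def by (rule cancel) (use torus_vol_nonneg in simp)
      then show ?thesis using cancel[of "Y + 1" "\<delta> / 4"] Y by (simp add: mult.commute)
    qed
    finally show ?thesis .
  qed
  obtain R S where R: "finite R" "\<And>q. S q \<in> sets borel"
    "\<And>k p. p \<in> torus \<Longrightarrow> \<bar>G b k p - (\<Sum>q\<in>R. G b k q * indicator (S q) p)\<bar> \<le> \<eta>"
    using G_degenerate_approx[OF b \<eta>] by blast
  define F where "F q u t = (if u then G b t q else indicator (S q) t)" for q u t
  have F: "sq_integrable torus_measure (\<lambda>t. complex_of_real (F q u t))" for q u
  proof -
    have "F q u \<in> borel_measurable torus_measure"
      using G_measurable1[of b q] R(2)[of q] unfolding F_def by (cases u) (simp_all add: G_commute[of b _ q])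
    moreover have "\<bar>F q u t\<bar> \<le> 1 / (- b) + 1" for t
      using G_abs_le[OF b, of t q] b by (auto simp: F_def indicator_def)
    ultimately have "sq_integrable torus_measure (\<lambda>t. complex_of_real (F q u t) * 1)"
      by (rule sq_integrable_bounded_mult[OF sq_integrable_const[OF finite_measure_torus]])
    then show ?thesis by simp
  qed
  \<comment> \<open>The products of functionals carry the coefficient \<open>Y\<close>, and each is
    at most half the sum of two squares; hence the weight \<open>Y / 2\<close> on every
    square.\<close>
  define s where "s = sqrt (Y / 2)"
  have s2: "s\<^sup>2 = Y / 2" using Y by (simp add: s_def)
  \<comment> \<open>The index consists of a lattice point \<open>q\<close>, the choice
    \<open>u\<close> between kernel factor and cell indicator, and the choice \<open>i\<close>
    between imaginary and real part.\<close>
  define v :: "_ \<Rightarrow> L2_torus \<times> L2_sym" where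
    "v = (\<lambda>(q, u, i). (s *\<^sub>R abs_L2_torus (\<lambda>t. (if i then \<i> else 1) * complex_of_real (F q u t)), 0))"
  define c where "c = min (\<delta> / 2) ((1 - 1 / \<kappa>) * (- b))"
  have c: "c > 0" using \<delta> \<kappa> b by (simp add: c_def mult_pos_neg)
  define D where "D k = Dl \<gamma> \<mu> b k - (\<kappa> - 1) * (\<mu>\<^sup>2 / 2 * I_int b k)" for k
  show ?thesis
  proof (rule discrete_spectrumI[of "R \<times> UNIV" c b v])
    show "finite (R \<times> (UNIV :: (bool \<times> bool) set))" using R(1) by simp
    fix x :: "L2_torus \<times> L2_sym"
    obtain \<phi> where \<phi>: "fst x = abs_L2_torus \<phi>" "sq_integrable torus_measure \<phi>" by (rule obtain_L2_torus)
    obtain \<psi> where \<psi>: "snd x = abs_L2_sym \<psi>" "L2_sym_rel \<psi> \<psi>" by (rule obtain_L2_sym)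
    have x: "x = (abs_L2_torus \<phi>, abs_L2_sym \<psi>)" using \<phi>(1) \<psi>(1) by (simp add: prod_eq_iff)
    define f where "f q u = cmod (\<integral>t. complex_of_real (F q u t) * \<phi> t \<partial>torus_measure)" for q u
    define N where "N = (\<integral>k. (cmod (\<phi> k))\<^sup>2 \<partial>torus_measure)"
    have N: "N \<ge> 0" by (simp add: N_def)
    have i5: "integrable torus_measure (\<lambda>k. (cmod (\<phi> k))\<^sup>2)" using \<phi>(2) by (simp add: sq_integrable_def)
    have ctrl: "(\<Sum>e\<in>R \<times> UNIV. (inner (v e) x)\<^sup>2) = s\<^sup>2 * (\<Sum>q\<in>R. (f q True)\<^sup>2 + (f q False)\<^sup>2)"
    proof -
      have "(\<Sum>e\<in>UNIV. (inner (v (q, e)) x)\<^sup>2) = s\<^sup>2 * ((f q True)\<^sup>2 + (f q False)\<^sup>2)" for q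
      proof -
        have "(\<Sum>i\<in>UNIV. (inner (v (q, u, i)) x)\<^sup>2) = s\<^sup>2 * (f q u)\<^sup>2" for u
          unfolding f_def functional_norm_sq[OF F \<phi>(2), symmetric]
          by (simp add: UNIV_bool v_def x inner_prod_def power_mult_distrib distrib_left)
        then show ?thesis
          by (simp add: UNIV_Times_UNIV[symmetric] sum.cartesian_product[symmetric] UNIV_bool distrib_left
              del: UNIV_Times_UNIV)
      qed
      moreover have "(\<Sum>e\<in>R \<times> UNIV. (inner (v e) x)\<^sup>2) = (\<Sum>q\<in>R. \<Sum>e\<in>UNIV. (inner (v (q, e)) x)\<^sup>2)"
        by (simp add: sum.cartesian_product)
      ultimately show ?thesis by (simp add: sum_distrib_left)
    qed
    have "Y * Re (kernel_form b \<phi>) \<le> Y * (\<eta> * (torus_vol + 1) * N + (\<Sum>q\<in>R. f q True * f q False))"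
    proof (rule mult_left_mono[OF order_trans[OF complex_Re_le_cmod] Y])
      show "cmod (kernel_form b \<phi>) \<le> \<eta> * (torus_vol + 1) * N + (\<Sum>q\<in>R. f q True * f q False)"
        using kernel_form_bound[OF b \<phi>(2) R] by (simp add: f_def F_def N_def)
    qed
    also have "\<dots> \<le> \<delta> / 4 * N + s\<^sup>2 * (\<Sum>q\<in>R. (f q True)\<^sup>2 + (f q False)\<^sup>2)"
    proof -
      have "Y * (\<eta> * (torus_vol + 1)) * N \<le> \<delta> / 4 * N" by (intro mult_right_mono Y\<eta> N)
      moreover have "Y * (\<Sum>q\<in>R. f q True * f q False) \<le> Y * (\<Sum>q\<in>R. ((f q True)\<^sup>2 + (f q False)\<^sup>2) / 2)"
      proof (intro mult_left_mono sum_mono Y)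
        show "f q True * f q False \<le> ((f q True)\<^sup>2 + (f q False)\<^sup>2) / 2" for q
          using sum_squares_bound[of "f q True" "f q False"] by simp
      qed
      moreover have "Y * (\<eta> * (torus_vol + 1) * N + (\<Sum>q\<in>R. f q True * f q False))
          = Y * (\<eta> * (torus_vol + 1)) * N + Y * (\<Sum>q\<in>R. f q True * f q False)"
        by (subst distrib_left) (simp only: mult.assoc)
      moreover have "s\<^sup>2 * (\<Sum>q\<in>R. (f q True)\<^sup>2 + (f q False)\<^sup>2) = Y * (\<Sum>q\<in>R. ((f q True)\<^sup>2 + (f q False)\<^sup>2) / 2)"
        by (simp add: s2 sum_divide_distrib[symmetric])
      ultimately show ?thesis by linarith
    qed
    finally have kern: "Y * Re (kernel_form b \<phi>) \<le> \<delta> / 4 * N + s\<^sup>2 * (\<Sum>q\<in>R. (f q True)\<^sup>2 + (f q False)\<^sup>2)" .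
    have "(3 * \<delta> / 4) * N = (\<integral>k. (3 * \<delta> / 4) * (cmod (\<phi> k))\<^sup>2 \<partial>torus_measure)" by (simp add: N_def)
    also have "\<dots> \<le> (\<integral>k. D k * (cmod (\<phi> k))\<^sup>2 \<partial>torus_measure)"
    proof (rule integral_mono_AE)
      have "(\<lambda>k. I_int b k) \<in> borel_measurable borel"
      proof (rule borel_measurable_continuous_onI)
        have "lipschitz_on (torus_vol * (5 / b\<^sup>2)) UNIV (I_int b)"
          using I_int_Lipschitz[OF b] torus_vol_nonneg by (intro lipschitz_onI) (auto simp: dist_norm mult.assoc)
        then show "continuous_on UNIV (\<lambda>k. I_int b k)" by (rule lipschitz_on_continuous_on)
      qed
      then have Dm: "(\<lambda>k. D k) \<in> borel_measurable torus_measure"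
        unfolding D_def Dl_def by measurable
      have Db: "\<bar>D k\<bar> \<le> 6 + \<bar>\<gamma>\<bar> + \<bar>b\<bar> + \<kappa> * X" for k
      proof -
        have "\<bar>\<kappa> * (\<mu>\<^sup>2 / 2 * I_int b k)\<bar> \<le> \<kappa> * X"
        proof -
          have "\<mu>\<^sup>2 / 2 * I_int b k \<le> X" unfolding X_def by (intro mult_left_mono I_int_bounds b) auto
          then have "\<kappa> * (\<mu>\<^sup>2 / 2 * I_int b k) \<le> \<kappa> * X" using \<kappa> by (intro mult_left_mono) auto
          moreover have "0 \<le> \<kappa> * (\<mu>\<^sup>2 / 2 * I_int b k)"
            using \<kappa> I_int_bounds(1)[OF b, of k] by (intro mult_nonneg_nonneg) auto
          ultimately show ?thesis by simp
        qed
        moreover have "D k = w1 \<gamma> k - b - \<kappa> * (\<mu>\<^sup>2 / 2 * I_int b k)"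
          by (simp add: D_def Dl_def left_diff_distrib diff_divide_distrib)
        ultimately show ?thesis using w1_bound[of \<gamma> k] by linarith
      qed
      show "integrable torus_measure (\<lambda>k. D k * (cmod (\<phi> k))\<^sup>2)"
      proof (rule Bochner_Integration.integrable_bound)
        show "integrable torus_measure (\<lambda>k. (6 + \<bar>\<gamma>\<bar> + \<bar>b\<bar> + \<kappa> * X) * (cmod (\<phi> k))\<^sup>2)" using i5 by simp
        show "(\<lambda>k. D k * (cmod (\<phi> k))\<^sup>2) \<in> borel_measurable torus_measure"
          using i5 by (intro borel_measurable_times Dm borel_measurable_integrable)
        show "AE k in torus_measure. norm (D k * (cmod (\<phi> k))\<^sup>2)
            \<le> norm ((6 + \<bar>\<gamma>\<bar> + \<bar>b\<bar> + \<kappa> * X) * (cmod (\<phi> k))\<^sup>2)"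
          unfolding real_norm_def abs_mult
          by (intro AE_I2 mult_right_mono order_trans[OF Db abs_ge_self]) simp
      qed
      show "AE k in torus_measure. 3 * \<delta> / 4 * (cmod (\<phi> k))\<^sup>2
          \<le> D k * (cmod (\<phi> k))\<^sup>2"
        using AE_space
      proof eventually_elim
        case (elim k)
        then have k: "k \<in> torus" by simp
        have "\<mu>\<^sup>2 / 2 * I_int b k \<le> X" unfolding X_def by (intro mult_left_mono I_int_bounds b) auto
        then have "(\<kappa> - 1) * (\<mu>\<^sup>2 / 2 * I_int b k) \<le> (\<kappa> - 1) * X" using \<kappa> by (intro mult_left_mono) auto
        then have "3 * \<delta> / 4 \<le> D k"
          using Dl_ge_origin[OF b k, of \<gamma> \<mu>] eps_nonneg[of k] \<kappa>X unfolding \<delta>_def D_def by linarith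
        then show ?case by (rule mult_right_mono) simp
      qed
    qed (use i5 in simp)
    finally have "3 * \<delta> / 4 * N - Y * Re (kernel_form b \<phi>) + (1 - 1 / \<kappa>) * (- b) * (norm (abs_L2_sym \<psi>))\<^sup>2
        \<le> inner (A_op \<gamma> \<mu> x - b *\<^sub>R x) x"
      using A_op_form_lower_bound[OF b \<kappa> \<phi>(2) \<psi>(2), of \<gamma> \<mu>] unfolding x Y_def D_def by linarith
    moreover have "c * (norm x)\<^sup>2 \<le> \<delta> / 2 * N + (1 - 1 / \<kappa>) * (- b) * (norm (abs_L2_sym \<psi>))\<^sup>2"
    proof -
      have "c * (norm x)\<^sup>2 = c * N + c * (norm (abs_L2_sym \<psi>))\<^sup>2"
        by (simp add: x norm_Pair norm_abs_L2_torus \<phi>(2) N_def distrib_left)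
      also have "\<dots> \<le> \<delta> / 2 * N + (1 - 1 / \<kappa>) * (- b) * (norm (abs_L2_sym \<psi>))\<^sup>2"
        unfolding c_def by (intro add_mono mult_right_mono N min.cobounded1 min.cobounded2) simp
      finally show ?thesis .
    qed
    ultimately show "c * (norm x)\<^sup>2 \<le> inner (A_op \<gamma> \<mu> x - b *\<^sub>R x) x + (\<Sum>e\<in>R \<times> UNIV. (inner (v e) x)\<^sup>2)"
      unfolding ctrl using kern by linarith
  qed (use c spec in auto)
qed

text \<open>Reduces the location of the minimum to the sign of a function of one real variable:
  wherever \<open>Dl \<gamma> \<mu> b 0\<close> is positive at negative \<open>b\<close>, spectrum
  is discrete.\<close>

lemma is_min_essential_spectrum:
  assumes m: "m \<le> 0" "complex_of_real m \<in> essential_spectrum (A_op \<gamma> \<mu>)"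
    and pos: "\<And>b. b < m \<Longrightarrow> 0 < Dl \<gamma> \<mu> b 0"
  shows "is_min (essential_spectrum (A_op \<gamma> \<mu>)) m"
  unfolding is_min_def
proof (intro conjI ballI)
  interpret self_adjoint_op "A_op \<gamma> \<mu>" by (rule self_adjoint_A_op)
  show "essential_spectrum (A_op \<gamma> \<mu>) \<subseteq> \<real>" by (rule essential_spectrum_real)
  show "complex_of_real m \<in> essential_spectrum (A_op \<gamma> \<mu>)" by (rule m(2))
  fix z assume z: "z \<in> essential_spectrum (A_op \<gamma> \<mu>)"
  then obtain b where b: "z = complex_of_real b"
    using essential_spectrum_real by (auto elim: Reals_cases)
  show "m \<le> Re z"
  proof (rule ccontr)
    assume "\<not> m \<le> Re z"
    then have "b < m" by (simp add: b)
    then have "z \<in> discrete_spectrum (A_op \<gamma> \<mu>)"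
      using A_op_discrete_spectrumI[of b \<gamma> \<mu>] pos[of b] m(1) z unfolding b essential_spectrum_def by simp
    with z show False by (simp add: essential_spectrum_def)
  qed
qed

theorem theorem4p3:
  fixes \<gamma> \<mu> :: real
  assumes "\<mu> > 0"
  shows
    "(\<gamma> \<le> 0 \<longrightarrow>
        is_min (Lambda \<gamma> \<mu> \<inter> complex_of_real ` {..0}) (E1 \<gamma> \<mu>) \<and>
        is_min (essential_spectrum (A_op \<gamma> \<mu>)) (E1 \<gamma> \<mu>) \<and> E1 \<gamma> \<mu> < 0) \<and>
     (\<gamma> > 0 \<longrightarrow>
        (\<mu> \<le> mu_l0 \<gamma> \<longrightarrow> is_min (essential_spectrum (A_op \<gamma> \<mu>)) 0) \<and>
        (\<mu> > mu_l0 \<gamma> \<longrightarrow>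
          is_min (Lambda \<gamma> \<mu> \<inter> complex_of_real ` {..0}) (E1 \<gamma> \<mu>) \<and>
          is_min (essential_spectrum (A_op \<gamma> \<mu>)) (E1 \<gamma> \<mu>) \<and> E1 \<gamma> \<mu> < 0))"
proof -
  \<comment> \<open>The sign of \<open>\<gamma> - \<mu>\<^sup>2 / 2 * I00\<close> decides: a
    negative value covers (A) and (B2), where \<open>E1\<close> is the root of \<open>Dl\<close> at
    the origin; otherwise \<open>Dl\<close> has no negative root there and the minimum stays at
    0.\<close>
  have strong: "is_min (Lambda \<gamma> \<mu> \<inter> complex_of_real ` {..0}) (E1 \<gamma> \<mu>) \<and>
      is_min (essential_spectrum (A_op \<gamma> \<mu>)) (E1 \<gamma> \<mu>) \<and> E1 \<gamma> \<mu> < 0"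
    if less: "\<gamma> < \<mu>\<^sup>2 / 2 * I00"
  proof -
    obtain E where E: "E < 0" "Dl \<gamma> \<mu> E 0 = 0" by (rule Dl_root[OF assms less])
    have "is_min (essential_spectrum (A_op \<gamma> \<mu>)) E"
    proof (rule is_min_essential_spectrum)
      show "0 < Dl \<gamma> \<mu> b 0" if "b < E" for b
        using Dl_strict_antimono[OF that E(1), of \<gamma> \<mu> 0] E(2) by simp
    qed (use E root_essential_spectrum in auto)
    then show ?thesis using is_min_Lambda[OF E] E(1) E1_eq[OF E] by simp
  qed
  have weak: "is_min (essential_spectrum (A_op \<gamma> \<mu>)) 0" if "\<mu>\<^sup>2 / 2 * I00 \<le> \<gamma>"
  proof (rule is_min_essential_spectrum)
    show "0 < Dl \<gamma> \<mu> b 0" if "b < 0" for b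
    proof -
      have "\<mu>\<^sup>2 / 2 * I_int b 0 \<le> \<mu>\<^sup>2 / 2 * I00" by (intro mult_left_mono I_int_zero_le_I00 that) simp
      with \<open>\<mu>\<^sup>2 / 2 * I00 \<le> \<gamma>\<close> that show ?thesis by (simp add: Dl_def w1_def eps_def)
    qed
  qed (use zero_essential_spectrum in auto)
  have threshold: "\<mu> \<le> mu_l0 \<gamma> \<longleftrightarrow> \<mu>\<^sup>2 / 2 * I00 \<le> \<gamma>" if "\<gamma> > 0"
  proof -
    have "I00 powr (- 1/2) = inverse (sqrt I00)"
      using powr_minus[of I00 "1/2"] I00_pos by (simp add: powr_half_sqrt)
    then have "mu_l0 \<gamma> = sqrt (2 * \<gamma> / I00)"
      unfolding mu_l0_def by (simp only: real_sqrt_divide divide_inverse[of "sqrt _"])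
    then have "\<mu> \<le> mu_l0 \<gamma> \<longleftrightarrow> \<mu> \<le> sqrt (2 * \<gamma> / I00)" by simp
    also have "\<dots> \<longleftrightarrow> \<mu>\<^sup>2 \<le> 2 * \<gamma> / I00"
      using assms real_le_rsqrt[of \<mu> "2 * \<gamma> / I00"] real_le_lsqrt[of "2 * \<gamma> / I00" \<mu>]
      by (metis abs_of_pos real_sqrt_abs real_sqrt_le_iff)
    also have "\<dots> \<longleftrightarrow> \<mu>\<^sup>2 / 2 * I00 \<le> \<gamma>" using I00_pos by (simp add: field_simps)
    finally show ?thesis .
  qed
  have "\<gamma> < \<mu>\<^sup>2 / 2 * I00" if "\<gamma> \<le> 0"
  proof -
    have "0 < \<mu>\<^sup>2 / 2 * I00" using assms I00_pos by simp
    with that show ?thesis by linarith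
  qed
  with strong weak threshold show ?thesis by (metis not_le)
qed

end
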